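(* Let $\lambda$ be a partition. For all $y\in\mathbb C$, $$\overset{*}{W}{}^{(\lambda)}_y=\beta\big(\hat W^{(\lambda)}_y\big),$$ where $\overset{*}{W}{}^{(\lambda)}_y$ is the span of the exceptional Hermite rational functions $R^{(\lambda)}_m(\cdot,y)$, $m\in\mathcal J^{(\lambda)}$, and $\beta$ is the bispectral involution on the adelic Grassmannian. (In particular $\overset{*}{W}{}^{(\lambda)}_y$ is a point of the adelic Grassmannian.)
   Context: Partitions: $\lambda_1\ge\lambda_2\ge\cdots\ge0$ integers, $N=|\lambda|=\sum\lambda_i<\infty$, $\ell$ the number of nonzero entries, $m_i=\lambda_i-i$ ($i\ge1$), $\mathcal J^{(\lambda)}=\mathbb Z\setminus\{m_i:i\ge1\}$, $k_i=m_i+\ell$ for $1\le i\le\ell$. Exceptional Hermite functions: $e^{xz+yz^2}=\sum_{n\ge0}H_n(x,y)z^n/n!$; with $\mathrm{Wr}$ the Wronskian in $x$, $$R^{(\lambda)}_m=\frac{1}{\prod_{i=1}^{\ell}(m-m_i)}\,\frac{\mathrm{Wr}[H_{k_\ell},\dots,H_{k_1},H_{m+\ell}]}{\mathrm{Wr}[H_{k_\ell},\dots,H_{k_1}]},\qquad m\in\mathcal J^{(\lambda)}.$$ Let $\overset{*}{W}{}^{(\lambda)}$ be the $\mathbb C[y]$-span of the $R_m^{(\lambda)}(x,y)$, $m\in\mathcal J^{(\lambda)}$; for fixed $y\in\mathbb C$, $\overset{*}{W}{}^{(\lambda)}_y$ is the $\mathbb C$-vector space of rational functions of one variable obtained by restricting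 to that value of $y$, i.e. the $\mathbb C$-span of the functions $R^{(\lambda)}_m(\cdot,y)$. Adelic Grassmannian: for $k\ge0,\zeta\in\mathbb C$ let $\mathrm{ev}(k,\zeta)$ be the functional $f\mapsto f^{(k)}(\zeta)$ on univariate polynomials; $\mathbb D_\zeta=\mathrm{span}\{\mathrm{ev}(k,\zeta):k\ge0\}$, $\mathbb D=\bigoplus_\zeta\mathbb D_\zeta$. A finite-dimensional $C\subset\mathbb D$ is homogeneous if it has a basis $c_1,\dots,c_l$ with $c_i\in\mathbb D_{\zeta_i}$. Then $q_C(z)=\prod_{i=1}^l(z-\zeta_i)$, $W_C=q_C^{-1}\{f\in\mathbb C[z]:\langle c,f\rangle=0\ \forall c\in C\}$. The adelic Grassmannian $\mathrm{Gr}^{\mathrm{ad}}$ is the set of all such $W_C$. The stationary wave function of $W=W_C$ is $$\psi_W(x,z)=\frac{\mathrm{Wr}_x[\phi_1,\dots,\phi_l,e^{xz}]}{q_C(z)\,\mathrm{Wr}_x[\phi_1,\dots,\phi_l]},\qquad \phi_i(x)=\langle c_i(z),e^{xz}\rangle,$$ which depends only on $W$ and determines it. The bispectral involution $\beta:\mathrm{Gr}^{\mathrm{ad}}\to\mathrm{Gr}^{\mathrm{ad}}$ (Wilson) is defined by $\psi_{\beta(W)}(x,z)=\psi_W(z,x)$. The curve $\hat W^{(\lambda)}_y$: let $C^{(\lambda)}=\mathrm{span}\{\mathrm{ev}(k_i,0):1\le i\le\ell\}$. For $c\in\mathbb D_0$ and $y\in\mathbb C$ let $\hat c_y\in\mathbb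 D_0$ be $\langle\hat c_y(z),f(z)\rangle=\langle c(z),e^{yz^2}f(z)\rangle$. Put $\hat C^{(\lambda)}_y=\{\hat c_y:c\in C^{(\lambda)}\}$ and $\hat W^{(\lambda)}_y=W_{\hat C^{(\lambda)}_y}$. *)

theory Defs
  imports
    "HOL-Complex_Analysis.Complex_Analysis"
    "HOL-Library.Function_Algebras"
    "Jordan_Normal_Form.Determinant"
begin

section \<open>Partitions\<close>

text \<open>Parts are indexed from 1; the value at 0 is never used.\<close>

definition is_partition :: "(nat \<Rightarrow> nat) \<Rightarrow> bool" where
  "is_partition lam \<longleftrightarrow> antimono_on {1..} lam \<and> finite {i. 1 \<le> i \<and> lam i \<noteq> 0}"

definition part_length :: "(nat \<Rightarrow> nat) \<Rightarrow> nat" where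
  "part_length lam = card {i. 1 \<le> i \<and> lam i \<noteq> 0}"

definition m_seq :: "(nat \<Rightarrow> nat) \<Rightarrow> nat \<Rightarrow> int" where
  "m_seq lam i = int (lam i) - int i"

definition J_set :: "(nat \<Rightarrow> nat) \<Rightarrow> int set" where
  "J_set lam = UNIV - m_seq lam ` {1..}"

text \<open>Both numbers \<open>m\<^sub>i + \<ell>\<close> (\<open>1 \<le> i \<le> \<ell>\<close>) and \<open>m + \<ell>\<close> (\<open>m \<in> J\<close>) to which
  the function \<open>nat\<close> is applied below are nonnegative.\<close>

definition k_seq :: "(nat \<Rightarrow> nat) \<Rightarrow> nat \<Rightarrow> nat" where
  "k_seq lam i = nat (m_seq lam i + int (part_length lam))"


section \<open>Wronskians\<close>

text \<open>The Wronskian with respect to a derivation \<open>D\<close>. It is used with \<open>pderiv\<close> on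
  polynomials and with \<open>deriv\<close> on the ring of functions with pointwise operations.\<close>

definition wronskian :: "('a \<Rightarrow> 'a) \<Rightarrow> 'a list \<Rightarrow> 'a :: comm_ring_1" where
  "wronskian D fs =
     Determinant.det (Matrix.mat (length fs) (length fs) (\<lambda>(i, j). (D ^^ i) (fs ! j)))"

lemma wronskian_pointwise:
  fixes fs :: "('a \<Rightarrow> 'b :: comm_ring_1) list"
  shows "wronskian D fs x =
    Determinant.det (Matrix.mat (length fs) (length fs) (\<lambda>(i, j). (D ^^ i) (fs ! j) x))"
proof -
  let ?A = "Matrix.mat (length fs) (length fs) (\<lambda>(i, j). (D ^^ i) (fs ! j))"
  have hom: "comm_ring_hom (\<lambda>f :: 'a \<Rightarrow> 'b. f x)"
    by unfold_locales (simp_all add: plus_fun_def times_fun_def zero_fun_def one_fun_def)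
  have "wronskian D fs x = Determinant.det (map_mat (\<lambda>f. f x) ?A)"
    unfolding wronskian_def by (rule comm_ring_hom.hom_det[OF hom, symmetric])
  also have "map_mat (\<lambda>f. f x) ?A =
      Matrix.mat (length fs) (length fs) (\<lambda>(i, j). (D ^^ i) (fs ! j) x)"
    by (rule eq_matI) simp_all
  finally show ?thesis .
qed


section \<open>Exceptional Hermite rational functions\<close>

text \<open>\<open>hermite y n\<close> is the polynomial \<open>H\<^sub>n(x, y)\<close> in \<open>x\<close>, for a fixed value of \<open>y\<close>.\<close>

definition hermite :: "complex \<Rightarrow> nat \<Rightarrow> complex poly" where
  "hermite y = (THE H. \<forall>x z.
     (\<lambda>n. poly (H n) x * z ^ n / fact n) sums exp (x * z + y * z ^ 2))"

lemma hermite_ex1: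
  "\<exists>!H. \<forall>x z :: complex. (\<lambda>n. poly (H n) x * z ^ n / fact n) sums exp (x * z + y * z ^ 2)"
proof (rule ex_ex1I)
  define g where "g = (\<lambda>n. (deriv ^^ n) (\<lambda>z. exp (y * z ^ 2)) 0 / fact n)"
  have hol: "(\<lambda>z. exp (y * z ^ 2)) holomorphic_on S" for S
    by (intro holomorphic_intros)
  have g: "(\<lambda>n. g n * z ^ n) sums exp (y * z ^ 2)" for z
    using holomorphic_power_series[of "\<lambda>z. exp (y * z ^ 2)" 0 "norm z + 1" z] hol
    by (simp add: g_def)
  have gabs: "summable (\<lambda>n. norm (g n * z ^ n))" for z
  proof -
    have "summable (\<lambda>n. g n * (of_real (norm z + 1)) ^ n)"
      using g[of "of_real (norm z + 1)"] by (rule sums_summable)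
    thus ?thesis by (rule powser_insidea) (simp del: of_real_add)
  qed
  define H where "H = (\<lambda>n. \<Sum>i\<le>n. monom (fact n * g (n - i) / fact i) i)"
  have "(\<lambda>n. poly (H n) x * z ^ n / fact n) sums exp (x * z + y * z ^ 2)" for x z
  proof -
    have "(\<lambda>k. \<Sum>i\<le>k. (x * z) ^ i /\<^sub>R fact i * (g (k - i) * z ^ (k - i))) sums
        ((\<Sum>n. (x * z) ^ n /\<^sub>R fact n) * (\<Sum>n. g n * z ^ n))"
      by (intro Cauchy_product_sums gabs summable_norm_exp)
    also have "(\<Sum>n. (x * z) ^ n /\<^sub>R fact n) * (\<Sum>n. g n * z ^ n) = exp (x * z + y * z ^ 2)"
      using sums_unique[OF g[of z]] sums_unique[OF exp_converges[of "x * z"]]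
      by (simp add: exp_add)
    also have "(\<lambda>k. \<Sum>i\<le>k. (x * z) ^ i /\<^sub>R fact i * (g (k - i) * z ^ (k - i))) =
        (\<lambda>n. poly (H n) x * z ^ n / fact n)"
    proof
      fix k
      have "poly (H k) x * z ^ k / fact k =
          (\<Sum>i\<le>k. fact k * g (k - i) / fact i * x ^ i * z ^ k / fact k)"
        by (simp add: H_def poly_sum poly_monom sum_distrib_right sum_divide_distrib)
      also have "\<dots> = (\<Sum>i\<le>k. (x * z) ^ i /\<^sub>R fact i * (g (k - i) * z ^ (k - i)))"
      proof (rule sum.cong)
        fix i assume "i \<in> {..k}"
        hence "z ^ k = z ^ i * z ^ (k - i)" by (simp flip: power_add)
        thus "fact k * g (k - i) / fact i * x ^ i * z ^ k / fact k =
            (x * z) ^ i /\<^sub>R fact i * (g (k - i) * z ^ (k - i))"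
          by (simp add: scaleR_conv_of_real field_simps power_mult_distrib)
      qed simp
      finally show "(\<Sum>i\<le>k. (x * z) ^ i /\<^sub>R fact i * (g (k - i) * z ^ (k - i))) =
          poly (H k) x * z ^ k / fact k" by simp
    qed
    finally show ?thesis .
  qed
  thus "\<exists>H. \<forall>x z. (\<lambda>n. poly (H n) x * z ^ n / fact n) sums exp (x * z + y * z ^ 2)"
    by blast
next
  fix H H' :: "nat \<Rightarrow> complex poly"
  assume H: "\<forall>x z. (\<lambda>n. poly (H n) x * z ^ n / fact n) sums exp (x * z + y * z ^ 2)"
    and H': "\<forall>x z. (\<lambda>n. poly (H' n) x * z ^ n / fact n) sums exp (x * z + y * z ^ 2)"
  have *: "poly (G n) x / fact n = (deriv ^^ n) (\<lambda>z. exp (x * z + y * z ^ 2)) 0 / fact n"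
    if "\<forall>x z. (\<lambda>n. poly (G n) x * z ^ n / fact n) sums exp (x * z + y * z ^ 2)"
    for G :: "nat \<Rightarrow> complex poly" and n x
  proof -
    let ?F = "Abs_fps (\<lambda>n. poly (G n) x / fact n)"
    have s: "(\<lambda>n. fps_nth ?F n * z ^ n) sums exp (x * z + y * z ^ 2)" for z
      using that by (simp add: field_simps)
    have "fps_conv_radius ?F \<ge> 1"
      unfolding fps_conv_radius_def
      using conv_radius_geI[OF sums_summable[OF s[of 1]]] by (simp add: one_ereal_def)
    hence rad: "fps_conv_radius ?F > 0"
      by (rule less_le_trans[rotated]) simp
    have "eval_fps ?F z = exp (x * z + y * z ^ 2)" for z
      unfolding eval_fps_def by (rule sums_unique[OF s, symmetric])
    hence "\<forall>\<^sub>F z in nhds 0. eval_fps ?F z = exp (x * z + y * z ^ 2)"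
      by (intro always_eventually allI)
    with rad have exp: "(\<lambda>z. exp (x * z + y * z ^ 2)) has_fps_expansion ?F"
      unfolding has_fps_expansion_def by blast
    from fps_nth_fps_expansion[OF exp, of n] show ?thesis by (simp only: fps_nth_Abs_fps)
  qed
  have "poly (H n) x = poly (H' n) x" for n x
    using *[OF H, of n x] *[OF H', of n x] by simp
  hence "poly (H n) = poly (H' n)" for n by (intro ext)
  thus "H = H'" by (intro ext) (metis poly_eq_poly_eq_iff)
qed

lemma hermite_generating_function:
  "(\<lambda>n. poly (hermite y n) x * z ^ n / fact n) sums exp (x * z + y * z ^ 2)"
  using theI'[OF hermite_ex1[of y]] unfolding hermite_def[symmetric] by blast

definition exc_hermite :: "(nat \<Rightarrow> nat) \<Rightarrow> complex \<Rightarrow> int \<Rightarrow> complex poly fract" where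
  "exc_hermite lam y m =
     (let l = part_length lam;
          Hs = map (\<lambda>i. hermite y (k_seq lam i)) (rev [1..<l+1])
      in to_fract [:1 / of_int (\<Prod>i=1..l. m - m_seq lam i):]
         * (to_fract (wronskian pderiv (Hs @ [hermite y (nat (m + int l))]))
            / to_fract (wronskian pderiv Hs)))"

global_interpretation ratfun: vector_space "\<lambda>(a::complex) (r::complex poly fract). to_fract [:a:] * r"
proof unfold_locales
  fix a b :: complex and r s :: "complex poly fract"
  have "[:a + b:] = [:a:] + [:b:]" "[:a * b:] = [:a:] * [:b:]" by simp_all
  thus "to_fract [:a + b:] * r = to_fract [:a:] * r + to_fract [:b:] * r"
    and "to_fract [:a:] * (to_fract [:b:] * r) = to_fract [:a * b:] * r"
    by (simp_all only: to_fract_add to_fract_mult distrib_right mult.assoc)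
qed (simp_all add: distrib_left flip: one_pCons)

definition exc_space :: "(nat \<Rightarrow> nat) \<Rightarrow> complex \<Rightarrow> complex poly fract set" where
  "exc_space lam y = ratfun.span (exc_hermite lam y ` J_set lam)"


section \<open>The adelic Grassmannian\<close>

text \<open>Elements of \<open>\<D>\<close> are applied to polynomials, to \<open>exp (x * z)\<close> and to
  \<open>exp (y * z\<^sup>2) * f z\<close>. They are therefore represented as functionals on entire functions,
  with the value 0 at all other functions. A finite combination of functionals \<open>ev k \<zeta>\<close> is
  determined by its values at polynomials.\<close>

type_synonym functional = "(complex \<Rightarrow> complex) \<Rightarrow> complex"

definition ev :: "nat \<Rightarrow> complex \<Rightarrow> functional" where
  "ev k \<zeta> f = (if f holomorphic_on UNIV then (deriv ^^ k) f \<zeta> else 0)"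

global_interpretation functional: vector_space "\<lambda>(a::complex) (c::functional) f. a * c f"
  by unfold_locales (auto simp: fun_eq_iff algebra_simps)

definition D_at :: "complex \<Rightarrow> functional set" where
  "D_at \<zeta> = functional.span (range (\<lambda>k. ev k \<zeta>))"

text \<open>\<open>bs\<close> lists a basis of \<open>C\<close> whose members have one-point supports; each member
  is paired with its support.\<close>

definition homogeneous_basis :: "functional set \<Rightarrow> (complex \<times> functional) list \<Rightarrow> bool" where
  "homogeneous_basis C bs \<longleftrightarrow>
     distinct (map snd bs) \<and> \<not> functional.dependent (set (map snd bs)) \<and>
     functional.span (set (map snd bs)) = C \<and> (\<forall>(\<zeta>, c) \<in> set bs. c \<in> D_at \<zeta>)"

definition homogeneous :: "functional set \<Rightarrow> bool" where
  "homogeneous C \<longleftrightarrow> (\<exists>bs. homogeneous_basis C bs)"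

text \<open>The polynomial \<open>q\<^sub>C\<close> and the wave function of \<open>C\<close> do not depend on the chosen basis.\<close>

definition hom_basis :: "functional set \<Rightarrow> (complex \<times> functional) list" where
  "hom_basis C = (SOME bs. homogeneous_basis C bs)"

definition q_poly :: "functional set \<Rightarrow> complex poly" where
  "q_poly C = prod_list (map (\<lambda>(\<zeta>, c). [:-\<zeta>, 1:]) (hom_basis C))"

definition W_of :: "functional set \<Rightarrow> complex poly fract set" where
  "W_of C = {to_fract f / to_fract (q_poly C) | f. \<forall>c\<in>C. c (poly f) = 0}"

definition Gr_ad :: "complex poly fract set set" where
  "Gr_ad = {W_of C | C. homogeneous C}"


section \<open>Wave functions and the bispectral involution\<close>

definition wave_of_conditions :: "functional set \<Rightarrow> complex \<Rightarrow> complex \<Rightarrow> complex" where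
  "wave_of_conditions C x z =
     (let phis = map (\<lambda>(\<zeta>, c) x. c (\<lambda>w. exp (x * w))) (hom_basis C)
      in wronskian deriv (phis @ [\<lambda>x. exp (x * z)]) x
         / (poly (q_poly C) z * wronskian deriv phis x))"

text \<open>The wave function does not depend on the choice of \<open>C\<close> with \<open>W = W\<^sub>C\<close>, as a
  meromorphic function.\<close>

definition wave :: "complex poly fract set \<Rightarrow> complex \<Rightarrow> complex \<Rightarrow> complex" where
  "wave W = wave_of_conditions (SOME C. homogeneous C \<and> W_of C = W)"

text \<open>Equality of meromorphic functions of two variables. At zeros of their denominators,
  where division by 0 gives the value 0, the representing functions may differ.\<close>

definition mero_eq :: "(complex \<Rightarrow> complex \<Rightarrow> complex) \<Rightarrow> (complex \<Rightarrow> complex \<Rightarrow> complex) \<Rightarrow> bool"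
  where "mero_eq f g \<longleftrightarrow>
    (\<exists>U. open U \<and> closure U = UNIV \<and> (\<forall>(x, z) \<in> U. f x z = g x z))"

definition bispectral :: "complex poly fract set \<Rightarrow> complex poly fract set" where
  "bispectral W = (THE W'. W' \<in> Gr_ad \<and> mero_eq (wave W') (\<lambda>x z. wave W z x))"


section \<open>The curve of points attached to a partition\<close>

definition C_part :: "(nat \<Rightarrow> nat) \<Rightarrow> functional set" where
  "C_part lam = functional.span ((\<lambda>i. ev (k_seq lam i) 0) ` {1..part_length lam})"

definition hat :: "complex \<Rightarrow> functional \<Rightarrow> functional" where
  "hat y c = (\<lambda>f. c (\<lambda>z. exp (y * z ^ 2) * f z))"

definition W_hat :: "(nat \<Rightarrow> nat) \<Rightarrow> complex \<Rightarrow> complex poly fract set" where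
  "W_hat lam y = W_of (hat y ` C_part lam)"

end

theory Submission
  imports Defs "HOL-Computational_Algebra.Fundamental_Theorem_Algebra" "HOL-Computational_Algebra.Field_as_Ring"
begin

text \<open>Write \<open>f\<^sub>1, \<dots>, f\<^sub>l\<close> for the Hermite polynomials \<open>H\<^sub>k\<close> with \<open>k = k\<^sub>l, \<dots>, k\<^sub>1\<close>, and let
  \<open>D f = Wr (f\<^sub>1, \<dots>, f\<^sub>l, f) / Wr (f\<^sub>1, \<dots>, f\<^sub>l)\<close>. Since the \<open>H\<^sub>n\<close> form a basis of the polynomials, of which
  \<open>D\<close> kills those with \<open>n = k\<^sub>i\<close>, the exceptional space is the image under \<open>D\<close> of all polynomials. On
  the other side the functions \<open>\<phi>\<^sub>i\<close> of the hatted conditions are the \<open>f\<^sub>i\<close>, so that the wave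
  function of the curve is \<open>D e\<^bsup>xz\<^esup> / z\<^sup>l\<close>, with \<open>D\<close> acting in \<open>x\<close>.

  The image of \<open>D\<close> lies in the adelic Grassmannian by counting. Since \<open>D\<close> lowers orders of
  vanishing by at most \<open>l\<close> and degrees by at least \<open>l\<close>, and has an \<open>l\<close>-dimensional kernel, near each zero
  of the Wronskian \<open>W\<close> there are at least as many conditions on \<open>W D f\<close> as its multiplicity, while
  the total codimension is at most \<open>deg W\<close>. Every such condition kills \<open>W D e\<^bsup>xz\<^esup>\<close> with \<open>D\<close> acting in
  \<open>z\<close>, and this identifies the wave function of the image.

  A wave function is the unique function \<open>P(z) e\<^bsup>xz\<^esup> / q(z)\<close> with \<open>P\<close> monic of degree \<open>deg q\<close> whose
  numerator satisfies the conditions. Hence it depends on the space alone, and conversely it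
  determines the space, because a functional killing these numerators for \<open>x\<close> in an open set is
  a combination of the conditions (kernel of a Wronskian).\<close>

section \<open>Wronskians\<close>

text \<open>Membership in the adelic Grassmannian is tested on polynomials, while wave functions
  need the conditions on exponentials. The bridge is that every functional in \<open>D_all\<close>
  vanishes on the multiples of some nonzero polynomial, modulo which an entire function is a
  polynomial; so a functional that vanishes on polynomials vanishes on exponentials. Composing a
  condition on the image with W D gives again such a functional, which is why the condition kills W
  D exp (x * z).

  That function is exp (x * z) times a polynomial in z. The degree bounds on the coefficients of W D
  show that its degree in z is deg W, with leading coefficient x^l times that of W, so it needs only
  rescaling to be the monic numerator.

  In the count no zero of W has to be known: the multiplicities add up to deg W, so the lower bounds
  at the single zeros and the upper bound for the total must be equalities.

  The definitions choose a basis of the conditions and the conditions themselves, and division by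
  zero gives 0. Identities between wave functions are therefore proved on open dense sets
  only.\<close>

text \<open>The \<open>b i\<close> are the cofactors of the last column, in which that column does
  not occur. Filling it with a copy of column \<open>j\<close> makes two columns equal, whence the
  last relation.\<close>

lemma det_last_column:
  fixes M :: "nat \<Rightarrow> nat \<Rightarrow> 'a :: comm_ring_1"
  obtains b where
    "\<And>v. Determinant.det (Matrix.mat (Suc l) (Suc l) (\<lambda>(i, j). if j < l then M i j else v i)) = (\<Sum>i\<le>l. b i * v i)"
    "b l = Determinant.det (Matrix.mat l l (\<lambda>(i, j). M i j))"
    "\<And>j. j < l \<Longrightarrow> (\<Sum>i\<le>l. b i * M i j) = 0"
proof -
  define A where "A = (\<lambda>v. Matrix.mat (Suc l) (Suc l) (\<lambda>(i, j). if j < l then M i j else v i))"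
  define b where "b = (\<lambda>i. cofactor (A (\<lambda>_. 0)) i l)"
  have carr: "A v \<in> carrier_mat (Suc l) (Suc l)" for v by (simp add: A_def)
  have del: "mat_delete (A v) i l = mat_delete (A (\<lambda>_. 0)) i l" if "i \<le> l" for v i
    using that by (intro eq_matI) (auto simp: A_def mat_delete_def)
  have 1: "Determinant.det (A v) = (\<Sum>i\<le>l. b i * v i)" for v
  proof -
    have "Determinant.det (A v) = (\<Sum>i<Suc l. A v $$ (i, l) * cofactor (A v) i l)"
      by (rule laplace_expansion_column[OF carr]) simp
    also have "\<dots> = (\<Sum>i\<le>l. b i * v i)"
      unfolding lessThan_Suc_atMost
    proof (rule sum.cong)
      fix i assume "i \<in> {..l}"
      hence "cofactor (A v) i l = b i" and "A v $$ (i, l) = v i"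
        using del[of i v] by (simp_all add: b_def cofactor_def) (simp add: A_def)
      thus "A v $$ (i, l) * cofactor (A v) i l = b i * v i" by (simp add: mult.commute)
    qed simp
    finally show ?thesis .
  qed
  have "mat_delete (A (\<lambda>_. 0)) l l = Matrix.mat l l (\<lambda>(i, j). M i j)"
    by (intro eq_matI) (auto simp: A_def mat_delete_def)
  hence 2: "b l = Determinant.det (Matrix.mat l l (\<lambda>(i, j). M i j))"
    by (simp add: b_def cofactor_def)
  have 3: "(\<Sum>i\<le>l. b i * M i j) = 0" if "j < l" for j
  proof -
    have "Determinant.det (A (\<lambda>i. M i j)) = 0"
      by (rule det_identical_columns[OF carr, of j l])
        (use that in \<open>auto simp: A_def intro!: eq_vecI\<close>)
    thus ?thesis using 1[of "\<lambda>i. M i j"] by simp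
  qed
  show ?thesis by (rule that[of b]) (use 1 2 3 in \<open>auto simp: A_def\<close>)
qed

text \<open>Cramer's rule without division: replacing the last row by the
  \<open>d\<close>-combination of all rows multiplies the determinant by \<open>d l\<close> and
  leaves only the corner entry in that row.\<close>

lemma det_annihilating_row:
  fixes M :: "nat \<Rightarrow> nat \<Rightarrow> 'a :: comm_ring_1"
  assumes "\<And>j. j < l \<Longrightarrow> (\<Sum>i\<le>l. d i * M i j) = 0"
  shows "d l * Determinant.det (Matrix.mat (Suc l) (Suc l) (\<lambda>(i, j). if j < l then M i j else v i)) =
    Determinant.det (Matrix.mat l l (\<lambda>(i, j). M i j)) * (\<Sum>i\<le>l. d i * v i)"
proof -
  define A where "A = Matrix.mat (Suc l) (Suc l) (\<lambda>(i, j). if j < l then M i j else v i)"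
  define B where "B = Matrix.mat (Suc l) (Suc l) (\<lambda>(i, j). if i < l then (if i = j then 1 else 0) else d j)"
  define P where "P = Matrix.mat (Suc l) (Suc l) (\<lambda>(i, j). if i < l then if j < l then M i j else v i else
     if j < l then 0 else \<Sum>i\<le>l. d i * v i)"
  have A: "A \<in> carrier_mat (Suc l) (Suc l)" and B: "B \<in> carrier_mat (Suc l) (Suc l)"
    and P: "P \<in> carrier_mat (Suc l) (Suc l)"
    by (simp_all add: A_def B_def P_def)
  have "B * A = P"
  proof (rule eq_matI)
    fix i j assume "i < dim_row P" "j < dim_col P"
    hence ij: "i < Suc l" "j < Suc l" by (simp_all add: P_def)
    have "(B * A) $$ (i, j) = (\<Sum>k\<le>l. B $$ (i, k) * A $$ (k, j))"
      using ij A B by (simp add: scalar_prod_def atLeast0LessThan lessThan_Suc_atMost)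
    also have "\<dots> = P $$ (i, j)"
    proof (cases "i < l")
      case True
      have "(\<Sum>k\<le>l. B $$ (i, k) * A $$ (k, j)) = (\<Sum>k\<le>l. if k = i then A $$ (k, j) else 0)"
        using True by (intro sum.cong) (auto simp: B_def)
      thus ?thesis using True ij by (simp add: A_def P_def)
    next
      case False
      hence "(\<Sum>k\<le>l. B $$ (i, k) * A $$ (k, j)) = (\<Sum>k\<le>l. d k * (if j < l then M k j else v k))"
        using ij by (intro sum.cong) (auto simp: B_def A_def)
      thus ?thesis using False ij assms[of j] by (auto simp: P_def)
    qed
    finally show "(B * A) $$ (i, j) = P $$ (i, j)" .
  qed (simp_all add: A_def B_def P_def)
  moreover have "Determinant.det (B * A) = Determinant.det B * Determinant.det A"
    by (rule Determinant.det_mult[OF B A])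
  moreover have "Determinant.det B = d l"
  proof -
    have "Determinant.det B = prod_list (diag_mat B)"
      by (rule det_lower_triangular[OF _ B]) (auto simp: B_def)
    also have "diag_mat B = map (\<lambda>i. if i < l then 1 else d i) [0..<Suc l]"
      unfolding diag_mat_def by (auto simp: B_def)
    also have "\<dots> = map (\<lambda>i. 1) [0..<l] @ [d l]"
      by simp
    also have "prod_list \<dots> = d l"
      by (simp add: map_replicate_const prod_list_replicate)
    finally show ?thesis .
  qed
  moreover have "Determinant.det P = (\<Sum>i\<le>l. d i * v i) * Determinant.det (Matrix.mat l l (\<lambda>(i, j). M i j))"
  proof -
    have "Determinant.det P = (\<Sum>j<Suc l. P $$ (l, j) * cofactor P l j)"
      by (rule laplace_expansion_row[OF P]) simp
    also have "\<dots> = P $$ (l, l) * cofactor P l l" by (simp add: P_def)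
    also have "mat_delete P l l = Matrix.mat l l (\<lambda>(i, j). M i j)"
      by (intro eq_matI) (auto simp: P_def mat_delete_def)
    hence "cofactor P l l = Determinant.det (Matrix.mat l l (\<lambda>(i, j). M i j))"
      by (simp add: cofactor_def)
    finally show ?thesis by (simp add: P_def)
  qed
  ultimately show ?thesis by (simp add: A_def mult.commute)
qed

lemma wronskian_snoc_matrix:
  "wronskian D (fs @ [g]) = Determinant.det (Matrix.mat (Suc (length fs)) (Suc (length fs))
     (\<lambda>(i, j). if j < length fs then (D ^^ i) (fs ! j) else (D ^^ i) g))"
  unfolding wronskian_def
  by (rule arg_cong[of _ _ Determinant.det]) (auto simp: nth_append intro!: eq_matI)

text \<open>Laplace expansion exhibits the Wronskian, as a function of its last entry, as a linear
  differential operator with leading coefficient \<open>wronskian D fs\<close>.\<close>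

lemma wronskian_last:
  obtains b where "\<And>g. wronskian D (fs @ [g]) = (\<Sum>i\<le>length fs. b i * (D ^^ i) g)"
    "b (length fs) = wronskian D fs"
    "\<And>f. f \<in> set fs \<Longrightarrow> (\<Sum>i\<le>length fs. b i * (D ^^ i) f) = 0"
proof -
  from det_last_column[of "length fs" "\<lambda>i j. (D ^^ i) (fs ! j)"] obtain b where b:
    "\<And>v. Determinant.det (Matrix.mat (Suc (length fs)) (Suc (length fs)) (\<lambda>(i, j). if j < length fs then (D ^^ i) (fs ! j) else v i)) = (\<Sum>i\<le>length fs. b i * v i)"
    "b (length fs) = Determinant.det (Matrix.mat (length fs) (length fs) (\<lambda>(i, j). (D ^^ i) (fs ! j)))"
    "\<And>j. j < length fs \<Longrightarrow> (\<Sum>i\<le>length fs. b i * (D ^^ i) (fs ! j)) = 0"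
    by blast
  show ?thesis
  proof (rule that[of b])
    show "wronskian D (fs @ [g]) = (\<Sum>i\<le>length fs. b i * (D ^^ i) g)" for g
      unfolding wronskian_snoc_matrix by (rule b(1))
  qed (use b(2,3) in \<open>auto simp: wronskian_def in_set_conv_nth\<close>)
qed

text \<open>An operator of order \<open>length fs\<close> that annihilates \<open>fs\<close> is
  proportional to the Wronskian operator; the two leading coefficients are the factors of
  proportionality.\<close>

lemma wronskian_annihilator:
  assumes "\<And>f. f \<in> set fs \<Longrightarrow> (\<Sum>i\<le>length fs. d i * (D ^^ i) f) = 0"
  shows "d (length fs) * wronskian D (fs @ [g]) = wronskian D fs * (\<Sum>i\<le>length fs. d i * (D ^^ i) g)"
  unfolding wronskian_snoc_matrix unfolding wronskian_def
  by (rule det_annihilating_row) (use assms in auto)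

section \<open>Abstract derivations and the recurrence for Wronskians\<close>

locale derivation =
  fixes D :: "'a :: idom \<Rightarrow> 'a"
  assumes D_add: "D (a + b) = D a + D b"
    and D_mult: "D (a * b) = a * D b + D a * b"
begin

lemma D_zero [simp]: "D 0 = 0"
  by (metis D_add add_cancel_right_right add_0)

lemma D_minus: "D (- a) = - D a"
  by (metis D_add D_zero add.right_inverse minus_unique)

lemma D_diff: "D (a - b) = D a - D b"
  using D_add[of a "-b"] by (simp add: D_minus)

lemma D_sum: "D (sum f A) = (\<Sum>x\<in>A. D (f x))"
  by (induction A rule: infinite_finite_induct) (auto simp: D_add)

lemma D_operator:
  "D (\<Sum>i\<le>n. b i * (D ^^ i) g) =
     (\<Sum>i\<le>Suc n. ((if i \<le> n then D (b i) else 0) + (if i = 0 then 0 else b (i - 1))) * (D ^^ i) g)"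
proof -
  have "(\<Sum>i\<le>Suc n. (if i = 0 then 0 else b (i - 1)) * (D ^^ i) g) = (\<Sum>i\<le>n. b i * D ((D ^^ i) g))"
    by (subst sum.atMost_Suc_shift) simp
  moreover have "(\<Sum>i\<le>Suc n. (if i \<le> n then D (b i) else 0) * (D ^^ i) g) = (\<Sum>i\<le>n. D (b i) * (D ^^ i) g)"
    by simp
  ultimately show ?thesis
    unfolding D_sum D_mult distrib_right sum.distrib by simp
qed

text \<open>In \<open>g\<close> the right-hand side is an operator of one order more that
  annihilates \<open>fs\<close> and \<open>f\<close>, so it is proportional to
  \<open>wronskian D (fs @ [f, g])\<close>, and the leading coefficients give the factor. A common
  factor \<open>wronskian D (fs @ [f])\<close> is cancelled at the end.\<close>

lemma wronskian_recurrence: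
  assumes "wronskian D (fs @ [f]) \<noteq> 0"
  shows "wronskian D fs * wronskian D (fs @ [f, g]) =
    wronskian D (fs @ [f]) * D (wronskian D (fs @ [g])) -
    D (wronskian D (fs @ [f])) * wronskian D (fs @ [g])"
proof -
  let ?l = "length fs" and ?u = "wronskian D (fs @ [f])"
  from wronskian_last[of D fs] obtain b where b:
    "\<And>g. wronskian D (fs @ [g]) = (\<Sum>i\<le>?l. b i * (D ^^ i) g)" "b ?l = wronskian D fs"
    "\<And>f. f \<in> set fs \<Longrightarrow> (\<Sum>i\<le>?l. b i * (D ^^ i) f) = 0" by blast
  \<comment> \<open>\<open>d1\<close> holds the coefficients of the differentiated operator,
    \<open>d2\<close> those of the operator itself, padded to order \<open>Suc ?l\<close>.\<close>
  define d1 where "d1 = (\<lambda>i. (if i \<le> ?l then D (b i) else 0) + (if i = 0 then 0 else b (i - 1)))"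
  define d2 where "d2 = (\<lambda>i. if i \<le> ?l then b i else 0)"
  define d where "d = (\<lambda>i. ?u * d1 i - D ?u * d2 i)"
  have d: "(\<Sum>i\<le>Suc ?l. d i * (D ^^ i) g) = ?u * D (wronskian D (fs @ [g])) - D ?u * wronskian D (fs @ [g])" for g
  proof -
    have 1: "(\<Sum>i\<le>Suc ?l. d2 i * (D ^^ i) g) = wronskian D (fs @ [g])"
      by (simp add: b(1) d2_def)
    have 2: "(\<Sum>i\<le>Suc ?l. d1 i * (D ^^ i) g) = D (wronskian D (fs @ [g]))"
      unfolding b(1) D_operator d1_def ..
    show ?thesis
      unfolding d_def left_diff_distrib sum_subtractf mult.assoc
      unfolding sum_distrib_left[symmetric] 1 2 ..
  qed
  have "d (length (fs @ [f])) * wronskian D ((fs @ [f]) @ [g]) =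
      ?u * (\<Sum>i\<le>length (fs @ [f]). d i * (D ^^ i) g)"
  proof (rule wronskian_annihilator)
    fix h assume "h \<in> set (fs @ [f])"
    hence "h = f \<or> h \<in> set fs" by auto
    hence "?u * D (wronskian D (fs @ [h])) - D ?u * wronskian D (fs @ [h]) = 0"
    proof
      assume "h \<in> set fs"
      hence "wronskian D (fs @ [h]) = 0" using b(1)[of h] b(3)[of h] by metis
      thus ?thesis by simp
    next
      assume "h = f"
      thus ?thesis by (simp add: mult.commute)
    qed
    thus "(\<Sum>i\<le>length (fs @ [f]). d i * (D ^^ i) h) = 0"
      using d[of h] by simp
  qed
  moreover have "d (Suc ?l) = ?u * wronskian D fs" by (simp add: d_def d1_def d2_def b(2))
  ultimately have "?u * (wronskian D fs * wronskian D (fs @ [f, g])) =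
      ?u * (\<Sum>i\<le>Suc ?l. d i * (D ^^ i) g)" by (simp add: mult.assoc del: sum.atMost_Suc)
  with assms show ?thesis unfolding d by simp
qed

lemma wronskian_Nil [simp]: "wronskian D [] = 1"
  unfolding wronskian_def by (simp add: det_def)

lemma wronskian_single [simp]: "wronskian D [f] = f"
  unfolding wronskian_def by (subst det_single) simp_all

end

text \<open>\<open>constants\<close> says that a quotient \<open>v / u\<close> with derivative zero
  is a scalar; it is written with cross products because \<open>'a\<close> is only a domain.\<close>

locale derivation_over_field = derivation D for D :: "'a :: idom \<Rightarrow> 'a" +
  fixes K :: "'k :: field \<Rightarrow> 'a"
  assumes K_add: "K (a + b) = K a + K b"
    and K_mult: "K (a * b) = K a * K b"
    and K_one: "K 1 = 1"
    and D_scale: "D (K a * u) = K a * D u"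
    and constants: "u \<noteq> 0 \<Longrightarrow> u * D v = D u * v \<Longrightarrow> \<exists>c. v = K c * u"
begin

lemma K_zero: "K 0 = 0"
  by (metis K_add add_cancel_right_right add_0)

lemma K_minus: "K (- a) = - K a"
  by (metis K_add K_zero add.right_inverse minus_unique)

definition indep_list :: "'a list \<Rightarrow> bool" where
  "indep_list fs \<longleftrightarrow>
     (\<forall>a. (\<Sum>i<length fs. K (a i) * fs ! i) = 0 \<longrightarrow> (\<forall>i<length fs. a i = 0))"

lemma indep_list_butlast:
  assumes "indep_list (fs @ [f])"
  shows "indep_list fs"
  unfolding indep_list_def
proof (intro allI impI)
  fix a i assume a: "(\<Sum>i<length fs. K (a i) * fs ! i) = 0" and i: "i < length fs"
  define a' where "a' = (\<lambda>i. if i < length fs then a i else 0)"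
  have "(\<Sum>i<length fs. K (a' i) * (fs @ [f]) ! i) = (\<Sum>i<length fs. K (a i) * fs ! i)"
    by (rule sum.cong) (auto simp: a'_def nth_append)
  hence "(\<Sum>i<length (fs @ [f]). K (a' i) * (fs @ [f]) ! i) = 0"
    using a by (simp add: a'_def K_zero)
  with assms have "a' i = 0" using i unfolding indep_list_def by simp
  thus "a i = 0" using i by (simp add: a'_def)
qed

lemma indep_list_snoc_not_combination:
  assumes "indep_list (fs @ [f])"
  shows "f \<noteq> (\<Sum>i<length fs. K (a i) * fs ! i)"
proof
  assume f: "f = (\<Sum>i<length fs. K (a i) * fs ! i)"
  define a' where "a' = (\<lambda>i. if i < length fs then a i else - 1)"
  have "(\<Sum>i<length fs. K (a' i) * (fs @ [f]) ! i) = (\<Sum>i<length fs. K (a i) * fs ! i)"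
    by (rule sum.cong) (auto simp: a'_def nth_append)
  hence "(\<Sum>i<length (fs @ [f]). K (a' i) * (fs @ [f]) ! i) = 0"
    using f by (simp add: a'_def K_minus K_one)
  with assms have "a' (length fs) = 0" unfolding indep_list_def by simp
  thus False by (simp add: a'_def)
qed

lemma D_pow_diff_scale: "(D ^^ i) (g - K c * f) = (D ^^ i) g - K c * (D ^^ i) f"
  by (induction i) (auto simp: D_diff D_scale)

lemma wronskian_diff_scale:
  "wronskian D (fs @ [g - K c * f]) = wronskian D (fs @ [g]) - K c * wronskian D (fs @ [f])"
proof -
  obtain b where b: "\<And>g. wronskian D (fs @ [g]) = (\<Sum>i\<le>length fs. b i * (D ^^ i) g)"
    using wronskian_last[of D fs thesis] by metis
  have "b i * (D ^^ i) (g - K c * f) = b i * (D ^^ i) g - K c * (b i * (D ^^ i) f)" for i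
    unfolding D_pow_diff_scale by (simp add: algebra_simps)
  thus ?thesis
    by (simp only: b sum_subtractf sum_distrib_left)
qed

text \<open>By the recurrence, \<open>Wr (fs, f, g) = 0\<close> makes \<open>Wr (fs, g) / Wr (fs, f)\<close> a constant \<open>c\<close>,
  so that \<open>g - c f\<close> is annihilated by \<open>Wr (fs, \<cdot>)\<close>.\<close>

lemma wronskian_independent:
  assumes "indep_list fs"
  shows "wronskian D fs \<noteq> 0 \<and>
    (\<forall>g. wronskian D (fs @ [g]) = 0 \<longrightarrow> (\<exists>a. g = (\<Sum>i<length fs. K (a i) * fs ! i)))"
  using assms
proof (induction fs rule: rev_induct)
  case Nil
  thus ?case by simp
next
  case (snoc f fs)
  note IH = snoc.IH[OF indep_list_butlast[OF snoc.prems]]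
  have nz: "wronskian D (fs @ [f]) \<noteq> 0"
    using IH indep_list_snoc_not_combination[OF snoc.prems] by blast
  have "\<exists>a. g = (\<Sum>i<length (fs @ [f]). K (a i) * (fs @ [f]) ! i)"
    if g: "wronskian D ((fs @ [f]) @ [g]) = 0" for g
  proof -
    have "wronskian D (fs @ [f]) * D (wronskian D (fs @ [g])) =
        D (wronskian D (fs @ [f])) * wronskian D (fs @ [g])"
      using wronskian_recurrence[OF nz, of g] g by simp
    from constants[OF nz this] obtain c
      where "wronskian D (fs @ [g]) = K c * wronskian D (fs @ [f])" by blast
    hence "wronskian D (fs @ [g - K c * f]) = 0" by (simp add: wronskian_diff_scale)
    with IH obtain a where a: "g - K c * f = (\<Sum>i<length fs. K (a i) * fs ! i)" by blast
    define a' where "a' = (\<lambda>i. if i < length fs then a i else c)"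
    have "(\<Sum>i<length fs. K (a' i) * (fs @ [f]) ! i) = (\<Sum>i<length fs. K (a i) * fs ! i)"
      by (rule sum.cong) (auto simp: a'_def nth_append)
    hence "g = (\<Sum>i<length (fs @ [f]). K (a' i) * (fs @ [f]) ! i)"
      using a by (simp add: a'_def algebra_simps)
    thus ?thesis by blast
  qed
  with nz show ?case by blast
qed

lemmas wronskian_nonzero = wronskian_independent[THEN conjunct1]
lemmas wronskian_kernel = wronskian_independent[THEN conjunct2, rule_format]

end

section \<open>Constants in power series and polynomials\<close>

lemma fps_mult_nth_lowest:
  fixes a b :: "'a :: comm_ring_1 fps"
  assumes "\<And>i. i < m \<Longrightarrow> fps_nth a i = 0" "\<And>i. i < n \<Longrightarrow> fps_nth b i = 0"
  shows "fps_nth (a * b) (m + n) = fps_nth a m * fps_nth b n"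
proof -
  have "fps_nth (a * b) (m + n) = (\<Sum>i=0..m+n. fps_nth a i * fps_nth b (m + n - i))"
    by (rule fps_mult_nth)
  also have "\<dots> = (\<Sum>i=0..m+n. if i = m then fps_nth a m * fps_nth b n else 0)"
  proof (rule sum.cong)
    fix i assume i: "i \<in> {0..m+n}"
    have "fps_nth a i = 0" if "i < m" using assms(1) that .
    moreover have "fps_nth b (m + n - i) = 0" if "m < i"
      using assms(2)[of "m + n - i"] that i by auto
    ultimately show "fps_nth a i * fps_nth b (m + n - i) = (if i = m then fps_nth a m * fps_nth b n else 0)"
      by (cases i m rule: linorder_cases) simp_all
  qed simp
  finally show ?thesis by simp
qed

text \<open>After multiplication by \<open>fps_X\<close> a derivative multiplies the coefficient of
  index \<open>i\<close> by \<open>i\<close>. Comparing the coefficients of index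
  \<open>?m + ?n\<close> and cancelling the two lowest coefficients leaves the equality of
  \<open>?m\<close> and \<open>?n\<close>.\<close>

lemma fps_subdegree_eqI:
  fixes u w :: "complex fps"
  assumes eq: "u * fps_deriv w = fps_deriv u * w" and nz: "u \<noteq> 0" "w \<noteq> 0"
  shows "subdegree u = subdegree w"
proof -
  let ?m = "subdegree u" and ?n = "subdegree w"
  have X: "fps_nth (fps_X * fps_deriv f) i = of_nat i * fps_nth f i" for i and f :: "complex fps"
    by (cases i) simp_all
  have low: "fps_nth u i = 0" "fps_nth (fps_X * fps_deriv u) i = 0" if "i < ?m" for i
    using that X by (metis nth_less_subdegree_zero mult_zero_right)+
  have low': "fps_nth w i = 0" "fps_nth (fps_X * fps_deriv w) i = 0" if "i < ?n" for i
    using that X by (metis nth_less_subdegree_zero mult_zero_right)+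
  have "fps_nth (u * (fps_X * fps_deriv w)) (?m + ?n) = fps_nth u ?m * (of_nat ?n * fps_nth w ?n)"
    by (metis fps_mult_nth_lowest low(1) low'(2) X)
  moreover have "fps_nth ((fps_X * fps_deriv u) * w) (?m + ?n) = of_nat ?m * fps_nth u ?m * fps_nth w ?n"
    by (metis fps_mult_nth_lowest low(2) low'(1) X)
  moreover have "u * (fps_X * fps_deriv w) = (fps_X * fps_deriv u) * w"
    using arg_cong[OF eq, of "\<lambda>f. fps_X * f"] by (simp only: mult.left_commute mult.assoc)
  ultimately have "fps_nth u ?m * (of_nat ?n * fps_nth w ?n) = of_nat ?m * fps_nth u ?m * fps_nth w ?n"
    by argo
  moreover have "fps_nth u ?m \<noteq> 0" "fps_nth w ?n \<noteq> 0" using nz by simp_all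
  ultimately show ?thesis by simp
qed

lemma fps_constants:
  fixes u v :: "complex fps"
  assumes nz: "u \<noteq> 0" and eq: "u * fps_deriv v = fps_deriv u * v"
  shows "\<exists>c. v = fps_const c * u"
proof -
  \<comment> \<open>Chosen so that \<open>w\<close> has no coefficient at
    \<open>subdegree u\<close>; a nonzero \<open>w\<close> would have its lowest coefficient exactly
    there.\<close>
  define c where "c = fps_nth v (subdegree u) / fps_nth u (subdegree u)"
  define w where "w = v - fps_const c * u"
  have "u * fps_deriv w = fps_deriv u * w"
    using eq by (simp add: w_def algebra_simps)
  moreover have "fps_nth w (subdegree u) = 0"
    using nz by (simp add: w_def c_def)
  ultimately have "w = 0"
    using fps_subdegree_eqI[of u w] nz by (metis nth_subdegree_nonzero)
  thus ?thesis by (auto simp: w_def)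
qed

interpretation fps_wr: derivation_over_field fps_deriv "fps_const :: complex \<Rightarrow> complex fps"
  using fps_constants by unfold_locales (auto simp: algebra_simps)

interpretation poly_wr: derivation_over_field pderiv "\<lambda>c :: complex. [:c:]"
proof unfold_locales
  fix u v :: "complex poly" assume "u \<noteq> 0" and eq: "u * pderiv v = pderiv u * v"
  have "fps_of_poly u * fps_deriv (fps_of_poly v) = fps_deriv (fps_of_poly u) * fps_of_poly v"
    using arg_cong[OF eq, of fps_of_poly] by (simp add: fps_of_poly_mult fps_of_poly_pderiv)
  moreover have "fps_of_poly u \<noteq> 0" using \<open>u \<noteq> 0\<close> by simp
  ultimately obtain c where "fps_of_poly v = fps_const c * fps_of_poly u"
    using fps_constants by blast
  also have "\<dots> = fps_of_poly ([:c:] * u)" by (simp add: fps_of_poly_smult)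
  finally show "\<exists>c. v = [:c:] * u" unfolding fps_of_poly_eq_iff by blast
qed (auto simp: pderiv_add pderiv_mult pderiv_smult algebra_simps)

section \<open>Degrees and orders of vanishing of polynomial Wronskians\<close>

lemma degree_cross_derivative:
  fixes u v :: "complex poly"
  assumes "u * pderiv v - pderiv u * v \<noteq> 0"
  shows "degree (u * pderiv v - pderiv u * v) + 1 \<le> degree u + degree v"
proof -
  have "degree u + degree v \<noteq> 0"
  proof
    assume "degree u + degree v = 0"
    hence "pderiv u = 0" "pderiv v = 0" by (auto simp: pderiv_eq_0_iff)
    with assms show False by simp
  qed
  moreover have "u * pderiv v = 0 \<or> degree (u * pderiv v) + 1 \<le> degree u + degree v"
    by (cases "degree v"; cases "u = 0") (auto simp: degree_mult_eq degree_pderiv pderiv_eq_0_iff)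
  moreover have "pderiv u * v = 0 \<or> degree (pderiv u * v) + 1 \<le> degree u + degree v"
    by (cases "degree u"; cases "v = 0") (auto simp: degree_mult_eq degree_pderiv pderiv_eq_0_iff)
  moreover have "degree (u * pderiv v - pderiv u * v) \<le> max (degree (u * pderiv v)) (degree (pderiv u * v))"
    by (rule degree_diff_le_max)
  ultimately show ?thesis by auto
qed

text \<open>Each of the two products contains one derivative, which costs at most one order of
  vanishing. The \<open>+ 1\<close> stands on the right so that \<open>n = m = 0\<close> is
  covered.\<close>

lemma order_cross_derivative:
  fixes u v :: "complex poly"
  assumes "u * pderiv v - pderiv u * v \<noteq> 0" "[:-z,1:] ^ n dvd v" "[:-z,1:] ^ m dvd u"
  shows "n + m \<le> order z (u * pderiv v - pderiv u * v) + 1"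
proof -
  let ?t = "[:-z, 1:]"
  obtain v' u' where v': "v = ?t ^ n * v'" and u': "u = ?t ^ m * u'"
    using assms by (auto elim!: dvdE)
  have d: "?t ^ (k - 1) dvd pderiv (?t ^ k * w)" for k and w :: "complex poly"
  proof (cases k)
    case (Suc k')
    have "pderiv (?t ^ k * w) = ?t ^ k' * (?t * pderiv w + Polynomial.smult (of_nat (Suc k')) (pderiv ?t) * w)"
      unfolding Suc pderiv_mult pderiv_power_Suc unfolding power_Suc
      by (simp only: distrib_left distrib_right mult_smult_left mult_smult_right ac_simps)
    thus ?thesis by (metis Suc diff_Suc_1 dvd_triv_left)
  qed simp
  have "?t ^ (m + (n - 1)) dvd u * pderiv v"
    unfolding power_add u' by (rule mult_dvd_mono) (simp_all only: v' d dvd_triv_left)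
  moreover have "?t ^ ((m - 1) + n) dvd pderiv u * v"
    unfolding power_add v' by (rule mult_dvd_mono) (simp_all only: u' d dvd_triv_left)
  ultimately have "?t ^ (n + m - 1) dvd u * pderiv v - pderiv u * v"
    by (intro dvd_diff) (erule dvd_trans[OF le_imp_power_dvd, rotated], simp)+
  with assms(1) have "n + m - 1 \<le> order z (u * pderiv v - pderiv u * v)"
    by (simp add: order_divides)
  thus ?thesis by simp
qed

text \<open>In the recurrence each new member of \<open>fs\<close> brings one derivative, hence the
  loss of at least one degree. The bound is written with sums because \<open>degree g\<close> may be
  smaller than \<open>length fs\<close>.\<close>

lemma degree_wronskian_snoc:
  fixes fs :: "complex poly list"
  assumes "poly_wr.indep_list fs" "wronskian pderiv (fs @ [g]) \<noteq> 0"
  shows "degree (wronskian pderiv (fs @ [g])) + length fs \<le> degree (wronskian pderiv fs) + degree g"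
  using assms
proof (induction fs rule: rev_induct)
  case Nil
  thus ?case by simp
next
  case (snoc f fs)
  note i = poly_wr.indep_list_butlast[OF snoc.prems(1)]
  let ?E = "\<lambda>g. wronskian pderiv (fs @ [g])"
  have nz: "wronskian pderiv fs \<noteq> 0" "?E f \<noteq> 0"
    using poly_wr.wronskian_nonzero i snoc.prems by blast+
  have rec: "wronskian pderiv fs * wronskian pderiv ((fs @ [f]) @ [g]) =
      ?E f * pderiv (?E g) - pderiv (?E f) * ?E g"
    using poly_wr.wronskian_recurrence[OF nz(2), of g] by simp
  with nz snoc.prems have "?E f * pderiv (?E g) - pderiv (?E f) * ?E g \<noteq> 0" by (metis mult_eq_0_iff)
  from degree_cross_derivative[OF this]
  have "degree (wronskian pderiv fs) + degree (wronskian pderiv ((fs @ [f]) @ [g])) + 1 \<le> degree (?E f) + degree (?E g)"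
    using nz snoc.prems unfolding rec[symmetric] by (simp add: degree_mult_eq)
  moreover have "?E g \<noteq> 0" using rec nz snoc.prems by fastforce
  ultimately show ?case using snoc.IH[OF i] by simp
qed

text \<open>The recurrence read at \<open>z\<close>: each member of \<open>fs\<close> costs at most
  one order of vanishing. The exponent \<open>n\<close> need not be the exact order of
  \<open>g\<close>, which suits multiples of a fixed power.\<close>

lemma order_wronskian_snoc:
  fixes fs :: "complex poly list"
  assumes "poly_wr.indep_list fs" "wronskian pderiv (fs @ [g]) \<noteq> 0" "[:-z,1:] ^ n dvd g"
  shows "order z (wronskian pderiv fs) + n \<le> order z (wronskian pderiv (fs @ [g])) + length fs"
  using assms
proof (induction fs rule: rev_induct)
  case Nil
  thus ?case by (simp add: order_divides order_0I)
next
  case (snoc f fs)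
  note i = poly_wr.indep_list_butlast[OF snoc.prems(1)]
  let ?E = "\<lambda>g. wronskian pderiv (fs @ [g])"
  have nz: "wronskian pderiv fs \<noteq> 0" "?E f \<noteq> 0"
    using poly_wr.wronskian_nonzero i snoc.prems by blast+
  have rec: "wronskian pderiv fs * wronskian pderiv ((fs @ [f]) @ [g]) =
      ?E f * pderiv (?E g) - pderiv (?E f) * ?E g"
    using poly_wr.wronskian_recurrence[OF nz(2), of g] by simp
  have nz': "wronskian pderiv fs * wronskian pderiv ((fs @ [f]) @ [g]) \<noteq> 0"
    using nz snoc.prems by simp
  have "?E f * pderiv (?E g) - pderiv (?E f) * ?E g \<noteq> 0" using nz' rec by metis
  from order_cross_derivative[OF this order_1 order_1, of z]
  have "order z (?E g) + order z (?E f) \<le>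
      order z (wronskian pderiv fs) + order z (wronskian pderiv ((fs @ [f]) @ [g])) + 1"
    unfolding rec[symmetric] order_mult[OF nz'] by simp
  moreover have "?E g \<noteq> 0" using rec nz snoc.prems by fastforce
  ultimately show ?case using snoc.IH[OF i] snoc.prems(3) by simp
qed

section \<open>Linear algebra\<close>

context vector_space
begin

text \<open>A dependent \<open>S\<close> could lose an element without losing span, and then fewer
  than \<open>card B\<close> vectors would span the independent set \<open>B\<close>.\<close>

lemma independent_if_card_le:
  assumes S: "finite S" "card S \<le> card B" and B: "independent B" "B \<subseteq> span S"
  shows "independent S"
proof
  assume "dependent S"
  then obtain a where a: "a \<in> S" "a \<in> span (S - {a})" unfolding dependent_def by blast
  hence "span (S - {a}) = span S"
    by (metis insert_Diff span_redundant)
  hence "card B \<le> card (S - {a})"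
    using independent_span_bound[of "S - {a}" B] S B by auto
  moreover have "card (S - {a}) < card S" using a S by (intro card_Diff1_less) auto
  ultimately show False using S by linarith
qed

text \<open>Each functional costs at most one dimension. The members of \<open>\<Phi>\<close> are
  bare functions because the vectors will themselves be functionals, which \<open>\<Phi>\<close>
  evaluates at polynomials.\<close>

lemma independent_in_common_kernel:
  assumes "finite B" "independent B"
    and "\<And>\<phi> u v. \<phi> \<in> set \<Phi> \<Longrightarrow> \<phi> (u + v) = \<phi> u + \<phi> v"
    and "\<And>\<phi> a u. \<phi> \<in> set \<Phi> \<Longrightarrow> \<phi> (scale a u) = a * \<phi> u"
  shows "\<exists>B'. finite B' \<and> independent B' \<and> B' \<subseteq> span B \<and> card B \<le> card B' + length \<Phi> \<and>
    (\<forall>\<phi>\<in>set \<Phi>. \<forall>b\<in>B'. \<phi> b = 0)"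
  using assms(3,4)
proof (induction \<Phi>)
  case Nil
  thus ?case using assms(1,2) by (auto intro!: exI[of _ B] span_base)
next
  case (Cons \<phi> \<Phi>)
  then obtain B1 where B1: "finite B1" "independent B1" "B1 \<subseteq> span B" "card B \<le> card B1 + length \<Phi>"
    "\<And>\<psi> b. \<psi> \<in> set \<Phi> \<Longrightarrow> b \<in> B1 \<Longrightarrow> \<psi> b = 0" by auto
  show ?case
  proof (cases "\<forall>b\<in>B1. \<phi> b = 0")
    case True
    thus ?thesis using B1 by (intro exI[of _ B1]) auto
  next
    case False
    then obtain b0 where b0: "b0 \<in> B1" "\<phi> b0 \<noteq> 0" by blast
    \<comment> \<open>Projection along \<open>b0\<close> to the kernel of \<open>\<phi>\<close>.
      That its images neither coincide nor become dependent is a matter of counting: together with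
      \<open>b0\<close> they span \<open>B1\<close>.\<close>
    define T where "T = (\<lambda>b. b - scale (\<phi> b / \<phi> b0) b0)"
    define B2 where "B2 = T ` (B1 - {b0})"
    have sub: "B1 \<subseteq> span (insert b0 B2)"
    proof
      fix b assume b: "b \<in> B1"
      show "b \<in> span (insert b0 B2)"
      proof (cases "b = b0")
        case False
        hence "T b \<in> span (insert b0 B2)" using b by (auto simp: B2_def intro!: span_base)
        moreover have "scale (\<phi> b / \<phi> b0) b0 \<in> span (insert b0 B2)"
          by (intro span_scale span_base) simp
        ultimately have "T b + scale (\<phi> b / \<phi> b0) b0 \<in> span (insert b0 B2)" by (rule span_add)
        thus ?thesis by (simp add: T_def)
      qed (auto intro: span_base)
    qed
    have fin: "finite (insert b0 B2)" using B1 by (simp add: B2_def)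
    have ge: "card B1 \<le> card (insert b0 B2)"
      using independent_span_bound[OF fin B1(2) sub] by blast
    have "card B2 \<le> card B1 - 1"
      unfolding B2_def using B1(1) b0 card_image_le[of "B1 - {b0}" T] by simp
    moreover have "card B1 > 0" using B1(1) b0 card_gt_0_iff by blast
    moreover have "card (insert b0 B2) \<le> Suc (card B2)" using fin by (simp add: card_insert_if)
    ultimately have card: "card (insert b0 B2) \<le> card B1" "card B1 \<le> card B2 + 1" using ge by linarith+
    have "independent (insert b0 B2)"
      by (rule independent_if_card_le[OF fin card(1) B1(2) sub])
    hence "independent B2" by (rule independent_mono) auto
    moreover have "B2 \<subseteq> span B1"
      using span_base[of _ B1] span_scale[OF span_base[OF b0(1)]] by (auto simp: B2_def T_def intro!: span_diff)
    hence "B2 \<subseteq> span B" using B1(3) span_mono span_span by blast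
    moreover have "\<psi> b = 0" if hyp: "\<psi> \<in> set (\<phi> # \<Phi>)" "b \<in> B2" for \<psi> b
    proof -
      obtain b' where b': "b' \<in> B1" "b = T b'" using hyp(2) unfolding B2_def by blast
      have "\<psi> b' = \<psi> (T b' + scale (\<phi> b' / \<phi> b0) b0)" by (simp add: T_def)
      also have "\<dots> = \<psi> b + (\<phi> b' / \<phi> b0) * \<psi> b0"
        unfolding b' using that Cons.prems by metis
      finally have "\<psi> b' = \<psi> b + (\<phi> b' / \<phi> b0) * \<psi> b0" .
      moreover have "\<psi> = \<phi> \<or> \<psi> b' = 0 \<and> \<psi> b0 = 0" using that B1(5) b' b0 by auto
      ultimately show ?thesis using b0 by auto
    qed
    ultimately show ?thesis
      using B1(4) card fin by (intro exI[of _ B2]) auto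
  qed
qed

lemma independent_list_coeffs:
  assumes "distinct xs" "independent (set xs)" "(\<Sum>i<length xs. scale (a i) (xs ! i)) = 0" "i < length xs"
  shows "a i = 0"
proof -
  define u where "u = (\<lambda>v. a (inv_into {..<length xs} ((!) xs) v))"
  have bij: "bij_betw ((!) xs) {..<length xs} (set xs)" using assms(1) by (simp add: bij_betw_nth)
  have u: "u (xs ! i) = a i" if "i < length xs" for i
    using bij that by (simp add: u_def bij_betw_def)
  have "(\<Sum>v\<in>set xs. scale (u v) v) = (\<Sum>i<length xs. scale (u (xs ! i)) (xs ! i))"
    by (rule sum.reindex_bij_betw[OF bij, symmetric])
  also have "\<dots> = (\<Sum>i<length xs. scale (a i) (xs ! i))" by (rule sum.cong) (auto simp: u)
  also have "\<dots> = 0" by (fact assms(3))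
  finally have "u (xs ! i) = 0"
    using assms(2,4) by (intro independentD[of "set xs" "set xs" u]) auto
  thus ?thesis using u assms(4) by simp
qed

lemma independent_listI:
  assumes "\<And>a. (\<Sum>i<length xs. scale (a i) (xs ! i)) = 0 \<Longrightarrow> (\<forall>i<length xs. a i = 0)"
  shows "distinct xs \<and> independent (set xs)"
proof
  show d: "distinct xs"
    unfolding distinct_conv_nth
  proof (intro allI impI notI)
    fix i j assume ij: "i < length xs" "j < length xs" "i \<noteq> j" and eq: "xs ! i = xs ! j"
    \<comment> \<open>The relation with coefficients 1 and -1 that two equal entries would
      satisfy.\<close>
    define a where "a = (\<lambda>k. if k = i then 1 else if k = j then -1 else (0::'a))"
    have "(\<Sum>k<length xs. scale (a k) (xs ! k)) = (\<Sum>k\<in>{i, j}. scale (a k) (xs ! k))"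
      using ij by (intro sum.mono_neutral_right) (auto simp: a_def)
    also have "\<dots> = 0" using ij eq by (simp add: a_def)
    finally have "a i = 0" using assms ij by blast
    thus False by (simp add: a_def)
  qed
  show "independent (set xs)"
  proof (rule independent_if_scalars_zero)
    fix f x assume "(\<Sum>x\<in>set xs. scale (f x) x) = 0" and x: "x \<in> set xs"
    hence "(\<Sum>i<length xs. scale (f (xs ! i)) (xs ! i)) = 0"
      using sum.reindex_bij_betw[OF bij_betw_nth[OF d refl refl], of "\<lambda>x. scale (f x) x"] by simp
    from assms[OF this] x show "f x = 0" by (auto simp: in_set_conv_nth)
  qed simp
qed

lemma independent_Un:
  assumes A: "finite A" "independent A" and B: "finite B" "independent B"
    and AB: "span A \<inter> span B = {0}"
  shows "independent (A \<union> B) \<and> A \<inter> B = {}"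
proof
  have "0 \<notin> A" using A(2) dependent_zero by blast
  show disj: "A \<inter> B = {}"
  proof (rule ccontr)
    assume "A \<inter> B \<noteq> {}"
    then obtain x where "x \<in> A" "x \<in> B" by blast
    hence "x \<in> span A \<inter> span B" by (auto intro: span_base)
    with AB \<open>0 \<notin> A\<close> \<open>x \<in> A\<close> show False by auto
  qed
  show "independent (A \<union> B)"
  proof (rule independent_if_scalars_zero)
    fix f x assume 0: "(\<Sum>x\<in>A \<union> B. scale (f x) x) = 0" and x: "x \<in> A \<union> B"
    have split: "(\<Sum>x\<in>A. scale (f x) x) + (\<Sum>x\<in>B. scale (f x) x) = 0"
      using 0 sum.union_disjoint[OF A(1) B(1) disj, of "\<lambda>x. scale (f x) x"] by simp
    have mem: "(\<Sum>x\<in>A. scale (f x) x) \<in> span A" "(\<Sum>x\<in>B. scale (f x) x) \<in> span B"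
      by (intro span_sum span_scale span_base; assumption)+
    have "(\<Sum>x\<in>A. scale (f x) x) = - (\<Sum>x\<in>B. scale (f x) x)"
      using split by (simp add: add_eq_0_iff2)
    hence "(\<Sum>x\<in>A. scale (f x) x) \<in> span B" using mem span_neg by metis
    hence "(\<Sum>x\<in>A. scale (f x) x) = 0" using mem AB by blast
    moreover from this split have "(\<Sum>x\<in>B. scale (f x) x) = 0" by simp
    ultimately show "f x = 0"
      using x independentD[OF A(2) A(1) subset_refl] independentD[OF B(2) B(1) subset_refl] by blast
  qed (use A B in auto)
qed

end

section \<open>Polynomials of bounded degree\<close>

global_interpretation poly_vs: vector_space "Polynomial.smult :: complex \<Rightarrow> complex poly \<Rightarrow> complex poly"
  by unfold_locales (auto simp: smult_add_right smult_add_left)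

text \<open>Bounding coefficients instead of the degree is right also for \<open>n = 0\<close>,
  where the span is \<open>{0}\<close> although the zero polynomial has degree 0.\<close>

lemma span_monoms: "poly_vs.span ((\<lambda>i. monom 1 i) ` {..<n}) = {p. \<forall>i\<ge>n. poly.coeff p i = 0}"
proof (intro equalityI subsetI)
  fix p assume "p \<in> poly_vs.span ((\<lambda>i. monom 1 i) ` {..<n})"
  thus "p \<in> {p. \<forall>i\<ge>n. poly.coeff p i = 0}"
    by (induction rule: poly_vs.span_induct) (auto simp: poly_vs.subspace_def)
next
  fix p :: "complex poly" assume p: "p \<in> {p. \<forall>i\<ge>n. poly.coeff p i = 0}"
  have "p = (\<Sum>i\<le>degree p. Polynomial.smult (poly.coeff p i) (monom 1 i))"
    by (simp add: smult_monom poly_as_sum_of_monoms)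
  moreover have "Polynomial.smult (poly.coeff p i) (monom 1 i) \<in> poly_vs.span ((\<lambda>i. monom 1 i) ` {..<n})" for i
  proof (cases "i < n")
    case True
    thus ?thesis by (intro poly_vs.span_scale poly_vs.span_base) auto
  next
    case False
    thus ?thesis using p by (simp add: poly_vs.span_zero)
  qed
  hence "(\<Sum>i\<le>degree p. Polynomial.smult (poly.coeff p i) (monom 1 i)) \<in> poly_vs.span ((\<lambda>i. monom 1 i) ` {..<n})"
    by (rule poly_vs.span_sum)
  ultimately show "p \<in> poly_vs.span ((\<lambda>i. monom 1 i) ` {..<n})" by simp
qed

lemma card_monoms: "card ((\<lambda>i. monom (1::complex) i) ` {..<n}) = n"
  by (subst card_image) (auto simp: inj_on_def monom_eq_iff')

lemma independent_monoms: "poly_vs.independent ((\<lambda>i. monom 1 i) ` {..<n})"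
proof (rule poly_vs.independent_if_scalars_zero)
  fix f :: "complex poly \<Rightarrow> complex" and x :: "complex poly"
  assume 0: "(\<Sum>x\<in>(\<lambda>i. monom 1 i) ` {..<n}. Polynomial.smult (f x) x) = 0"
    and "x \<in> (\<lambda>i. monom 1 i) ` {..<n}"
  then obtain i where i: "i < n" "x = monom 1 i" by auto
  have "inj_on (\<lambda>i. monom (1::complex) i) {..<n}" by (auto simp: inj_on_def monom_eq_iff')
  hence "(\<Sum>k<n. monom (f (monom 1 k)) k) = 0"
    using 0 by (simp add: sum.reindex smult_monom)
  hence "poly.coeff (\<Sum>k<n. monom (f (monom 1 k)) k) i = 0" by simp
  thus "f x = 0" using i by (simp add: coeff_sum)
qed simp

text \<open>Prepares dimension counts: \<open>G\<close> represents a basis of the polynomials of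
  degree below \<open>n\<close> modulo the span of \<open>S\<close>.\<close>

lemma independent_poly_complement:
  assumes S: "finite S" "poly_vs.independent S" "\<And>p. p \<in> S \<Longrightarrow> degree p < n"
  obtains G where "finite G" "card G + card S = n" "G \<inter> S = {}" "poly_vs.independent (G \<union> S)"
    "\<And>p. p \<in> G \<Longrightarrow> \<forall>i\<ge>n. poly.coeff p i = 0" "\<And>p. degree p < n \<Longrightarrow> p \<in> poly_vs.span (G \<union> S)"
proof -
  let ?M = "(\<lambda>i. monom (1::complex) i) ` {..<n}"
  let ?V = "poly_vs.span ?M"
  have V: "p \<in> ?V" if "degree p < n" for p :: "complex poly"
    using that by (auto simp: span_monoms intro!: coeff_eq_0)
  have "S \<subseteq> ?V" using S V by auto
  from poly_vs.maximal_independent_subset_extend[OF this S(2)] obtain B where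
    B: "S \<subseteq> B" "B \<subseteq> ?V" "poly_vs.independent B" "?V \<subseteq> poly_vs.span B" by blast
  have "finite ?M" by simp
  from poly_vs.independent_span_bound[OF this B(3,2)]
  have fin: "finite B" "card B \<le> n" by (simp_all add: card_monoms)
  have "?M \<subseteq> poly_vs.span B" using B(4) poly_vs.span_superset[of ?M] by (rule order_trans[rotated])
  from poly_vs.independent_span_bound[OF fin(1) independent_monoms this]
  have "n \<le> card B" by (simp add: card_monoms)
  hence "card (B - S) + card S = n"
    using fin B(1) S(1) card_Diff_subset[OF S(1) B(1)] card_mono[OF fin(1) B(1)] by linarith
  moreover have "(B - S) \<union> S = B" using B(1) by blast
  ultimately show thesis
  proof (intro that[of "B - S"])
    fix p assume "p \<in> B - S"
    thus "\<forall>i\<ge>n. poly.coeff p i = 0" using B(2) unfolding span_monoms by blast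
  next
    fix p :: "complex poly" assume "degree p < n"
    from V[OF this] show "p \<in> poly_vs.span (B - S \<union> S)"
      using B(4) \<open>(B - S) \<union> S = B\<close> by auto
  qed (use fin B in auto)
qed

section \<open>Functionals on entire functions\<close>

abbreviation entire :: "(complex \<Rightarrow> complex) \<Rightarrow> bool" where
  "entire f \<equiv> f holomorphic_on UNIV"

definition D_all :: "functional set" where
  "D_all = functional.span (range (\<lambda>(k, \<zeta>). ev k \<zeta>))"

lemma entire_poly [simp, intro]: "entire (poly p)"
  by (intro holomorphic_intros)

lemma entire_exp [simp, intro]: "entire (\<lambda>w. exp (x * w))"
  by (intro holomorphic_intros)

lemma entire_mult [intro]: "entire f \<Longrightarrow> entire g \<Longrightarrow> entire (\<lambda>z. f z * g z)"
  by (intro holomorphic_intros)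

lemma functional_span_induct [consumes 1, case_names zero step]:
  assumes "c \<in> functional.span S" "P (\<lambda>_. 0)"
    "\<And>a x c. x \<in> S \<Longrightarrow> c \<in> functional.span S \<Longrightarrow> P c \<Longrightarrow> P (\<lambda>f. a * x f + c f)"
  shows "P c"
proof -
  have "c \<in> functional.span S \<and> P c"
    using assms(1)
  proof (induction rule: functional.span_induct_alt)
    case base
    thus ?case using assms(2) functional.span_zero[of S] by (simp add: zero_fun_def)
  next
    case (step a x c)
    have "(\<lambda>f. a * x f) + c \<in> functional.span S"
      using step by (intro functional.span_add[OF functional.span_scale[OF functional.span_base]]) blast+
    thus ?case using step assms(3)[of x c a] by (simp add: plus_fun_def)
  qed
  thus ?thesis by blast
qed

lemma functional_span_zero: "(\<lambda>_. 0) \<in> functional.span S"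
  using functional.span_zero[of S] by (simp add: zero_fun_def)

lemma functional_span_step:
  "c \<in> functional.span S \<Longrightarrow> d \<in> functional.span S \<Longrightarrow> (\<lambda>f. a * c f + d f) \<in> functional.span S"
  using functional.span_add[OF functional.span_scale, of c S d a] by (simp add: plus_fun_def)

lemma functional_span_scale:
  "c \<in> functional.span S \<Longrightarrow> (\<lambda>f. a * c f) \<in> functional.span S"
  using functional_span_step[OF _ functional_span_zero] by simp

lemma functional_span_sum:
  assumes "\<And>i. i \<in> I \<Longrightarrow> c i \<in> functional.span S"
  shows "(\<lambda>f. \<Sum>i\<in>I. a i * c i f) \<in> functional.span S"
  using assms
  by (induction I rule: infinite_finite_induct) (auto intro: functional_span_zero functional_span_step)

lemma D_at_le_D_all: "D_at \<zeta> \<subseteq> D_all"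
  unfolding D_at_def D_all_def by (rule functional.span_mono) auto

lemma D_all_induct [consumes 1, case_names zero step]:
  assumes "c \<in> D_all" "P (\<lambda>_. 0)"
    "\<And>a k \<zeta> c. c \<in> D_all \<Longrightarrow> P c \<Longrightarrow> P (\<lambda>f. a * ev k \<zeta> f + c f)"
  shows "P c"
  using assms(1) unfolding D_all_def
  by (induction rule: functional_span_induct) (use assms in \<open>auto simp: D_all_def\<close>)

lemma ev_in_D_at [simp, intro]: "ev k \<zeta> \<in> D_at \<zeta>"
  unfolding D_at_def by (auto intro: functional.span_base)

lemma ev_in_D_all [simp, intro]: "ev k \<zeta> \<in> D_all"
  using D_at_le_D_all by blast

lemma ev_add: "entire f \<Longrightarrow> entire g \<Longrightarrow> ev k \<zeta> (\<lambda>z. f z + g z) = ev k \<zeta> f + ev k \<zeta> g"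
  using higher_deriv_add[of f UNIV g \<zeta> k] by (simp add: ev_def holomorphic_on_add)

lemma ev_cmult: "entire f \<Longrightarrow> ev k \<zeta> (\<lambda>z. a * f z) = a * ev k \<zeta> f"
  using higher_deriv_cmult[of f UNIV \<zeta> k a] by (simp add: ev_def holomorphic_on_mult)

lemma D_all_add:
  assumes "c \<in> D_all" "entire f" "entire g"
  shows "c (\<lambda>z. f z + g z) = c f + c g"
  using assms(1) by (induction rule: D_all_induct) (simp_all add: ev_add assms algebra_simps)

lemma D_all_cmult:
  assumes "c \<in> D_all" "entire f"
  shows "c (\<lambda>z. a * f z) = a * c f"
  using assms(1) by (induction rule: D_all_induct) (simp_all add: ev_cmult assms algebra_simps)

text \<open>The default value 0; because of it, functionals in \<open>D_all\<close> that agree at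
  entire functions are equal.\<close>

lemma D_all_not_entire:
  assumes "c \<in> D_all" "\<not> entire f"
  shows "c f = 0"
  using assms(1) by (induction rule: D_all_induct) (simp_all add: ev_def assms(2))

lemma D_all_sum:
  assumes "c \<in> D_all" "\<And>i. i \<in> I \<Longrightarrow> entire (f i)"
  shows "c (\<lambda>z. \<Sum>i\<in>I. a i * f i z) = (\<Sum>i\<in>I. a i * c (f i))"
  using assms(2)
proof (induction I rule: infinite_finite_induct)
  case (insert i I)
  have "c (\<lambda>z. a i * f i z + (\<Sum>i\<in>I. a i * f i z)) = c (\<lambda>z. a i * f i z) + c (\<lambda>z. \<Sum>i\<in>I. a i * f i z)"
    using insert.prems by (intro D_all_add assms(1) holomorphic_intros) auto
  thus ?case using insert by (simp add: D_all_cmult[OF assms(1)])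
qed (use D_all_cmult[OF assms(1), of "\<lambda>_. 0" 0] in auto)

section \<open>Multiplication, differentiation and division under functionals\<close>

text \<open>By the Leibniz rule \<open>ev k \<zeta>\<close> of a product with \<open>u\<close> is a
  combination of the \<open>ev j \<zeta>\<close> with \<open>j \<le> k\<close>. The equation is
  restricted to entire \<open>f\<close>, since a product with \<open>u\<close> can be entire when
  \<open>f\<close> is not.\<close>

lemma D_at_mult:
  assumes "c \<in> D_at \<zeta>" "entire u"
  obtains d where "d \<in> D_at \<zeta>" "\<And>f. entire f \<Longrightarrow> d f = c (\<lambda>z. u z * f z)"
proof -
  have "\<exists>d\<in>D_at \<zeta>. \<forall>f. entire f \<longrightarrow> d f = c (\<lambda>z. u z * f z)"
    using assms(1) unfolding D_at_def
  proof (induction rule: functional_span_induct)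
    case zero
    show ?case by (rule bexI[of _ "\<lambda>_. 0"]) (auto intro: functional_span_zero)
  next
    case (step a x c)
    then obtain d k where d: "d \<in> functional.span (range (\<lambda>k. ev k \<zeta>))"
      "\<And>f. entire f \<Longrightarrow> d f = c (\<lambda>z. u z * f z)" and k: "x = ev k \<zeta>" by blast
    define e where "e = (\<lambda>f. \<Sum>i=0..k. (of_nat (k choose i) * (deriv ^^ i) u \<zeta>) * ev (k - i) \<zeta> f)"
    have e: "e \<in> functional.span (range (\<lambda>k. ev k \<zeta>))"
      unfolding e_def by (intro functional_span_sum functional.span_base) auto
    have "e f = x (\<lambda>z. u z * f z)" if "entire f" for f
      using higher_deriv_mult[of u UNIV f \<zeta> k] assms(2) that
      by (simp add: k e_def ev_def entire_mult)
    with d show ?case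
      by (intro bexI[OF _ functional_span_step[OF e d(1)]]) auto
  qed
  thus thesis using that by blast
qed

lemma D_all_mult:
  assumes "c \<in> D_all" "entire u"
  obtains d where "d \<in> D_all" "\<And>f. entire f \<Longrightarrow> d f = c (\<lambda>z. u z * f z)"
proof -
  have "\<exists>d\<in>D_all. \<forall>f. entire f \<longrightarrow> d f = c (\<lambda>z. u z * f z)"
    using assms(1)
  proof (induction rule: D_all_induct)
    case zero
    show ?case by (rule bexI[of _ "\<lambda>_. 0"]) (auto simp: D_all_def intro: functional_span_zero)
  next
    case (step a k \<zeta> c)
    then obtain d where d: "d \<in> D_all" "\<And>f. entire f \<Longrightarrow> d f = c (\<lambda>z. u z * f z)" by blast
    obtain e where e: "e \<in> D_at \<zeta>" "\<And>f. entire f \<Longrightarrow> e f = ev k \<zeta> (\<lambda>z. u z * f z)"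
      using D_at_mult[OF ev_in_D_at assms(2)] by blast
    have "(\<lambda>f. a * e f + d f) \<in> D_all"
      using e d D_at_le_D_all unfolding D_all_def by (intro functional_span_step) auto
    thus ?case using d e by (intro bexI) auto
  qed
  thus thesis using that by blast
qed

lemma D_all_deriv:
  assumes "c \<in> D_all"
  obtains d where "d \<in> D_all" "\<And>f. entire f \<Longrightarrow> d f = c (deriv f)"
proof -
  have "\<exists>d\<in>D_all. \<forall>f. entire f \<longrightarrow> d f = c (deriv f)"
    using assms(1)
  proof (induction rule: D_all_induct)
    case zero
    show ?case by (rule bexI[of _ "\<lambda>_. 0"]) (auto simp: D_all_def intro: functional_span_zero)
  next
    case (step a k \<zeta> c)
    then obtain d where d: "d \<in> D_all" "\<And>f. entire f \<Longrightarrow> d f = c (deriv f)" by blast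
    have "(\<lambda>f. a * ev (Suc k) \<zeta> f + d f) \<in> D_all"
      using d ev_in_D_all unfolding D_all_def by (intro functional_span_step) auto
    moreover have "ev (Suc k) \<zeta> f = ev k \<zeta> (deriv f)" if "entire f" for f
      using that holomorphic_deriv[OF that] by (simp add: ev_def funpow_swap1)
    ultimately show ?case using d by (intro bexI) auto
  qed
  thus thesis using that by blast
qed

lemma ev_Suc_linear_mult:
  assumes "entire g"
  shows "ev (Suc k) \<zeta> (\<lambda>w. (w - a) * g w) = of_nat (Suc k) * ev k \<zeta> g + (\<zeta> - a) * ev (Suc k) \<zeta> g"
proof -
  have "(deriv ^^ Suc k) (\<lambda>w. (w - a) * g w) \<zeta> =
    (\<Sum>i=0..Suc k. of_nat (Suc k choose i) * (deriv ^^ i) (\<lambda>w. w - a) \<zeta> * (deriv ^^ (Suc k - i)) g \<zeta>)"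
    by (rule higher_deriv_mult[of _ UNIV]) (auto intro!: holomorphic_intros assms)
  also have "\<dots> = (\<Sum>i\<in>{0, 1}. of_nat (Suc k choose i) * (deriv ^^ i) (\<lambda>w. w - a) \<zeta> * (deriv ^^ (Suc k - i)) g \<zeta>)"
  proof (rule sum.mono_neutral_right)
    have "(deriv ^^ i) (\<lambda>w. w - a) \<zeta> = 0" if "i \<ge> 2" for i
    proof -
      have "(deriv ^^ i) (\<lambda>w. w - a) \<zeta> = (deriv ^^ i) (\<lambda>w. w) \<zeta> - (deriv ^^ i) (\<lambda>w. a) \<zeta>"
        by (rule higher_deriv_diff[of _ UNIV]) auto
      thus ?thesis using that by simp
    qed
    thus "\<forall>i\<in>{0..Suc k} - {0, 1}. of_nat (Suc k choose i) * (deriv ^^ i) (\<lambda>w. w - a) \<zeta> * (deriv ^^ (Suc k - i)) g \<zeta> = 0"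
      by auto
  qed auto
  also have "\<dots> = of_nat (Suc k) * (deriv ^^ k) g \<zeta> + (\<zeta> - a) * (deriv ^^ Suc k) g \<zeta>"
    by simp
  finally show ?thesis
    using assms by (simp add: ev_def entire_mult holomorphic_intros del: funpow.simps)
qed

lemma ev_0_linear_mult: "entire g \<Longrightarrow> ev 0 \<zeta> (\<lambda>w. (w - a) * g w) = (\<zeta> - a) * ev 0 \<zeta> g"
  by (auto simp: ev_def intro!: holomorphic_intros)

text \<open>The transpose of multiplication by \<open>w - a\<close> is surjective. At
  \<open>\<zeta> = a\<close> it lowers the order of the derivative, so a multiple of
  \<open>ev (Suc k) \<zeta>\<close> is a preimage of \<open>ev k \<zeta>\<close>; elsewhere it is
  triangular with the invertible diagonal entry \<open>\<zeta> - a\<close>.\<close>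

lemma D_all_divide_linear:
  assumes "c \<in> D_all"
  obtains d where "d \<in> D_all" "\<And>g. entire g \<Longrightarrow> d (\<lambda>w. (w - a) * g w) = c g"
proof -
  have ev: "\<exists>d\<in>D_all. \<forall>g. entire g \<longrightarrow> d (\<lambda>w. (w - a) * g w) = ev k \<zeta> g" for k \<zeta>
  proof (cases "\<zeta> = a")
    case True
    have mem: "(\<lambda>f. 1 / of_nat (Suc k) * ev (Suc k) \<zeta> f) \<in> D_all"
      using ev_in_D_all unfolding D_all_def by (rule functional_span_scale)
    have "1 / of_nat (Suc k) * ev (Suc k) \<zeta> (\<lambda>w. (w - a) * g w) = ev k \<zeta> g" if "entire g" for g
      using ev_Suc_linear_mult[OF that, of k \<zeta> a] True by (simp del: of_nat_Suc)
    thus ?thesis by (intro bexI[OF _ mem] allI impI)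
  next
    case False
    show ?thesis
    proof (induction k)
      case 0
      have mem: "(\<lambda>f. 1 / (\<zeta> - a) * ev 0 \<zeta> f) \<in> D_all"
        using ev_in_D_all unfolding D_all_def by (rule functional_span_scale)
      have "1 / (\<zeta> - a) * ev 0 \<zeta> (\<lambda>w. (w - a) * g w) = ev 0 \<zeta> g" if "entire g" for g
        using ev_0_linear_mult[OF that, of \<zeta> a] False by simp
      thus ?case by (intro bexI[OF _ mem] allI impI)
    next
      case (Suc k)
      then obtain d where d: "d \<in> D_all" "\<And>g. entire g \<Longrightarrow> d (\<lambda>w. (w - a) * g w) = ev k \<zeta> g" by blast
      have "(\<lambda>f. - of_nat (Suc k) / (\<zeta> - a) * d f) \<in> D_all"
        using d(1) unfolding D_all_def by (rule functional_span_scale)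
      with ev_in_D_all have mem: "(\<lambda>f. 1 / (\<zeta> - a) * ev (Suc k) \<zeta> f + (- of_nat (Suc k) / (\<zeta> - a) * d f)) \<in> D_all"
        unfolding D_all_def by (rule functional_span_step)
      have "1 / (\<zeta> - a) * ev (Suc k) \<zeta> (\<lambda>w. (w - a) * g w) +
          (- of_nat (Suc k) / (\<zeta> - a) * d (\<lambda>w. (w - a) * g w)) = ev (Suc k) \<zeta> g" if "entire g" for g
      proof -
        define N u :: complex where "N = of_nat (Suc k)" and "u = \<zeta> - a"
        have "u \<noteq> 0" using False by (simp add: u_def)
        thus ?thesis
          unfolding ev_Suc_linear_mult[OF that] d(2)[OF that] N_def[symmetric] u_def[symmetric]
          by (simp add: distrib_left)
      qed
      thus ?case by (intro bexI[OF _ mem] allI impI)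
    qed
  qed
  have "\<exists>d\<in>D_all. \<forall>g. entire g \<longrightarrow> d (\<lambda>w. (w - a) * g w) = c g"
    using assms(1)
  proof (induction rule: D_all_induct)
    case zero
    show ?case by (rule bexI[of _ "\<lambda>_. 0"]) (auto simp: D_all_def intro: functional_span_zero)
  next
    case (step b k \<zeta> c)
    then obtain d where d: "d \<in> D_all" "\<And>g. entire g \<Longrightarrow> d (\<lambda>w. (w - a) * g w) = c g" by blast
    obtain e where e: "e \<in> D_all" "\<And>g. entire g \<Longrightarrow> e (\<lambda>w. (w - a) * g w) = ev k \<zeta> g"
      using ev by blast
    have "(\<lambda>f. b * e f + d f) \<in> D_all"
      using e d unfolding D_all_def by (intro functional_span_step) auto
    thus ?case using d e by (intro bexI) auto
  qed
  thus thesis using that by blast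
qed

lemma poly_roots_induct [case_names const root]:
  fixes q :: "complex poly"
  assumes "\<And>c. P [:c:]" "\<And>a q. P q \<Longrightarrow> P ([:-a, 1:] * q)"
  shows "P q"
proof (induction "degree q" arbitrary: q)
  case 0
  then obtain c where "q = [:c:]" using degree_eq_zeroE by metis
  thus ?case using assms(1) by simp
next
  case (Suc n)
  obtain a where "poly q a = 0"
    using alg_closed_imp_poly_has_root[of q] Suc.hyps(2) by auto
  then obtain q' where q': "q = [:-a, 1:] * q'" unfolding poly_eq_0_iff_dvd by (rule dvdE)
  have "q' \<noteq> 0" using Suc.hyps(2) q' by auto
  hence "degree q = Suc (degree q')" unfolding q' by (subst degree_mult_eq) auto
  with Suc.hyps(2) have "n = degree q'" by simp
  from assms(2)[OF Suc.hyps(1)[OF this]] show ?case unfolding q' .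
qed

text \<open>One root of \<open>q\<close> at a time. The lemma carries a condition on a quotient by
  \<open>q\<close> over to a condition on the numerator.\<close>

lemma D_all_divide:
  assumes "c \<in> D_all" "q \<noteq> 0"
  obtains d where "d \<in> D_all" "\<And>g. entire g \<Longrightarrow> d (\<lambda>w. poly q w * g w) = c g"
proof -
  have "\<exists>d\<in>D_all. \<forall>g. entire g \<longrightarrow> d (\<lambda>w. poly q w * g w) = c g"
    using assms
  proof (induction q arbitrary: c rule: poly_roots_induct)
    case (const b)
    have mem: "(\<lambda>f. 1 / b * c f) \<in> D_all"
      using const(1) unfolding D_all_def by (rule functional_span_scale)
    have "1 / b * c (\<lambda>w. b * g w) = c g" if "entire g" for g
      using D_all_cmult[OF const(1) that, of b] const(2) by simp
    thus ?case by (intro bexI[OF _ mem]) simp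
  next
    case (root a q)
    hence "q \<noteq> 0" by auto
    from root.IH[OF root.prems(1) this] obtain e where
      e: "e \<in> D_all" "\<And>g. entire g \<Longrightarrow> e (\<lambda>w. poly q w * g w) = c g" by blast
    obtain d where d: "d \<in> D_all" "\<And>g. entire g \<Longrightarrow> d (\<lambda>w. (w - a) * g w) = e g"
      using D_all_divide_linear[OF e(1)] by blast
    have "d (\<lambda>w. poly ([:-a, 1:] * q) w * g w) = c g" if "entire g" for g
    proof -
      have "d (\<lambda>w. (w - a) * (poly q w * g w)) = c g"
        using d(2)[of "\<lambda>w. poly q w * g w"] e(2)[OF that] that by (simp add: entire_mult)
      moreover have "(\<lambda>w. poly ([:-a, 1:] * q) w * g w) = (\<lambda>w. (w - a) * (poly q w * g w))"
        by (simp add: algebra_simps)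
      ultimately show ?thesis by (simp only:)
    qed
    thus ?case using d(1) by blast
  qed
  thus thesis using that by blast
qed

section \<open>Annihilators and the reduction of entire functions to polynomials\<close>

lemma ev_kill:
  assumes "entire h"
  shows "ev k \<zeta> (\<lambda>w. (w - \<zeta>) ^ Suc k * h w) = 0"
  using assms
proof (induction k arbitrary: h)
  case 0
  thus ?case using ev_0_linear_mult[of h \<zeta> \<zeta>] by simp
next
  case (Suc k)
  have ent: "entire (\<lambda>w. (w - \<zeta>) ^ Suc k * h w)"
    by (intro holomorphic_intros Suc.prems)
  have "ev (Suc k) \<zeta> (\<lambda>w. (w - \<zeta>) * ((w - \<zeta>) ^ Suc k * h w)) = 0"
    unfolding ev_Suc_linear_mult[OF ent] Suc.IH[OF Suc.prems] by simp
  thus ?case by (simp add: mult.assoc)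
qed

lemma D_at_kill:
  assumes "c \<in> D_at \<zeta>"
  obtains n where "\<And>h. entire h \<Longrightarrow> c (\<lambda>w. poly ([:-\<zeta>, 1:] ^ n) w * h w) = 0"
proof -
  have "\<exists>n. \<forall>h. entire h \<longrightarrow> c (\<lambda>w. poly ([:-\<zeta>, 1:] ^ n) w * h w) = 0"
    using assms unfolding D_at_def
  proof (induction rule: functional_span_induct)
    case zero
    show ?case by simp
  next
    case (step a x c)
    then obtain n k where n: "\<And>h. entire h \<Longrightarrow> c (\<lambda>w. poly ([:-\<zeta>, 1:] ^ n) w * h w) = 0"
      and k: "x = ev k \<zeta>" by blast
    have "a * x (\<lambda>w. poly ([:-\<zeta>, 1:] ^ (n + Suc k)) w * h w) +
        c (\<lambda>w. poly ([:-\<zeta>, 1:] ^ (n + Suc k)) w * h w) = 0" if "entire h" for h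
    proof -
      have "entire (\<lambda>w. (w - \<zeta>) ^ n * h w)" "entire (\<lambda>w. poly ([:-\<zeta>, 1:] ^ Suc k) w * h w)"
        by (intro holomorphic_intros that)+
      from ev_kill[OF this(1), of k] n[OF this(2)] show ?thesis
        by (simp add: k power_add algebra_simps)
    qed
    thus ?case by blast
  qed
  thus thesis using that by blast
qed

text \<open>Each \<open>ev k \<zeta>\<close> kills the multiples of a power of
  \<open>w - \<zeta>\<close>, and a product of annihilators serves for a sum. A functional therefore
  sees entire functions only modulo a nonzero polynomial.\<close>

lemma D_all_kill:
  assumes "c \<in> D_all"
  obtains r where "r \<noteq> 0" "\<And>h. entire h \<Longrightarrow> c (\<lambda>w. poly r w * h w) = 0"
proof -
  have "\<exists>r. r \<noteq> 0 \<and> (\<forall>h. entire h \<longrightarrow> c (\<lambda>w. poly r w * h w) = 0)"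
    using assms
  proof (induction rule: D_all_induct)
    case zero
    show ?case by (intro exI[of _ 1]) simp
  next
    case (step a k \<zeta> c)
    then obtain r where r: "r \<noteq> 0" "\<And>h. entire h \<Longrightarrow> c (\<lambda>w. poly r w * h w) = 0" by blast
    obtain n where n: "\<And>h. entire h \<Longrightarrow> ev k \<zeta> (\<lambda>w. poly ([:-\<zeta>, 1:] ^ n) w * h w) = 0"
      using D_at_kill[OF ev_in_D_at] by blast
    define t where "t = [:-\<zeta>, 1:] ^ n"
    have "t \<noteq> 0" by (simp add: t_def)
    moreover have "a * ev k \<zeta> (\<lambda>w. poly (r * t) w * h w) + c (\<lambda>w. poly (r * t) w * h w) = 0"
      if "entire h" for h
    proof -
      have e: "(\<lambda>w. poly (r * t) w * h w) = (\<lambda>w. poly t w * (poly r w * h w))"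
        "(\<lambda>w. poly (r * t) w * h w) = (\<lambda>w. poly r w * (poly t w * h w))"
        by (simp_all add: algebra_simps)
      have "ev k \<zeta> (\<lambda>w. poly (r * t) w * h w) = 0"
        unfolding e(1) unfolding t_def by (rule n) (intro holomorphic_intros that)
      moreover have "c (\<lambda>w. poly (r * t) w * h w) = 0"
        unfolding e(2) by (rule r) (intro holomorphic_intros that)
      ultimately show ?thesis by simp
    qed
    ultimately show ?case using r(1) by (intro exI[of _ "r * t"]) auto
  qed
  thus thesis using that by blast
qed

lemma D_all_kill_common:
  assumes "finite C" "C \<subseteq> D_all"
  obtains r where "r \<noteq> 0" "\<And>c h. c \<in> C \<Longrightarrow> entire h \<Longrightarrow> c (\<lambda>w. poly r w * h w) = 0"
proof -
  have "\<exists>r. r \<noteq> 0 \<and> (\<forall>c\<in>C. \<forall>h. entire h \<longrightarrow> c (\<lambda>w. poly r w * h w) = 0)"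
    using assms
  proof (induction C rule: finite_induct)
    case empty
    show ?case by (intro exI[of _ 1]) simp
  next
    case (insert c C)
    hence "C \<subseteq> D_all" and c: "c \<in> D_all" by simp_all
    from insert.IH[OF this(1)] obtain r where r: "r \<noteq> 0"
      "\<forall>c\<in>C. \<forall>h. entire h \<longrightarrow> c (\<lambda>w. poly r w * h w) = 0" by (elim exE conjE)
    obtain t where t: "t \<noteq> 0" "\<And>h. entire h \<Longrightarrow> c (\<lambda>w. poly t w * h w) = 0"
      using D_all_kill[OF c] by blast
    have "d (\<lambda>w. poly (r * t) w * h w) = 0" if "d \<in> insert c C" and h: "entire h" for d h
    proof -
      have e: "(\<lambda>w. poly (r * t) w * h w) = (\<lambda>w. poly t w * (poly r w * h w))"
        "(\<lambda>w. poly (r * t) w * h w) = (\<lambda>w. poly r w * (poly t w * h w))"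
        by (simp_all add: algebra_simps)
      have "c (\<lambda>w. poly (r * t) w * h w) = 0"
        unfolding e(1) by (rule t) (intro holomorphic_intros h)
      moreover have "d (\<lambda>w. poly (r * t) w * h w) = 0" if "d \<in> C"
        unfolding e(2) by (rule r(2)[rule_format, OF that]) (intro holomorphic_intros h)
      ultimately show ?thesis using that(1) by (cases "d = c") simp_all
    qed
    moreover have "r * t \<noteq> 0" using r(1) t(1) by simp
    ultimately show ?case by (intro exI[of _ "r * t"] conjI ballI allI impI)
  qed
  thus thesis using that by blast
qed

text \<open>Root by root: \<open>h z - h a\<close> is divisible by \<open>z - a\<close> with an
  entire quotient, the singularity being removable. So entire functions modulo \<open>r\<close> are
  represented by polynomials.\<close>

lemma entire_division:
  assumes "entire g" "r \<noteq> 0"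
  obtains f h where "entire h" "\<And>z. g z = poly f z + poly r z * h z"
proof -
  have "\<exists>f h. entire h \<and> (\<forall>z. g z = poly f z + poly r z * h z)"
    using assms(2)
  proof (induction r rule: poly_roots_induct)
    case (const c)
    show ?case
      by (rule exI[of _ 0], rule exI[of _ "\<lambda>z. g z / c"])
        (use const in \<open>auto intro!: holomorphic_intros assms(1)\<close>)
  next
    case (root a r)
    hence "r \<noteq> 0" by auto
    from root.IH[OF this] obtain f h where h: "entire h" "\<And>z. g z = poly f z + poly r z * h z" by blast
    define h2 where "h2 = (\<lambda>z. if z = a then deriv h a else (h z - h a) / (z - a))"
    have "entire h2" unfolding h2_def by (rule pole_lemma_open[OF h(1)]) simp
    moreover have "g z = poly (f + Polynomial.smult (h a) r) z + poly ([:-a, 1:] * r) z * h2 z" for z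
    proof -
      have "h z = h a + (z - a) * h2 z" by (simp add: h2_def)
      hence "g z = poly f z + poly r z * (h a + (z - a) * h2 z)" using h(2)[of z] by simp
      thus ?thesis by (simp add: algebra_simps)
    qed
    ultimately show ?case by blast
  qed
  thus thesis using that by blast
qed

text \<open>Modulo a polynomial whose multiples \<open>c\<close> kills, every entire function is a
  polynomial; elsewhere the default value is 0.\<close>

lemma D_all_eq_zeroI:
  assumes c: "c \<in> D_all" and 0: "\<And>f. c (poly f) = 0"
  shows "c = (\<lambda>_. 0)"
proof
  fix g
  show "c g = 0"
  proof (cases "entire g")
    case True
    obtain r where r: "r \<noteq> 0" "\<And>h. entire h \<Longrightarrow> c (\<lambda>w. poly r w * h w) = 0"
      using D_all_kill[OF c] by blast
    obtain f h where h: "entire h" "\<And>z. g z = poly f z + poly r z * h z"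
      by (rule entire_division[OF True r(1)], rule that)
    have "g = (\<lambda>z. poly f z + poly r z * h z)" using h(2) by (rule ext)
    hence "c g = c (\<lambda>z. poly f z + poly r z * h z)" by (rule arg_cong)
    also have "\<dots> = c (poly f) + c (\<lambda>z. poly r z * h z)"
      by (rule D_all_add[OF c]) (intro holomorphic_intros h)+
    finally show ?thesis using 0 r(2)[OF h(1)] by simp
  qed (use D_all_not_entire[OF c] in auto)
qed

text \<open>By Bezout every polynomial is the sum of a multiple of \<open>r\<close> and a multiple
  of \<open>s\<close>.\<close>

lemma D_all_coprime_kill:
  assumes c: "c \<in> D_all" and cop: "coprime r s"
    and "\<And>h. entire h \<Longrightarrow> c (\<lambda>w. poly r w * h w) = 0" "\<And>h. entire h \<Longrightarrow> c (\<lambda>w. poly s w * h w) = 0"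
  shows "c = (\<lambda>_. 0)"
proof (rule D_all_eq_zeroI[OF c])
  fix f :: "complex poly"
  define u v where "u = fst (bezout_coefficients r s)" and "v = snd (bezout_coefficients r s)"
  have "u * r + v * s = gcd r s" unfolding u_def v_def by (rule bezout_coefficients_fst_snd)
  hence uv: "u * r + v * s = 1" using cop by simp
  have "f = r * (u * f) + s * (v * f)"
    using arg_cong[OF uv, of "\<lambda>p. p * f"] by (simp add: algebra_simps)
  hence "poly f z = poly r z * poly (u * f) z + poly s z * poly (v * f) z" for z
    by (metis poly_add poly_mult)
  hence "c (poly f) = c (\<lambda>z. poly r z * poly (u * f) z + poly s z * poly (v * f) z)"
    by (intro arg_cong[of _ _ c] ext)
  also have "\<dots> = c (\<lambda>z. poly r z * poly (u * f) z) + c (\<lambda>z. poly s z * poly (v * f) z)"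
    by (rule D_all_add[OF c]) (intro holomorphic_intros)+
  also have "\<dots> = 0" using assms(3)[of "poly (u * f)"] assms(4)[of "poly (v * f)"] by simp
  finally show "c (poly f) = 0" .
qed

section \<open>Functionals applied to exponentials\<close>

lemma ev_exp: "ev k \<zeta> (\<lambda>w. exp (x * w)) = x ^ k * exp (x * \<zeta>)"
proof -
  have "(deriv ^^ k) (\<lambda>w. exp (x * w)) = (\<lambda>w. x ^ k * exp (x * w))"
    by (induction k) (auto intro!: ext DERIV_imp_deriv derivative_eq_intros)
  thus ?thesis by (simp add: ev_def)
qed

lemma ev_linear_exp:
  "ev k \<zeta> (\<lambda>w. w * exp (x * w)) = \<zeta> * (x ^ k * exp (x * \<zeta>)) + of_nat k * x ^ (k - 1) * exp (x * \<zeta>)"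
proof (cases k)
  case 0
  thus ?thesis by (simp add: ev_def holomorphic_intros)
next
  case (Suc n)
  thus ?thesis
    using ev_Suc_linear_mult[OF entire_exp, of n \<zeta> 0 x] unfolding ev_exp
    by (simp add: mult.assoc del: of_nat_Suc)
qed

lemma D_all_exp_deriv:
  assumes "c \<in> D_all"
  shows "((\<lambda>x. c (\<lambda>w. exp (x * w))) has_field_derivative c (\<lambda>w. w * exp (x * w))) (at x)"
  using assms
proof (induction rule: D_all_induct)
  case (step a k \<zeta> c)
  show ?case
    unfolding ev_exp ev_linear_exp
    by (rule derivative_eq_intros refl step)+ (simp add: algebra_simps)
qed simp

text \<open>Differentiation in \<open>x\<close> under the functional multiplies by \<open>w\<close>.
  As multiplication by \<open>w ^ i\<close> can be absorbed into a functional of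
  \<open>D_all\<close>, the formula for the first derivative can be iterated.\<close>

lemma D_all_exp_higher_deriv:
  assumes "c \<in> D_all"
  shows "(deriv ^^ i) (\<lambda>x. c (\<lambda>w. exp (x * w))) = (\<lambda>x. c (\<lambda>w. w ^ i * exp (x * w)))"
proof (induction i)
  case (Suc i)
  obtain d where d: "d \<in> D_all" "\<And>f. entire f \<Longrightarrow> d f = c (\<lambda>w. w ^ i * f w)"
    by (rule D_all_mult[OF assms, of "\<lambda>w. w ^ i"]) (intro holomorphic_intros, rule that)
  have "(deriv ^^ Suc i) (\<lambda>x. c (\<lambda>w. exp (x * w))) = deriv (\<lambda>x. d (\<lambda>w. exp (x * w)))"
    by (simp add: Suc d(2))
  also have "\<dots> = (\<lambda>x. d (\<lambda>w. w * exp (x * w)))"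
    using D_all_exp_deriv[OF d(1)] DERIV_imp_deriv by blast
  also have "\<dots> = (\<lambda>x. c (\<lambda>w. w ^ Suc i * exp (x * w)))"
    by (intro ext, subst d(2)) (auto intro!: holomorphic_intros simp: algebra_simps)
  finally show ?case .
qed simp

lemma D_all_exp_entire:
  assumes "c \<in> D_all"
  shows "entire (\<lambda>x. c (\<lambda>w. w ^ i * exp (x * w)))"
proof -
  obtain d where d: "d \<in> D_all" "\<And>f. entire f \<Longrightarrow> d f = c (\<lambda>w. w ^ i * f w)"
    by (rule D_all_mult[OF assms, of "\<lambda>w. w ^ i"]) (intro holomorphic_intros, rule that)
  have "entire (\<lambda>x. d (\<lambda>w. exp (x * w)))"
    using D_all_exp_deriv[OF d(1)] by (auto simp: holomorphic_on_def field_differentiable_def)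
  thus ?thesis by (simp add: d(2))
qed

lemma D_all_poly:
  assumes "c \<in> D_all"
  shows "c (\<lambda>w. poly p w * exp (x * w)) = (\<Sum>i\<le>degree p. poly.coeff p i * c (\<lambda>w. w ^ i * exp (x * w)))"
proof -
  have "(\<lambda>w. poly p w * exp (x * w)) = (\<lambda>w. \<Sum>i\<le>degree p. poly.coeff p i * (w ^ i * exp (x * w)))"
    by (simp add: poly_altdef sum_distrib_right mult.assoc)
  thus ?thesis
    by (simp only:) (rule D_all_sum[OF assms], intro holomorphic_intros)
qed

text \<open>The power series at 0 of \<open>x \<mapsto> \<langle>c, e\<^bsup>xw\<^esup>\<rangle>\<close>.\<close>

definition exp_series :: "functional \<Rightarrow> complex fps" where
  "exp_series c = Abs_fps (\<lambda>n. c (\<lambda>w. w ^ n) / fact n)"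

lemma exp_series_expansion:
  assumes "c \<in> D_all"
  shows "(\<lambda>x. c (\<lambda>w. exp (x * w))) has_fps_expansion exp_series c"
proof -
  have "(\<lambda>x. c (\<lambda>w. exp (x * w))) analytic_on {0}"
    using D_all_exp_entire[OF assms, of 0] by (auto simp: analytic_on_holomorphic intro!: exI[of _ UNIV])
  hence "(\<lambda>x. c (\<lambda>w. exp (x * w))) has_fps_expansion fps_expansion (\<lambda>x. c (\<lambda>w. exp (x * w))) 0"
    by (rule analytic_at_imp_has_fps_expansion_0)
  also have "fps_expansion (\<lambda>x. c (\<lambda>w. exp (x * w))) 0 = exp_series c"
    by (simp add: fps_expansion_def exp_series_def D_all_exp_higher_deriv[OF assms])
  finally show ?thesis .
qed

text \<open>Up to factorials the coefficients of the series are the values of \<open>c\<close> at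
  the monomials.\<close>

lemma exp_series_eq_0:
  assumes c: "c \<in> D_all" and 0: "exp_series c = 0"
  shows "c = (\<lambda>_. 0)"
proof (rule D_all_eq_zeroI[OF c])
  fix f :: "complex poly"
  have "c (\<lambda>w. w ^ n) = 0" for n
    using arg_cong[OF 0, of "\<lambda>s. fps_nth s n"] by (simp add: exp_series_def)
  moreover have "c (poly f) = (\<Sum>i\<le>degree f. poly.coeff f i * c (\<lambda>w. w ^ i))"
    using D_all_poly[OF c, of f 0] by simp
  ultimately show "c (poly f) = 0" by simp
qed

lemma exp_series_sum:
  assumes "\<And>i. i \<in> I \<Longrightarrow> c i \<in> D_all"
  shows "exp_series (\<lambda>f. \<Sum>i\<in>I. a i * c i f) = (\<Sum>i\<in>I. fps_const (a i) * exp_series (c i))"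
  by (rule fps_ext) (simp add: exp_series_def fps_sum_nth sum_divide_distrib)

section \<open>Homogeneous spaces of conditions\<close>

lemma coprime_linear_power:
  fixes r :: "complex poly"
  assumes "poly r \<zeta> \<noteq> 0"
  shows "coprime ([:-\<zeta>, 1:] ^ n) r"
proof (rule coprimeI)
  fix d :: "complex poly" assume d: "d dvd [:-\<zeta>, 1:] ^ n" "d dvd r"
  show "is_unit d"
  proof (rule ccontr)
    assume "\<not> is_unit d"
    moreover have "d \<noteq> 0" using d(2) assms by auto
    ultimately have "degree d > 0" by (simp add: is_unit_iff_degree)
    then obtain a where a: "poly d a = 0" using alg_closed_imp_poly_has_root by blast
    have "poly p a = 0" if "d dvd p" for p
      using that a by (auto elim!: dvdE)
    from this[OF d(1)] this[OF d(2)] have "a = \<zeta>" "poly r a = 0" by (simp_all add: poly_power)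
    with \<open>poly r a = 0\<close> assms show False by simp
  qed
qed

text \<open>A functional supported away from \<open>\<zeta>\<close> kills the multiples of some
  polynomial that does not vanish at \<open>\<zeta>\<close>; one supported at \<open>\<zeta>\<close>
  kills the multiples of a power of \<open>z - \<zeta>\<close>. These polynomials are
  coprime.\<close>

lemma D_at_direct:
  assumes e: "e \<in> D_at \<zeta>" and e': "e \<in> functional.span (\<Union>\<zeta>'\<in>-{\<zeta>}. D_at \<zeta>')"
  shows "e = (\<lambda>_. 0)"
proof -
  have "\<exists>r. poly r \<zeta> \<noteq> 0 \<and> (\<forall>h. entire h \<longrightarrow> e (\<lambda>w. poly r w * h w) = 0)"
    using e'
  proof (induction rule: functional_span_induct)
    case zero
    show ?case by (intro exI[of _ 1]) simp
  next
    case (step a x c)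
    then obtain r where r: "poly r \<zeta> \<noteq> 0" "\<forall>h. entire h \<longrightarrow> c (\<lambda>w. poly r w * h w) = 0"
      by (elim exE conjE)
    from step obtain \<zeta>' where z: "\<zeta>' \<noteq> \<zeta>" "x \<in> D_at \<zeta>'" by auto
    obtain n where n: "\<And>h. entire h \<Longrightarrow> x (\<lambda>w. poly ([:-\<zeta>', 1:] ^ n) w * h w) = 0"
      by (rule D_at_kill[OF z(2)], rule that)
    define t where "t = [:-\<zeta>', 1:] ^ n"
    have "poly (r * t) \<zeta> \<noteq> 0" using z r by (simp add: t_def poly_power)
    moreover have "a * x (\<lambda>w. poly (r * t) w * h w) + c (\<lambda>w. poly (r * t) w * h w) = 0"
      if h: "entire h" for h
    proof -
      have e: "(\<lambda>w. poly (r * t) w * h w) = (\<lambda>w. poly t w * (poly r w * h w))"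
        "(\<lambda>w. poly (r * t) w * h w) = (\<lambda>w. poly r w * (poly t w * h w))"
        by (simp_all add: algebra_simps)
      have "x (\<lambda>w. poly (r * t) w * h w) = 0"
        unfolding e(1) unfolding t_def by (rule n) (intro holomorphic_intros h)
      moreover have "c (\<lambda>w. poly (r * t) w * h w) = 0"
        unfolding e(2) by (rule r(2)[rule_format]) (intro holomorphic_intros h)
      ultimately show ?thesis by simp
    qed
    ultimately show ?case by (intro exI[of _ "r * t"] conjI allI impI)
  qed
  then obtain r where r: "poly r \<zeta> \<noteq> 0" "\<forall>h. entire h \<longrightarrow> e (\<lambda>w. poly r w * h w) = 0"
    by (elim exE conjE)
  obtain n where n: "\<And>h. entire h \<Longrightarrow> e (\<lambda>w. poly ([:-\<zeta>, 1:] ^ n) w * h w) = 0"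
    by (rule D_at_kill[OF e], rule that)
  have "e \<in> D_all" using e D_at_le_D_all by blast
  thus ?thesis
    by (rule D_all_coprime_kill[OF _ coprime_linear_power[OF r(1)] n r(2)[rule_format]])
qed

text \<open>\<open>q_poly\<close> for an explicit basis instead of the chosen one, so that it can be
  computed wherever a basis is at hand.\<close>

definition support_poly :: "(complex \<times> functional) list \<Rightarrow> complex poly" where
  "support_poly bs = prod_list (map (\<lambda>(\<zeta>, c). [:-\<zeta>, 1:]) bs)"

lemma support_poly_degree: "degree (support_poly bs) = length bs \<and> lead_coeff (support_poly bs) = 1"
proof (induction bs)
  case Nil
  thus ?case by (simp add: support_poly_def)
next
  case (Cons b bs)
  have e: "support_poly (b # bs) = [:- fst b, 1:] * support_poly bs"
    by (simp add: support_poly_def case_prod_beta)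
  have "support_poly bs \<noteq> 0" using Cons.IH by auto
  hence "degree (support_poly (b # bs)) = Suc (length bs)"
    unfolding e using Cons.IH by (subst degree_mult_eq) auto
  moreover have "lead_coeff (support_poly (b # bs)) = 1"
    using Cons.IH[THEN conjunct2] unfolding e lead_coeff_mult by simp
  ultimately show ?case by simp
qed

lemma support_poly_nonzero: "support_poly bs \<noteq> 0"
  using support_poly_degree[of bs] by auto

lemma homogeneous_basis_facts:
  assumes "homogeneous_basis C bs"
  shows "distinct (map snd bs)" "functional.independent (set (map snd bs))"
    "functional.span (set (map snd bs)) = C" "\<And>\<zeta> c. (\<zeta>, c) \<in> set bs \<Longrightarrow> c \<in> D_at \<zeta>"
    "set (map snd bs) \<subseteq> D_all" "C \<subseteq> D_all"
proof -
  show 1: "distinct (map snd bs)" "functional.independent (set (map snd bs))"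
    "functional.span (set (map snd bs)) = C" "\<And>\<zeta> c. (\<zeta>, c) \<in> set bs \<Longrightarrow> c \<in> D_at \<zeta>"
    using assms unfolding homogeneous_basis_def by auto
  thus 2: "set (map snd bs) \<subseteq> D_all" using D_at_le_D_all by fastforce
  show "C \<subseteq> D_all"
    using functional.span_mono[OF 2] functional.span_span unfolding 1(3) D_all_def by blast
qed

text \<open>The basis members attached to \<open>\<zeta>\<close> form a basis of
  \<open>C \<inter> D_at \<zeta>\<close>, so their number is intrinsic to \<open>C\<close>. This
  makes \<open>q_poly\<close> independent of the chosen basis.\<close>

lemma homogeneous_basis_dim:
  assumes "homogeneous_basis C bs"
  shows "count_list (map fst bs) \<zeta> = functional.dim (C \<inter> D_at \<zeta>)"
proof -
  note hb = homogeneous_basis_facts[OF assms]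
  define I where "I = {b \<in> set bs. fst b = \<zeta>}"
  have inj: "inj_on snd (set bs)" and "distinct bs"
    using hb(1) by (simp_all add: distinct_map)
  have "I = set (filter (\<lambda>b. fst b = \<zeta>) bs)" by (auto simp: I_def)
  hence "card I = length (filter (\<lambda>b. fst b = \<zeta>) bs)"
    by (simp only:) (intro distinct_card distinct_filter \<open>distinct bs\<close>)
  also have "\<dots> = count_list (map fst bs) \<zeta>" by (induction bs) auto
  finally have "card I = count_list (map fst bs) \<zeta>" .
  moreover have "card (snd ` I) = card I"
    by (rule card_image) (rule inj_on_subset[OF inj], auto simp: I_def)
  ultimately have card: "card (snd ` I) = count_list (map fst bs) \<zeta>" by simp
  have sub: "snd ` I \<subseteq> C \<inter> D_at \<zeta>"
    using hb(4) functional.span_superset[of "set (map snd bs)"] unfolding hb(3) by (auto simp: I_def)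
  have "C \<inter> D_at \<zeta> \<subseteq> functional.span (snd ` I)"
  proof
    fix c assume c: "c \<in> C \<inter> D_at \<zeta>"
    define J where "J = snd ` {b \<in> set bs. fst b \<noteq> \<zeta>}"
    have "set (map snd bs) = snd ` I \<union> J" by (auto simp: I_def J_def)
    hence "c \<in> functional.span (snd ` I \<union> J)" using c hb(3) by simp
    \<comment> \<open>\<open>u\<close> is the part attached to \<open>\<zeta>\<close> and
      \<open>v\<close> the rest. As \<open>v = c - u\<close> also lies in
      \<open>D_at \<zeta>\<close>, directness of the sum gives \<open>v = 0\<close>.\<close>
    then obtain u v where uv: "c = u + v" "u \<in> functional.span (snd ` I)" "v \<in> functional.span J"
      unfolding functional.span_Un by blast
    have "snd ` I \<subseteq> D_at \<zeta>" using sub by blast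
    hence "u \<in> D_at \<zeta>" using uv(2) functional.span_mono functional.span_span unfolding D_at_def by blast
    hence "c - u \<in> D_at \<zeta>" using c unfolding D_at_def by (intro functional.span_diff) auto
    hence "v \<in> D_at \<zeta>" using uv(1) by simp
    moreover have "J \<subseteq> (\<Union>\<zeta>'\<in>-{\<zeta>}. D_at \<zeta>')" using hb(4) by (fastforce simp: J_def)
    hence "v \<in> functional.span (\<Union>\<zeta>'\<in>-{\<zeta>}. D_at \<zeta>')"
      using uv(3) functional.span_mono by blast
    ultimately have "v = (\<lambda>_. 0)" by (rule D_at_direct)
    hence "c = u" using uv(1) by (simp add: plus_fun_def)
    thus "c \<in> functional.span (snd ` I)" using uv(2) by simp
  qed
  moreover have "functional.independent (snd ` I)"
    by (rule functional.independent_mono[OF hb(2)]) (auto simp: I_def)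
  ultimately show ?thesis
    using functional.dim_unique[OF sub _ _ card] by simp
qed

lemma support_poly_unique:
  assumes "homogeneous_basis C bs" "homogeneous_basis C bs'"
  shows "support_poly bs = support_poly bs'"
proof -
  have "mset (map fst bs) = mset (map fst bs')"
    by (rule multiset_eqI) (simp add: count_mset homogeneous_basis_dim[OF assms(1)] homogeneous_basis_dim[OF assms(2)] del: mset_map)
  moreover have "support_poly bs = prod_mset (image_mset (\<lambda>\<zeta>. [:-\<zeta>, 1:]) (mset (map fst bs)))" for bs
    by (induction bs) (auto simp: support_poly_def)
  ultimately show ?thesis by simp
qed

lemma hom_basis: "homogeneous C \<Longrightarrow> homogeneous_basis C (hom_basis C)"
  unfolding homogeneous_def hom_basis_def by (rule someI_ex)

lemma q_poly_eq_support_poly: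
  assumes "homogeneous_basis C bs"
  shows "q_poly C = support_poly bs"
  using support_poly_unique[OF hom_basis assms] assms
  unfolding q_poly_def support_poly_def homogeneous_def by blast

lemma q_poly_facts:
  assumes "homogeneous C"
  shows "q_poly C \<noteq> 0" "degree (q_poly C) = length (hom_basis C)" "lead_coeff (q_poly C) = 1"
  using support_poly_degree[of "hom_basis C"] support_poly_nonzero q_poly_eq_support_poly[OF hom_basis[OF assms]] by auto

section \<open>Wave functions\<close>

abbreviation exp_transform :: "functional \<Rightarrow> complex \<Rightarrow> complex" where
  "exp_transform c \<equiv> (\<lambda>x. c (\<lambda>w. exp (x * w)))"

lemma entire_has_fps_expansion_deriv:
  assumes "f has_fps_expansion F"
  shows "(deriv ^^ i) f has_fps_expansion (fps_deriv ^^ i) F"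
  by (induction i) (auto intro!: has_fps_expansion_deriv assms)

lemma has_fps_expansion_sum:
  fixes f :: "'i \<Rightarrow> complex \<Rightarrow> complex"
  assumes "\<And>i. i \<in> I \<Longrightarrow> f i has_fps_expansion F i"
  shows "(\<lambda>x. \<Sum>i\<in>I. f i x) has_fps_expansion (\<Sum>i\<in>I. F i)"
  using assms by (induction I rule: infinite_finite_induct) (auto intro!: has_fps_expansion_add)

lemma has_fps_expansion_prod:
  fixes f :: "'i \<Rightarrow> complex \<Rightarrow> complex"
  assumes "\<And>i. i \<in> I \<Longrightarrow> f i has_fps_expansion F i"
  shows "(\<lambda>x. \<Prod>i\<in>I. f i x) has_fps_expansion (\<Prod>i\<in>I. F i)"
  using assms by (induction I rule: infinite_finite_induct) (auto intro!: has_fps_expansion_mult)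

lemma wronskian_expand:
  "wronskian D fs = (\<Sum>p | p permutes {0..<length fs}.
     of_int (sign p) * (\<Prod>i=0..<length fs. (D ^^ i) (fs ! p i)))"
  unfolding wronskian_def det_def using permutes_in_image
  by (fastforce intro!: sum.cong prod.cong arg_cong2[of _ _ _ _ "(*)"])

lemma wronskian_expand_pointwise:
  fixes fs :: "('a \<Rightarrow> 'b :: comm_ring_1) list"
  shows "wronskian D fs = (\<lambda>x. \<Sum>p | p permutes {0..<length fs}.
     of_int (sign p) * (\<Prod>i=0..<length fs. (D ^^ i) (fs ! p i) x))"
  unfolding fun_eq_iff wronskian_pointwise det_def using permutes_in_image
  by (fastforce intro!: sum.cong prod.cong arg_cong2[of _ _ _ _ "(*)"])

text \<open>Functions under pointwise operations do not form a domain. Nonvanishing and kernels of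
  Wronskians are therefore obtained for Taylor series at 0 and transferred to entire
  functions.\<close>

lemma wronskian_expansion:
  fixes fs :: "(complex \<Rightarrow> complex) list"
  assumes "length fs = length Fs" "\<And>i. i < length fs \<Longrightarrow> fs ! i has_fps_expansion Fs ! i"
  shows "wronskian deriv fs has_fps_expansion wronskian fps_deriv Fs"
proof -
  have exp: "fs ! p i has_fps_expansion Fs ! p i"
    if "p \<in> {p. p permutes {0..<length fs}}" "i \<in> {0..<length fs}" for p i
    using that assms(2)[of "p i"] permutes_in_image[of p "{0..<length fs}" i] by simp
  show ?thesis
    unfolding wronskian_expand_pointwise wronskian_expand assms(1)[symmetric] fps_of_int[symmetric]
    by (intro has_fps_expansion_sum has_fps_expansion_mult has_fps_expansion_const has_fps_expansion_prod
        entire_has_fps_expansion_deriv exp)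
qed

lemma wronskian_entire:
  assumes "\<And>f. f \<in> set fs \<Longrightarrow> entire f"
  shows "entire (wronskian deriv fs)"
proof -
  have "entire (fs ! p i)" if "p permutes {0..<length fs}" "i \<in> {0..<length fs}" for p i
    using that assms permutes_in_image[OF that(1), of i] by simp
  thus ?thesis
    unfolding wronskian_expand_pointwise
    by (intro holomorphic_intros holomorphic_higher_deriv) auto
qed

lemma wronskian_exp_transform:
  assumes "set cs \<subseteq> D_all"
  shows "wronskian deriv (map exp_transform cs) x =
    Determinant.det (Matrix.mat (length cs) (length cs) (\<lambda>(i, j). (cs ! j) (\<lambda>w. w ^ i * exp (x * w))))"
  unfolding wronskian_pointwise using assms
  by (intro arg_cong[of _ _ Determinant.det] eq_matI) (auto simp: D_all_exp_higher_deriv subset_iff)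

lemma wronskian_exp_transform_snoc:
  assumes "set cs \<subseteq> D_all"
  shows "wronskian deriv (map exp_transform cs @ [g]) x =
    Determinant.det (Matrix.mat (Suc (length cs)) (Suc (length cs))
      (\<lambda>(i, j). if j < length cs then (cs ! j) (\<lambda>w. w ^ i * exp (x * w)) else (deriv ^^ i) g x))"
  unfolding wronskian_pointwise using assms
  by (intro arg_cong[of _ _ Determinant.det] eq_matI) (auto simp: D_all_exp_higher_deriv subset_iff nth_append)

text \<open>At a fixed \<open>x\<close> the coefficients of \<open>P\<close> annihilate the columns
  belonging to \<open>cs\<close>. Expanding the Wronskian thus amounts to applying P(d/dx) to
  \<open>g\<close>, with the coefficients of \<open>P\<close> frozen at this
  \<open>x\<close>.\<close>

lemma wronskian_exp_transform_annihilator: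
  assumes cs: "set cs \<subseteq> D_all" and P: "degree P = length cs" "lead_coeff P = 1"
    and 0: "\<And>c. c \<in> set cs \<Longrightarrow> c (\<lambda>w. poly P w * exp (x * w)) = 0"
  shows "wronskian deriv (map exp_transform cs @ [g]) x =
    wronskian deriv (map exp_transform cs) x * (\<Sum>i\<le>length cs. poly.coeff P i * (deriv ^^ i) g x)"
proof -
  have "(\<Sum>i\<le>length cs. poly.coeff P i * (cs ! j) (\<lambda>w. w ^ i * exp (x * w))) = 0" if "j < length cs" for j
  proof -
    have "cs ! j \<in> set cs" using that by simp
    thus ?thesis using D_all_poly[of "cs ! j" P x] 0[of "cs ! j"] cs P(1) by auto
  qed
  from det_annihilating_row[where d = "poly.coeff P" and l = "length cs" and v = "\<lambda>i. (deriv ^^ i) g x", OF this]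
  show ?thesis
    unfolding wronskian_exp_transform[OF cs] wronskian_exp_transform_snoc[OF cs] using P by simp
qed

lemma annihilating_poly_exists:
  assumes cs: "set cs \<subseteq> D_all" and nz: "wronskian deriv (map exp_transform cs) x \<noteq> 0"
  obtains P where "degree P = length cs" "lead_coeff P = 1"
    "\<And>c. c \<in> functional.span (set cs) \<Longrightarrow> c (\<lambda>w. poly P w * exp (x * w)) = 0"
proof -
  let ?l = "length cs"
  obtain b where b:
    "b ?l = Determinant.det (Matrix.mat ?l ?l (\<lambda>(i, j). (cs ! j) (\<lambda>w. w ^ i * exp (x * w))))"
    "\<And>j. j < ?l \<Longrightarrow> (\<Sum>i\<le>?l. b i * (cs ! j) (\<lambda>w. w ^ i * exp (x * w))) = 0"
    by (rule det_last_column[of ?l "\<lambda>i j. (cs ! j) (\<lambda>w. w ^ i * exp (x * w))"], rule that)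
  hence bl: "b ?l \<noteq> 0" using nz unfolding wronskian_exp_transform[OF cs] by simp
  \<comment> \<open>Cofactors divided by the last one, which is the Wronskian at \<open>x\<close>;
    this makes \<open>P\<close> monic.\<close>
  define P where "P = (\<Sum>i\<le>?l. monom (b i / b ?l) i)"
  have coeff: "poly.coeff P i = (if i \<le> ?l then b i / b ?l else 0)" for i
    by (simp add: P_def coeff_sum)
  have deg: "degree P = ?l"
    by (rule antisym) (use bl in \<open>auto intro!: degree_le le_degree simp: coeff\<close>)
  have "c (\<lambda>w. poly P w * exp (x * w)) = 0" if "c \<in> set cs" for c
  proof -
    from that obtain j where j: "j < ?l" "c = cs ! j" by (auto simp: in_set_conv_nth)
    have "c (\<lambda>w. poly P w * exp (x * w)) = (\<Sum>i\<le>?l. b i / b ?l * c (\<lambda>w. w ^ i * exp (x * w)))"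
      using D_all_poly[of c P x] that cs unfolding deg by (auto simp: coeff intro!: sum.cong)
    also have "\<dots> = (\<Sum>i\<le>?l. b i * c (\<lambda>w. w ^ i * exp (x * w))) / b ?l"
      by (simp add: sum_divide_distrib)
    also have "\<dots> = 0" using b(2) j by simp
    finally show ?thesis .
  qed
  note killed = this
  show thesis
  proof (rule that[of P])
    fix c assume "c \<in> functional.span (set cs)"
    thus "c (\<lambda>w. poly P w * exp (x * w)) = 0"
      by (induction rule: functional_span_induct) (auto simp: killed)
  qed (use deg coeff[of ?l] bl in auto)
qed

lemma sum_apply: "(\<Sum>i\<in>I. g i) x = (\<Sum>i\<in>I. g i x)"
  by (induction I rule: infinite_finite_induct) auto

lemma exp_series_indep:
  assumes "distinct cs" "functional.independent (set cs)" "set cs \<subseteq> D_all"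
  shows "fps_wr.indep_list (map exp_series cs)"
  unfolding fps_wr.indep_list_def
proof (intro allI impI)
  fix a i assume 0: "(\<Sum>i<length (map exp_series cs). fps_const (a i) * map exp_series cs ! i) = 0"
    and i: "i < length (map exp_series cs)"
  define c where "c = (\<lambda>f. \<Sum>i<length cs. a i * (cs ! i) f)"
  have mem: "cs ! i \<in> D_all" if "i < length cs" for i using assms(3) that by auto
  hence "c \<in> D_all" unfolding c_def D_all_def by (intro functional_span_sum) (auto simp: D_all_def)
  moreover have "exp_series c = 0"
    unfolding c_def by (subst exp_series_sum) (use 0 mem in auto)
  ultimately have "c = (\<lambda>_. 0)" by (rule exp_series_eq_0)
  hence "(\<Sum>i<length cs. (\<lambda>f. a i * (cs ! i) f)) = 0"
    by (simp add: c_def fun_eq_iff sum_apply)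
  from functional.independent_list_coeffs[OF assms(1,2) this, of i] i show "a i = 0" by simp
qed

lemma entire_zero_on_open:
  assumes "entire f" "open A" "A \<noteq> {}" "\<And>x. x \<in> A \<Longrightarrow> f x = 0"
  shows "f x = 0"
  using analytic_continuation_open[of A UNIV f "\<lambda>_. 0" x] assms by auto

text \<open>The Taylor series at 0 is a Wronskian of independent power series, hence nonzero, and a
  nonzero entire function vanishes on no nonempty open set.\<close>

lemma wronskian_exp_transform_nonzero:
  assumes "distinct cs" "functional.independent (set cs)" "set cs \<subseteq> D_all"
  shows "open {x. wronskian deriv (map exp_transform cs) x \<noteq> 0}"
    "closure {x. wronskian deriv (map exp_transform cs) x \<noteq> 0} = UNIV"
proof -
  let ?W = "wronskian deriv (map exp_transform cs)"
  have ent: "entire ?W"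
    using assms(3) D_all_exp_entire[of _ 0] by (intro wronskian_entire) auto
  have exp: "?W has_fps_expansion wronskian fps_deriv (map exp_series cs)"
    using assms(3) by (intro wronskian_expansion) (auto intro!: exp_series_expansion)
  have nz: "wronskian fps_deriv (map exp_series cs) \<noteq> 0"
    by (rule fps_wr.wronskian_nonzero[OF exp_series_indep[OF assms]])
  have "continuous_on UNIV ?W" by (rule holomorphic_on_imp_continuous_on[OF ent])
  thus "open {x. ?W x \<noteq> 0}"
    using open_Collect_neq[of ?W "\<lambda>_. 0"] by simp
  show "closure {x. ?W x \<noteq> 0} = UNIV"
  proof (rule ccontr)
    assume "closure {x. ?W x \<noteq> 0} \<noteq> UNIV"
    hence "- closure {x. ?W x \<noteq> 0} \<noteq> {}" by auto
    moreover have "?W x = 0" if "x \<in> - closure {x. ?W x \<noteq> 0}" for x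
      using that closure_subset[of "{x. ?W x \<noteq> 0}"] by auto
    moreover have "open (- closure {x. ?W x \<noteq> 0})" by auto
    ultimately have "?W x = 0" for x
      using entire_zero_on_open[OF ent] by metis
    hence "?W = (\<lambda>_. 0)" by (rule ext)
    hence "(\<lambda>_. 0) has_fps_expansion wronskian fps_deriv (map exp_series cs)" using exp by simp
    moreover have "(\<lambda>_ :: complex. 0 :: complex) has_fps_expansion 0" by simp
    ultimately show False using nz fps_expansion_unique_complex by blast
  qed
qed

text \<open>Vanishing on \<open>A\<close> spreads to the plane and to the Taylor series, where the
  kernel of a Wronskian is known. Since \<open>exp_series\<close> is injective, the resulting
  relation between series is one between functionals.\<close>

lemma wronskian_exp_transform_kernel:
  assumes cs: "distinct cs" "functional.independent (set cs)" "set cs \<subseteq> D_all" and d: "d \<in> D_all"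
    and A: "open A" "A \<noteq> {}" "\<And>x. x \<in> A \<Longrightarrow> wronskian deriv (map exp_transform cs @ [exp_transform d]) x = 0"
  shows "d \<in> functional.span (set cs)"
proof -
  let ?W = "wronskian deriv (map exp_transform (cs @ [d]))"
  have ent: "entire ?W"
    using cs(3) d D_all_exp_entire[of _ 0] by (intro wronskian_entire) auto
  have exp: "?W has_fps_expansion wronskian fps_deriv (map exp_series (cs @ [d]))"
    using cs(3) d by (intro wronskian_expansion) (auto intro!: exp_series_expansion simp: nth_append less_Suc_eq)
  have "?W x = 0" for x
    using entire_zero_on_open[OF ent A(1,2)] A(3) by simp
  hence "?W = (\<lambda>_. 0)" by (rule ext)
  hence "(\<lambda>_. 0) has_fps_expansion wronskian fps_deriv (map exp_series (cs @ [d]))" using exp by simp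
  moreover have "(\<lambda>_ :: complex. 0 :: complex) has_fps_expansion 0" by simp
  ultimately have "wronskian fps_deriv (map exp_series cs @ [exp_series d]) = 0"
    using fps_expansion_unique_complex by fastforce
  from fps_wr.wronskian_kernel[OF exp_series_indep[OF cs] this] obtain a where
    a: "exp_series d = (\<Sum>i<length cs. fps_const (a i) * exp_series (cs ! i))" by auto
  have mem: "cs ! i \<in> D_all" if "i < length cs" for i using cs(3) that by auto
  define c where "c = (\<lambda>f. \<Sum>i<length cs. a i * (cs ! i) f)"
  have c: "c \<in> functional.span (set cs)"
    unfolding c_def by (intro functional_span_sum functional.span_base) auto
  have "c \<in> D_all" unfolding c_def D_all_def by (intro functional_span_sum) (use mem in \<open>auto simp: D_all_def\<close>)
  with d have "(\<lambda>f. -1 * c f + d f) \<in> D_all" unfolding D_all_def by (intro functional_span_step)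
  moreover have "exp_series c = exp_series d"
    unfolding c_def a by (rule exp_series_sum) (use mem in auto)
  hence "exp_series (\<lambda>f. -1 * c f + d f) = 0"
    by (simp add: exp_series_def fps_eq_iff)
  ultimately have "(\<lambda>f. -1 * c f + d f) = (\<lambda>_. 0)" by (rule exp_series_eq_0)
  hence "d = c" by (simp add: fun_eq_iff)
  with c show ?thesis by simp
qed

lemma homogeneous_basis_list:
  assumes "homogeneous_basis C bs"
  shows "distinct (map snd bs)" "functional.independent (set (map snd bs))" "set (map snd bs) \<subseteq> D_all"
    "functional.span (set (map snd bs)) = C"
  using homogeneous_basis_facts[OF assms] by auto

text \<open>The Wronskian in the denominator of the wave function: its zeros are the exceptional
  \<open>x\<close>, as the roots of \<open>q_poly C\<close> are the exceptional
  \<open>z\<close>.\<close>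

definition tau :: "functional set \<Rightarrow> complex \<Rightarrow> complex" where
  "tau C = wronskian deriv (map exp_transform (map snd (hom_basis C)))"

lemma tau_generic:
  assumes "homogeneous C"
  shows "open {x. tau C x \<noteq> 0}" "closure {x. tau C x \<noteq> 0} = UNIV"
  using wronskian_exp_transform_nonzero[OF homogeneous_basis_list(1-3)[OF hom_basis[OF assms]]]
  unfolding tau_def by auto

lemma higher_deriv_exp: "(deriv ^^ i) (\<lambda>x. exp (x * z)) = (\<lambda>x. z ^ i * exp (x * z :: complex))"
  by (induction i) (auto intro!: ext DERIV_imp_deriv derivative_eq_intros)

text \<open>Applying P(d/dx) to \<open>exp (x * z)\<close> multiplies it by P(z). Any monic
  \<open>P\<close> of the right degree with these zeros will do, so a wave function is found by
  exhibiting one. At the roots of \<open>q_poly C\<close> both sides are 0 by the convention on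
  division.\<close>

lemma wave_of_conditions_eq:
  assumes C: "homogeneous C" and x: "tau C x \<noteq> 0"
    and P: "degree P = degree (q_poly C)" "lead_coeff P = 1"
    and 0: "\<And>c. c \<in> C \<Longrightarrow> c (\<lambda>w. poly P w * exp (x * w)) = 0"
  shows "wave_of_conditions C x z = poly P z * exp (x * z) / poly (q_poly C) z"
proof -
  let ?bs = "hom_basis C" and ?cs = "map snd (hom_basis C)"
  note hb = homogeneous_basis_list[OF hom_basis[OF C]]
  have deg: "degree P = length ?cs" using P q_poly_facts[OF C] by simp
  have killed: "c (\<lambda>w. poly P w * exp (x * w)) = 0" if "c \<in> set ?cs" for c
    using 0 functional.span_base[OF that] hb(4) by blast
  have "wronskian deriv (map exp_transform ?cs @ [\<lambda>x. exp (x * z)]) x =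
      tau C x * (\<Sum>i\<le>length ?cs. poly.coeff P i * (deriv ^^ i) (\<lambda>x. exp (x * z)) x)"
    unfolding tau_def by (rule wronskian_exp_transform_annihilator[OF hb(3) deg P(2)]) (rule killed)
  also have "(\<Sum>i\<le>length ?cs. poly.coeff P i * (deriv ^^ i) (\<lambda>x. exp (x * z)) x) = poly P z * exp (x * z)"
    unfolding poly_altdef deg higher_deriv_exp by (simp add: sum_distrib_right mult.assoc)
  finally have wr: "wronskian deriv (map exp_transform ?cs @ [\<lambda>x. exp (x * z)]) x =
    tau C x * (poly P z * exp (x * z))" .
  have phis: "map (\<lambda>(\<zeta>, c) x. c (\<lambda>w. exp (x * w))) ?bs = map exp_transform ?cs"
    by (auto simp: case_prod_beta)
  show ?thesis
    unfolding wave_of_conditions_def Let_def phis wr unfolding tau_def[symmetric] using x by simp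
qed

lemma annihilating_poly:
  assumes C: "homogeneous C" and x: "tau C x \<noteq> 0"
  obtains P where "degree P = degree (q_poly C)" "lead_coeff P = 1"
    "\<And>c. c \<in> C \<Longrightarrow> c (\<lambda>w. poly P w * exp (x * w)) = 0"
proof -
  note hb = homogeneous_basis_list[OF hom_basis[OF C]]
  obtain P where "degree P = length (map snd (hom_basis C))" "lead_coeff P = 1"
    "\<And>c. c \<in> functional.span (set (map snd (hom_basis C))) \<Longrightarrow> c (\<lambda>w. poly P w * exp (x * w)) = 0"
    by (rule annihilating_poly_exists[OF hb(3) x[unfolded tau_def]], rule that)
  thus thesis using that[of P] q_poly_facts[OF C] hb(4) by simp
qed

lemma common_kill:
  assumes "homogeneous C"
  obtains r where "r \<noteq> 0" "\<And>c h. c \<in> C \<Longrightarrow> entire h \<Longrightarrow> c (\<lambda>w. poly r w * h w) = 0"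
proof -
  note hb = homogeneous_basis_list[OF hom_basis[OF assms]]
  obtain r where r: "r \<noteq> 0"
    "\<And>c h. c \<in> set (map snd (hom_basis C)) \<Longrightarrow> entire h \<Longrightarrow> c (\<lambda>w. poly r w * h w) = 0"
    by (rule D_all_kill_common[OF _ hb(3)]) (simp, rule that)
  show thesis
  proof (rule that[OF r(1)])
    fix c h assume "c \<in> C" and h: "entire h"
    hence "c \<in> functional.span (set (map snd (hom_basis C)))" using hb(4) by simp
    thus "c (\<lambda>w. poly r w * h w) = 0"
      by (induction rule: functional_span_induct) (use r(2) h in auto)
  qed
qed

lemma homogeneous_in_D_all: "homogeneous C \<Longrightarrow> C \<subseteq> D_all"
  using homogeneous_basis_facts(6) hom_basis by blast

text \<open>For fixed \<open>x\<close> the exponential \<open>e\<^bsup>xz\<^esup>\<close> agrees with a polynomial \<open>f\<close> to high order at all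
  points where conditions are imposed, so \<open>f P / q\<close> lies in \<open>W\<close>, and \<open>W\<close> alone decides what the
  numerator is.\<close>

lemma wave_of_conditions_cong:
  assumes C: "homogeneous C" and C': "homogeneous C'" and W: "W_of C = W_of C'"
    and x: "tau C x \<noteq> 0" "tau C' x \<noteq> 0" and z: "poly (q_poly C) z \<noteq> 0" "poly (q_poly C') z \<noteq> 0"
  shows "wave_of_conditions C x z = wave_of_conditions C' x z"
proof -
  let ?q = "q_poly C" and ?q' = "q_poly C'"
  note q = q_poly_facts[OF C] and q' = q_poly_facts[OF C']
  obtain P where P: "degree P = degree ?q" "lead_coeff P = 1"
    "\<And>c. c \<in> C \<Longrightarrow> c (\<lambda>w. poly P w * exp (x * w)) = 0"
    by (rule annihilating_poly[OF C x(1)], rule that)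
  obtain r where r: "r \<noteq> 0" "\<And>c h. c \<in> C \<Longrightarrow> entire h \<Longrightarrow> c (\<lambda>w. poly r w * h w) = 0"
    by (rule common_kill[OF C], rule that)
  obtain r' where r': "r' \<noteq> 0" "\<And>c h. c \<in> C' \<Longrightarrow> entire h \<Longrightarrow> c (\<lambda>w. poly r' w * h w) = 0"
    by (rule common_kill[OF C'], rule that)
  \<comment> \<open>The factors \<open>r\<close> and \<open>r'\<close> make both spaces of
    conditions blind to multiples of \<open>R\<close>. The factor \<open>?q\<close> makes
    \<open>f\<close> agree with the exponential at the roots of \<open>?q\<close>, so that
    \<open>f\<close> has no root in common with it.\<close>
  define R where "R = r * r' * ?q"
  have "R \<noteq> 0" using r(1) r'(1) q(1) by (simp add: R_def)
  obtain f h where h: "entire h" and fh: "\<And>w. exp (x * w) = poly f w + poly R w * h w"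
    by (rule entire_division[OF entire_exp \<open>R \<noteq> 0\<close>], rule that)
  have split: "c (\<lambda>w. poly S w * exp (x * w)) = c (poly (f * S))"
    if c: "c \<in> D_all" and kill: "\<And>g. entire g \<Longrightarrow> c (\<lambda>w. poly R w * g w) = 0" for c S
  proof -
    have "(\<lambda>w. poly S w * exp (x * w)) = (\<lambda>w. poly (f * S) w + poly R w * (poly S w * h w))"
      unfolding fh by (simp add: algebra_simps)
    hence "c (\<lambda>w. poly S w * exp (x * w)) = c (\<lambda>w. poly (f * S) w + poly R w * (poly S w * h w))"
      by simp
    also have "\<dots> = c (poly (f * S)) + c (\<lambda>w. poly R w * (poly S w * h w))"
      by (rule D_all_add[OF c]) (intro holomorphic_intros h)+
    also have "c (\<lambda>w. poly R w * (poly S w * h w)) = 0"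
      by (rule kill) (intro holomorphic_intros h)
    finally show ?thesis by (simp only: add_0_right)
  qed
  have killC: "c (\<lambda>w. poly R w * g w) = 0" if "c \<in> C" "entire g" for c g
  proof -
    have "entire (\<lambda>w. poly (r' * ?q) w * g w)" by (intro holomorphic_intros that)
    from r(2)[OF that(1) this] show ?thesis by (simp add: R_def mult.assoc)
  qed
  have killC': "c (\<lambda>w. poly R w * g w) = 0" if "c \<in> C'" "entire g" for c g
  proof -
    have "entire (\<lambda>w. poly (r * ?q) w * g w)" by (intro holomorphic_intros that)
    from r'(2)[OF that(1) this] show ?thesis by (simp add: R_def ac_simps)
  qed
  have "c (poly (f * P)) = 0" if "c \<in> C" for c
  proof -
    have "c \<in> D_all" using that homogeneous_in_D_all[OF C] by blast
    from split[OF this killC[OF that], of P] P(3)[OF that] show ?thesis by (simp only:)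
  qed
  hence "to_fract (f * P) / to_fract ?q \<in> W_of C"
    unfolding W_of_def by (intro CollectI exI[of _ "f * P"]) simp
  hence "to_fract (f * P) / to_fract ?q \<in> W_of C'" by (simp only: W)
  then obtain v where v: "to_fract (f * P) / to_fract ?q = to_fract v / to_fract ?q'"
    "\<forall>c\<in>C'. c (poly v) = 0" unfolding W_of_def by (elim CollectE exE conjE)
  have "to_fract (f * P * ?q') = to_fract (v * ?q)"
    using v(1) q(1) q'(1) by (simp add: frac_eq_eq)
  hence eq: "f * P * ?q' = v * ?q" by (simp only: to_fract_eq_iff)
  have "coprime f ?q"
  proof (rule coprimeI)
    fix d assume d: "d dvd f" "d dvd ?q"
    show "is_unit d"
    proof (rule ccontr)
      assume "\<not> is_unit d"
      moreover have "d \<noteq> 0" using d(2) q(1) by auto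
      ultimately have "degree d > 0" by (simp add: is_unit_iff_degree)
      then obtain a where a: "poly d a = 0" using alg_closed_imp_poly_has_root by blast
      have "poly p a = 0" if "d dvd p" for p using that a by (auto elim!: dvdE)
      from this[OF d(1)] this[OF d(2)] have "exp (x * a) = 0" using fh[of a] by (simp add: R_def)
      thus False by simp
    qed
  qed
  moreover have "f * (P * ?q') = v * ?q" using eq by (simp only: mult.assoc)
  hence "?q dvd f * (P * ?q')" by (simp only: dvd_triv_right)
  ultimately have "?q dvd P * ?q'" by (simp add: coprime_dvd_mult_right_iff coprime_commute)
  \<comment> \<open>\<open>S / ?q'\<close> equals \<open>P / ?q\<close>, and \<open>S\<close> is the
    numerator belonging to \<open>C'\<close>: it is monic of degree \<open>degree ?q'\<close>, and
    \<open>C'\<close> kills \<open>S\<close> times the exponential because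
    \<open>v = f * S\<close>.\<close>
  then obtain S where S: "P * ?q' = ?q * S" by (rule dvdE)
  have "v = f * S"
  proof -
    have "?q * v = f * (P * ?q')" using eq by (simp only: ac_simps)
    also have "\<dots> = ?q * (f * S)" unfolding S by (simp only: mult.left_commute)
    finally have "?q * v = ?q * (f * S)" .
    thus ?thesis using q(1) by simp
  qed
  have P0: "P \<noteq> 0" using P(2) by auto
  have S0: "S \<noteq> 0" using S P0 q'(1) by auto
  have "degree P + degree ?q' = degree ?q + degree S"
    using arg_cong[OF S, of degree] P0 S0 q(1) q'(1) by (simp add: degree_mult_eq)
  hence degS: "degree S = degree ?q'" using P(1) by simp
  have lcS: "lead_coeff S = 1"
    using arg_cong[OF S, of lead_coeff] P(2) q(3) q'(3) by (simp add: lead_coeff_mult)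
  have killed: "c (\<lambda>w. poly S w * exp (x * w)) = 0" if "c \<in> C'" for c
  proof -
    have "c \<in> D_all" using that homogeneous_in_D_all[OF C'] by blast
    from split[OF this killC'[OF that], of S] v(2)[rule_format, OF that] \<open>v = f * S\<close> show ?thesis by (simp only:)
  qed
  have PS: "poly P z / poly ?q z = poly S z / poly ?q' z"
    using arg_cong[OF S, of "\<lambda>p. poly p z"] z by (simp add: frac_eq_eq)
  show ?thesis
  proof -
    have "wave_of_conditions C x z = poly P z / poly ?q z * exp (x * z)"
      by (subst wave_of_conditions_eq[OF C x(1) P(1,2)]) (simp_all add: P(3))
    moreover have "wave_of_conditions C' x z = poly S z / poly ?q' z * exp (x * z)"
      by (subst wave_of_conditions_eq[OF C' x(2) degS lcS]) (simp_all add: killed)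
    ultimately show ?thesis by (simp only: PS)
  qed
qed

section \<open>Recovering the space from its wave function\<close>

text \<open>Functionals that kill the multiples of \<open>q\<close> separate polynomials modulo
  \<open>q\<close>. For one more root \<open>b\<close>, write \<open>f = q * s\<close>; dividing
  \<open>ev 0 b\<close> by \<open>q\<close> gives a functional that reads off the value of
  \<open>s\<close> at \<open>b\<close>.\<close>

lemma dvd_if_functionals_vanish:
  assumes "q \<noteq> 0"
    and "\<And>a. a \<in> D_all \<Longrightarrow> (\<And>g. entire g \<Longrightarrow> a (\<lambda>w. poly q w * g w) = 0) \<Longrightarrow> a (poly f) = 0"
  shows "q dvd f"
  using assms
proof (induction q rule: poly_roots_induct)
  case (const c)
  have "c \<noteq> 0" using const.prems(1) by simp
  hence "is_unit [:c:]" by (simp add: is_unit_const_poly_iff dvd_field_iff)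
  thus ?case by (rule unit_imp_dvd)
next
  case (root b q)
  have q0: "q \<noteq> 0" using root.prems(1) mult_zero_right by metis
  have "q dvd f"
  proof (rule root.IH[OF q0])
    fix a assume a: "a \<in> D_all" "\<And>g. entire g \<Longrightarrow> a (\<lambda>w. poly q w * g w) = 0"
    show "a (poly f) = 0"
    proof (rule root.prems(2)[OF a(1)])
      fix g assume "entire g"
      hence "entire (\<lambda>w. (w - b) * g w)" by (intro holomorphic_intros)
      moreover have "(\<lambda>w. poly ([:-b, 1:] * q) w * g w) = (\<lambda>w. poly q w * ((w - b) * g w))"
        by (simp add: algebra_simps)
      ultimately show "a (\<lambda>w. poly ([:-b, 1:] * q) w * g w) = 0"
        using a(2) by (simp only:)
    qed
  qed
  then obtain s where s: "f = q * s" by (rule dvdE)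
  obtain d where d: "d \<in> D_all" "\<And>g. entire g \<Longrightarrow> d (\<lambda>w. poly q w * g w) = ev 0 b g"
    by (rule D_all_divide[OF ev_in_D_all q0], rule that)
  have "d (poly f) = 0"
  proof (rule root.prems(2)[OF d(1)])
    fix g assume "entire g"
    hence "entire (\<lambda>w. (w - b) * g w)" by (intro holomorphic_intros)
    moreover have "(\<lambda>w. poly ([:-b, 1:] * q) w * g w) = (\<lambda>w. poly q w * ((w - b) * g w))"
      by (simp add: algebra_simps)
    ultimately have "d (\<lambda>w. poly ([:-b, 1:] * q) w * g w) = ev 0 b (\<lambda>w. (w - b) * g w)"
      using d(2) by (simp only:)
    thus "d (\<lambda>w. poly ([:-b, 1:] * q) w * g w) = 0"
      using ev_0_linear_mult[OF \<open>entire g\<close>, of b b] by simp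
  qed
  moreover have "poly f = (\<lambda>w. poly q w * poly s w)" by (rule ext) (simp add: s)
  hence "d (poly f) = poly s b"
    using d(2)[of "poly s"] by (simp add: ev_def)
  ultimately have "[:-b, 1:] dvd s" by (simp add: poly_eq_0_iff_dvd)
  hence "q * [:-b, 1:] dvd q * s" by (rule mult_dvd_mono[OF dvd_refl])
  thus ?case unfolding s by (simp only: mult.commute)
qed

text \<open>For fixed \<open>x\<close> the exponential cancels, and two rational functions of
  \<open>z\<close> that agree at infinitely many points agree identically.\<close>

lemma annihilating_polys_agree:
  assumes C: "homogeneous C" and C': "homogeneous C'"
    and AB: "open B" "B \<noteq> {}" and x: "tau C x \<noteq> 0" "tau C' x \<noteq> 0"
    and eq: "\<And>z. z \<in> B \<Longrightarrow> wave_of_conditions C x z = wave_of_conditions C' x z"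
  obtains P P' where "degree P = degree (q_poly C)" "lead_coeff P = 1"
    "\<And>c. c \<in> C \<Longrightarrow> c (\<lambda>w. poly P w * exp (x * w)) = 0"
    "\<And>c. c \<in> C' \<Longrightarrow> c (\<lambda>w. poly P' w * exp (x * w)) = 0" "P * q_poly C' = P' * q_poly C"
proof -
  let ?q = "q_poly C" and ?q' = "q_poly C'"
  obtain P where P: "degree P = degree ?q" "lead_coeff P = 1"
    "\<And>c. c \<in> C \<Longrightarrow> c (\<lambda>w. poly P w * exp (x * w)) = 0"
    by (rule annihilating_poly[OF C x(1)], rule that)
  obtain P' where P': "degree P' = degree ?q'" "lead_coeff P' = 1"
    "\<And>c. c \<in> C' \<Longrightarrow> c (\<lambda>w. poly P' w * exp (x * w)) = 0"
    by (rule annihilating_poly[OF C' x(2)], rule that)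
  have "poly (P * ?q' - P' * ?q) z = 0" if z: "z \<in> B - {z. poly (?q * ?q') z = 0}" for z
  proof -
    have w: "wave_of_conditions C x z = poly P z * exp (x * z) / poly ?q z"
      by (rule wave_of_conditions_eq[OF C x(1) P(1,2)]) (rule P(3))
    have w': "wave_of_conditions C' x z = poly P' z * exp (x * z) / poly ?q' z"
      by (rule wave_of_conditions_eq[OF C' x(2) P'(1,2)]) (rule P'(3))
    have "poly P z / poly ?q z = poly P' z / poly ?q' z"
      using eq[of z] z unfolding w w' by (simp add: divide_simps)
    thus ?thesis using z by (simp add: divide_simps)
  qed
  hence "B - {z. poly (?q * ?q') z = 0} \<subseteq> {z. poly (P * ?q' - P' * ?q) z = 0}" by blast
  moreover have "infinite (B - {z. poly (?q * ?q') z = 0})"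
  proof (rule Diff_infinite_finite)
    show "finite {z. poly (?q * ?q') z = 0}"
      using q_poly_facts(1)[OF C] q_poly_facts(1)[OF C'] by (intro poly_roots_finite) simp
    show "infinite B" using AB by (metis finite_imp_not_open)
  qed
  ultimately have "infinite {z. poly (P * ?q' - P' * ?q) z = 0}" using finite_subset by blast
  hence "P * ?q' - P' * ?q = 0" using poly_roots_finite by blast
  hence "P * ?q' = P' * ?q" by simp
  show thesis by (rule that[OF P(1,2) _ _ \<open>P * ?q' = P' * ?q\<close>]) (rule P(3) P'(3), assumption)+
qed

text \<open>For \<open>f / ?q\<close> in \<open>W_of C\<close> two things are needed:
  \<open>?q\<close> divides \<open>?q' * f\<close>, and \<open>C'\<close> kills the quotient. Both
  follow from functionals \<open>a\<close> that vanish at \<open>?q' * f\<close>. The functional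
  \<open>a\<close> preceded by multiplication by \<open>?q'\<close> kills the numerators of the wave
  function of \<open>C\<close>, because \<open>P * ?q' = P' * ?q\<close>; so it lies in
  \<open>C\<close> and kills \<open>f\<close>.\<close>

lemma W_of_subset_if_waves_agree:
  assumes C: "homogeneous C" and C': "homogeneous C'"
    and U: "open U" "U \<noteq> {}"
    and eq: "\<And>x z. (x, z) \<in> U \<Longrightarrow> wave_of_conditions C x z = wave_of_conditions C' x z"
  shows "W_of C \<subseteq> W_of C'"
proof
  let ?q = "q_poly C" and ?q' = "q_poly C'"
  let ?cs = "map snd (hom_basis C)"
  note hb = homogeneous_basis_list[OF hom_basis[OF C]]
  note q = q_poly_facts[OF C] and q' = q_poly_facts[OF C']
  fix g assume "g \<in> W_of C"
  then obtain f where g: "g = to_fract f / to_fract ?q" and f: "\<forall>c\<in>C. c (poly f) = 0"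
    unfolding W_of_def by (elim CollectE exE conjE)
  obtain u where u: "u \<in> U" using U(2) by auto
  obtain A0 B where AB: "open A0" "open B" "fst u \<in> A0" "snd u \<in> B" "A0 \<times> B \<subseteq> U"
    using open_prod_elim[OF U(1) u] by (metis mem_Times_iff)
  define A where "A = A0 \<inter> {x. tau C x \<noteq> 0} \<inter> {x. tau C' x \<noteq> 0}"
  note t = tau_generic[OF C] and t' = tau_generic[OF C']
  have opA: "open A" unfolding A_def using AB(1) t(1) t'(1) by blast
  have "A0 \<inter> {x. tau C x \<noteq> 0} \<noteq> {}"
    using open_Int_closure_eq_empty[OF AB(1), of "{x. tau C x \<noteq> 0}"] t(2) AB(3) by auto
  hence neA: "A \<noteq> {}"
    using open_Int_closure_eq_empty[OF open_Int[OF AB(1) t(1)], of "{x. tau C' x \<noteq> 0}"] t'(2)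
    unfolding A_def by auto
  \<comment> \<open>Used for \<open>a\<close> that kills all multiples of \<open>?q\<close>, which
    yields the divisibility, and for \<open>a\<close> whose value at \<open>?q\<close> times
    \<open>g\<close> is \<open>c g\<close> with \<open>c\<close> in \<open>C'\<close>, which yields
    the conditions on the quotient.\<close>
  have main: "a (poly (?q' * f)) = 0"
    if a: "a \<in> D_all" and a0: "\<And>x P'. x \<in> A \<Longrightarrow> (\<And>c. c \<in> C' \<Longrightarrow> c (\<lambda>w. poly P' w * exp (x * w)) = 0) \<Longrightarrow>
      a (\<lambda>w. poly ?q w * (poly P' w * exp (x * w))) = 0" for a
  proof -
    obtain d where d: "d \<in> D_all" "\<And>g. entire g \<Longrightarrow> d g = a (\<lambda>w. poly ?q' w * g w)"
      by (rule D_all_mult[OF a, of "poly ?q'"]) (simp, rule that)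
    have "wronskian deriv (map exp_transform ?cs @ [exp_transform d]) x = 0" if x: "x \<in> A" for x
    proof -
      have tx: "tau C x \<noteq> 0" "tau C' x \<noteq> 0" using x by (simp_all add: A_def)
      have weq: "wave_of_conditions C x z = wave_of_conditions C' x z" if "z \<in> B" for z
        using x that AB(5) by (intro eq) (auto simp: A_def)
      obtain P P' where P: "degree P = degree ?q" "lead_coeff P = 1"
        "\<And>c. c \<in> C \<Longrightarrow> c (\<lambda>w. poly P w * exp (x * w)) = 0"
        "\<And>c. c \<in> C' \<Longrightarrow> c (\<lambda>w. poly P' w * exp (x * w)) = 0" and PP': "P * ?q' = P' * ?q"
        by (rule annihilating_polys_agree[OF C C' AB(2) _ tx weq]) (use AB(4) that in auto)
      have deg: "degree P = length ?cs" using P q(2) by simp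
      have killed: "c (\<lambda>w. poly P w * exp (x * w)) = 0" if "c \<in> set ?cs" for c
        using P(3) functional.span_base[OF that] hb(4) by blast
      have "wronskian deriv (map exp_transform ?cs @ [exp_transform d]) x =
        tau C x * (\<Sum>i\<le>length ?cs. poly.coeff P i * (deriv ^^ i) (exp_transform d) x)"
        unfolding tau_def by (rule wronskian_exp_transform_annihilator[OF hb(3) deg P(2)]) (rule killed)
      also have "(\<Sum>i\<le>length ?cs. poly.coeff P i * (deriv ^^ i) (exp_transform d) x) = d (\<lambda>w. poly P w * exp (x * w))"
        unfolding D_all_poly[OF d(1)] D_all_exp_higher_deriv[OF d(1)] deg ..
      also have "\<dots> = a (\<lambda>w. poly ?q' w * (poly P w * exp (x * w)))"
        by (rule d(2)) (intro holomorphic_intros)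
      also have "(\<lambda>w. poly ?q' w * (poly P w * exp (x * w))) = (\<lambda>w. poly (P * ?q') w * exp (x * w))"
        by (simp add: ac_simps)
      also have "\<dots> = (\<lambda>w. poly ?q w * (poly P' w * exp (x * w)))"
        unfolding PP' by (simp add: ac_simps)
      also have "a \<dots> = 0" by (rule a0[OF x]) (rule P(4))
      finally show ?thesis by simp
    qed
    hence "d \<in> C"
      using wronskian_exp_transform_kernel[OF hb(1-3) d(1) opA neA] hb(4) by simp
    hence "d (poly f) = 0" using f by blast
    moreover have "d (poly f) = a (poly (?q' * f))"
      using d(2)[of "poly f"] by (simp add: poly_mult[abs_def])
    ultimately show ?thesis by simp
  qed
  have "?q dvd ?q' * f"
  proof (rule dvd_if_functionals_vanish[OF q(1)])
    fix a assume a: "a \<in> D_all" "\<And>g. entire g \<Longrightarrow> a (\<lambda>w. poly ?q w * g w) = 0"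
    show "a (poly (?q' * f)) = 0"
      by (rule main[OF a(1)]) (rule a(2), intro holomorphic_intros)
  qed
  then obtain v where v: "?q' * f = ?q * v" by (rule dvdE)
  have "c (poly v) = 0" if c: "c \<in> C'" for c
  proof -
    have "c \<in> D_all" using c homogeneous_in_D_all[OF C'] by blast
    then obtain a where a: "a \<in> D_all" "\<And>g. entire g \<Longrightarrow> a (\<lambda>w. poly ?q w * g w) = c g"
      by (rule D_all_divide[OF _ q(1)]) (rule that)
    have "a (poly (?q' * f)) = 0"
    proof (rule main[OF a(1)])
      fix x P' assume "\<And>c. c \<in> C' \<Longrightarrow> c (\<lambda>w. poly P' w * exp (x * w)) = 0"
      from this[OF c] show "a (\<lambda>w. poly ?q w * (poly P' w * exp (x * w))) = 0"
        by (subst a(2)) (intro holomorphic_intros, simp)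
    qed
    thus ?thesis using a(2)[of "poly v"] unfolding v by (simp add: poly_mult[abs_def])
  qed
  moreover have "g = to_fract v / to_fract ?q'"
  proof -
    have "to_fract f * to_fract ?q' = to_fract v * to_fract ?q"
      using arg_cong[OF v, of to_fract] by (simp add: ac_simps)
    thus ?thesis unfolding g using q(1) q'(1) by (simp add: frac_eq_eq)
  qed
  ultimately show "g \<in> W_of C'" unfolding W_of_def by (intro CollectI exI[of _ v]) simp
qed

lemma W_of_eq_if_waves_agree:
  assumes "homogeneous C" "homogeneous C'" "open U" "U \<noteq> {}"
    and "\<And>x z. (x, z) \<in> U \<Longrightarrow> wave_of_conditions C x z = wave_of_conditions C' x z"
  shows "W_of C = W_of C'"
  using W_of_subset_if_waves_agree[OF assms] W_of_subset_if_waves_agree[OF assms(2,1,3,4)] assms(5)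
  by (simp add: subset_antisym)

definition conditions :: "complex poly fract set \<Rightarrow> functional set" where
  "conditions W = (SOME C. homogeneous C \<and> W_of C = W)"

lemma conditions:
  assumes "W \<in> Gr_ad"
  shows "homogeneous (conditions W)" "W_of (conditions W) = W"
proof -
  have "\<exists>C. homogeneous C \<and> W_of C = W" using assms unfolding Gr_ad_def by blast
  from someI_ex[OF this] show "homogeneous (conditions W)" "W_of (conditions W) = W"
    unfolding conditions_def by blast+
qed

lemma wave_conditions: "wave W = wave_of_conditions (conditions W)"
  unfolding wave_def conditions_def ..

lemma closure_Times_UNIV:
  assumes "closure A = UNIV" "closure B = UNIV"
  shows "closure (A \<times> B) = UNIV"
  by (simp add: closure_Times assms)

lemma closure_Int_open_dense:
  fixes A B :: "'a :: topological_space set"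
  assumes "open A" "closure A = UNIV" "closure B = UNIV"
  shows "closure (A \<inter> B) = UNIV"
  using open_Int_closure_subset[OF assms(1), of B] assms closure_mono[of A "closure (A \<inter> B)"] by auto

text \<open>\<open>wave\<close> is built from an arbitrary choice of conditions, so agreement is
  claimed away from zeros of denominators. The good set is a product, which allows the two variables
  to be exchanged later.\<close>

lemma wave_eq_on_generic:
  assumes C: "homogeneous C"
  obtains A B where "open A" "closure A = UNIV" "open B" "closure B = UNIV"
    "\<And>x z. x \<in> A \<Longrightarrow> z \<in> B \<Longrightarrow> wave (W_of C) x z = wave_of_conditions C x z"
    "A \<subseteq> {x. tau C x \<noteq> 0}"
proof -
  let ?C' = "conditions (W_of C)"
  have "W_of C \<in> Gr_ad" using C unfolding Gr_ad_def by blast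
  note C' = conditions[OF this]
  define A where "A = {x. tau C x \<noteq> 0} \<inter> {x. tau ?C' x \<noteq> 0}"
  define B where "B = - {z. poly (q_poly C * q_poly ?C') z = 0}"
  have fin: "finite {z. poly (q_poly C * q_poly ?C') z = 0}"
    using q_poly_facts(1)[OF C] q_poly_facts(1)[OF C'(1)] by (intro poly_roots_finite) simp
  show thesis
  proof (rule that[of A B])
    show "open A" using tau_generic(1)[OF C] tau_generic(1)[OF C'(1)] by (auto simp: A_def)
    show "closure A = UNIV"
      unfolding A_def by (intro closure_Int_open_dense tau_generic C C')
    show "open B" unfolding B_def using finite_imp_closed[OF fin] by (rule open_Compl)
    have "interior {z. poly (q_poly C * q_poly ?C') z = 0} = {}"
      using fin by (rule empty_interior_finite)
    thus "closure B = UNIV" unfolding B_def closure_complement by simp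
    show "wave (W_of C) x z = wave_of_conditions C x z" if "x \<in> A" "z \<in> B" for x z
      unfolding wave_conditions using that
      by (intro wave_of_conditions_cong C C') (auto simp: A_def B_def)
  qed (auto simp: A_def)
qed

text \<open>Supplies the uniqueness required by the definite description in
  \<open>bispectral\<close>: two dense sets, both open, have a nonempty open intersection.\<close>

lemma wave_determines:
  assumes "W \<in> Gr_ad" "W' \<in> Gr_ad" "mero_eq (wave W) h" "mero_eq (wave W') h"
  shows "W = W'"
proof -
  obtain U where U: "open U" "closure U = UNIV" "\<And>x z. (x, z) \<in> U \<Longrightarrow> wave W x z = h x z"
    using assms(3) unfolding mero_eq_def by blast
  obtain U' where U': "open U'" "closure U' = UNIV" "\<And>x z. (x, z) \<in> U' \<Longrightarrow> wave W' x z = h x z"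
    using assms(4) unfolding mero_eq_def by blast
  have "closure (U \<inter> U') = UNIV" by (rule closure_Int_open_dense) (use U U' in auto)
  hence "U \<inter> U' \<noteq> {}" by auto
  hence "W_of (conditions W) = W_of (conditions W')"
    by (intro W_of_eq_if_waves_agree[of _ _ "U \<inter> U'"] conditions assms(1,2) open_Int)
       (use U U' in \<open>auto simp flip: wave_conditions\<close>)
  thus ?thesis using conditions(2) assms(1,2) by simp
qed

section \<open>The image of a Wronskian operator\<close>

text \<open>Applied to \<open>exp (x * w)\<close>, a relation becomes the polynomial in
  \<open>x\<close> with coefficients \<open>a i\<close>, times
  \<open>exp (x * \<zeta>)\<close>.\<close>

lemma independent_ev: "distinct (map (\<lambda>k. ev k \<zeta>) [0..<n]) \<and> functional.independent (set (map (\<lambda>k. ev k \<zeta>) [0..<n]))"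
proof (rule functional.independent_listI)
  fix a assume "(\<Sum>i<length (map (\<lambda>k. ev k \<zeta>) [0..<n]). (\<lambda>f. a i * (map (\<lambda>k. ev k \<zeta>) [0..<n] ! i) f)) = 0"
  hence 0: "(\<Sum>i<n. (\<lambda>f. a i * ev i \<zeta> f)) = 0" by simp
  have "poly (\<Sum>i<n. monom (a i) i) x = 0" for x
  proof -
    have "(\<Sum>i<n. a i * ev i \<zeta> (\<lambda>w. exp (x * w))) = 0"
      using arg_cong[OF 0, of "\<lambda>c. c (\<lambda>w. exp (x * w))"] by (simp add: sum_apply)
    hence "(\<Sum>i<n. a i * x ^ i) * exp (x * \<zeta>) = 0"
      by (simp add: ev_exp sum_distrib_right mult.assoc)
    thus ?thesis by (simp add: poly_sum poly_monom)
  qed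
  hence z: "(\<Sum>i<n. monom (a i) i) = 0" using poly_all_0_iff_0 by blast
  have "a i = 0" if "i < n" for i
    using arg_cong[OF z, of "\<lambda>p. poly.coeff p i"] that by (simp add: coeff_sum)
  thus "\<forall>i<length (map (\<lambda>k. ev k \<zeta>) [0..<n]). a i = 0" by simp
qed

lemma ev_poly_power_dvd:
  assumes "[:-\<zeta>, 1:] ^ n dvd p" "k < n"
  shows "ev k \<zeta> (poly p) = 0"
proof -
  obtain s where s: "p = [:-\<zeta>, 1:] ^ n * s" using assms(1) by (rule dvdE)
  have n: "(w - \<zeta>) ^ n = (w - \<zeta>) ^ Suc k * (w - \<zeta>) ^ (n - Suc k)" for w
    unfolding power_add[symmetric] using assms(2) by simp
  have "poly p = (\<lambda>w. (w - \<zeta>) ^ Suc k * ((w - \<zeta>) ^ (n - Suc k) * poly s w))"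
    unfolding s by (rule ext) (simp add: poly_power n mult.assoc del: power_Suc)
  moreover have "entire (\<lambda>w. (w - \<zeta>) ^ (n - Suc k) * poly s w)" by (intro holomorphic_intros)
  ultimately show ?thesis using ev_kill by (simp only:)
qed

lemma D_all_poly_add: "c \<in> D_all \<Longrightarrow> c (poly (p + q)) = c (poly p) + c (poly q)"
  using D_all_add[of c "poly p" "poly q"] by (simp add: poly_add[abs_def])

lemma D_all_poly_smult: "c \<in> D_all \<Longrightarrow> c (poly (Polynomial.smult a p)) = a * c (poly p)"
  using D_all_cmult[of c "poly p" a] by (simp add: poly_smult[abs_def])

lemma D_all_poly_zero: "c \<in> D_all \<Longrightarrow> c (poly 0) = 0"
  using D_all_poly_smult[of c 0 0] by simp

locale poly_operator =
  fixes fs :: "complex poly list"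
  assumes indep: "poly_wr.indep_list fs"
begin

text \<open>This is W D, the operator D with its denominator W cleared; W itself is
  \<open>wr\<close>.\<close>

definition E :: "complex poly \<Rightarrow> complex poly" where
  "E g = wronskian pderiv (fs @ [g])"

definition wr :: "complex poly" where
  "wr = wronskian pderiv fs"

definition coef :: "nat \<Rightarrow> complex poly" where
  "coef = (SOME b. (\<forall>g. wronskian pderiv (fs @ [g]) = (\<Sum>i\<le>length fs. b i * (pderiv ^^ i) g)) \<and>
    b (length fs) = wronskian pderiv fs)"

lemma E_eq: "E g = (\<Sum>i\<le>length fs. coef i * (pderiv ^^ i) g)"
  and coef_length: "coef (length fs) = wr"
proof -
  have "\<exists>b. (\<forall>g. wronskian pderiv (fs @ [g]) = (\<Sum>i\<le>length fs. b i * (pderiv ^^ i) g)) \<and>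
    b (length fs) = wronskian pderiv fs"
    by (rule wronskian_last[of pderiv fs]) blast
  from someI_ex[OF this] show "E g = (\<Sum>i\<le>length fs. coef i * (pderiv ^^ i) g)" "coef (length fs) = wr"
    unfolding coef_def E_def wr_def by blast+
qed

lemma wr_nonzero: "wr \<noteq> 0"
  unfolding wr_def by (rule poly_wr.wronskian_nonzero[OF indep])

lemma E_add: "E (f + g) = E f + E g"
  by (simp add: E_eq higher_pderiv_add sum.distrib distrib_left)

lemma E_smult: "E (Polynomial.smult a f) = Polynomial.smult a (E f)"
  by (simp add: E_eq higher_pderiv_smult poly_vs.scale_sum_right)

lemma E_zero [simp]: "E 0 = 0"
  using E_smult[of 0 0] by simp

lemma E_sum: "E (\<Sum>i\<in>I. Polynomial.smult (a i) (g i)) = (\<Sum>i\<in>I. Polynomial.smult (a i) (E (g i)))"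
  by (induction I rule: infinite_finite_induct) (auto simp: E_add E_smult)

lemma E_fs: "f \<in> set fs \<Longrightarrow> E f = 0"
  unfolding E_def using wronskian_last[of pderiv fs "wronskian pderiv (fs @ [f]) = 0"] by metis

lemma E_kernel:
  assumes "E g = 0"
  obtains a where "g = (\<Sum>i<length fs. Polynomial.smult (a i) (fs ! i))"
  using poly_wr.wronskian_kernel[OF indep assms[unfolded E_def]] by auto

lemma fs_independent: "distinct fs" "poly_vs.independent (set fs)"
proof -
  have "distinct fs \<and> poly_vs.independent (set fs)"
    by (rule poly_vs.independent_listI) (use indep in \<open>auto simp: poly_wr.indep_list_def\<close>)
  thus "distinct fs" "poly_vs.independent (set fs)" by blast+
qed

lemma kill_E_span:
  assumes c: "c \<in> D_all" and S: "\<And>g. g \<in> S \<Longrightarrow> c (poly (E g)) = 0" and p: "p \<in> poly_vs.span S"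
  shows "c (poly (E p)) = 0"
  using p
proof (induction rule: poly_vs.span_induct_alt)
  case base
  show ?case unfolding E_zero by (rule D_all_poly_zero[OF c])
next
  case (step a x y)
  thus ?case unfolding E_add E_smult D_all_poly_add[OF c] D_all_poly_smult[OF c] using S by simp
qed

text \<open>Modulo a high power of \<open>z - \<zeta>\<close> the image of \<open>E\<close> has corank at least \<open>order \<zeta> wr\<close>: the order
  bound lets \<open>E\<close> factor through polynomials modulo a power of \<open>z - \<zeta>\<close>, where the kernel still has
  dimension \<open>length fs\<close>.\<close>

lemma local_conditions:
  obtains B where "finite B" "B \<subseteq> D_at \<zeta>" "functional.independent B" "card B = order \<zeta> wr"
    "\<And>c f. c \<in> B \<Longrightarrow> c (poly (E f)) = 0"
proof -
  let ?l = "length fs" and ?\<nu> = "order \<zeta> wr"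
  \<comment> \<open>\<open>K\<close> exceeds all degrees in \<open>fs\<close>, so that
    \<open>fs\<close> stays independent modulo the power \<open>K\<close> of
    \<open>z - \<zeta>\<close>. \<open>M\<close> is the order to which \<open>E\<close> of a
    multiple of that power must vanish at \<open>\<zeta>\<close>.\<close>
  define K where "K = Suc (?l + (\<Sum>f\<in>set fs. degree f))"
  define M where "M = K + ?\<nu> - ?l"
  have K: "?l \<le> K" "K > 0" by (simp_all add: K_def)
  have degK: "degree f < K" if "f \<in> set fs" for f
    using member_le_sum[OF that, of degree] by (simp add: K_def)
  obtain G where G: "finite G" "card G + card (set fs) = K"
    "\<And>p. degree p < K \<Longrightarrow> p \<in> poly_vs.span (G \<union> set fs)"
    by (rule independent_poly_complement[OF _ fs_independent(2) degK]) (simp, assumption, rule that)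
  have cardG: "card G + ?l = K" using G(2) fs_independent(1) by (simp add: distinct_card)
  obtain gs where gs: "set gs = G" "length gs = card G"
    using finite_distinct_list[OF G(1)] by (metis distinct_card)
  let ?B0 = "set (map (\<lambda>k. ev k \<zeta>) [0..<M])"
  let ?\<Phi> = "map (\<lambda>g (c :: functional). c (poly (E g))) gs"
  have "\<exists>B'. finite B' \<and> functional.independent B' \<and> B' \<subseteq> functional.span ?B0 \<and>
      card ?B0 \<le> card B' + length ?\<Phi> \<and> (\<forall>\<phi>\<in>set ?\<Phi>. \<forall>b\<in>B'. \<phi> b = 0)"
    by (rule functional.independent_in_common_kernel) (use independent_ev[of \<zeta> M] in auto)
  then obtain B' where B': "finite B'" "functional.independent B'" "B' \<subseteq> functional.span ?B0"
    "card ?B0 \<le> card B' + length ?\<Phi>" "\<And>g c. g \<in> G \<Longrightarrow> c \<in> B' \<Longrightarrow> c (poly (E g)) = 0"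
    using gs(1) by auto
  have "card ?B0 = M" using distinct_card[of "map (\<lambda>k. ev k \<zeta>) [0..<M]"] independent_ev[of \<zeta> M] by simp
  \<comment> \<open>Of the \<open>M\<close> dimensions of evaluations at most \<open>K - ?l\<close>
    are spent on killing \<open>E\<close> on \<open>G\<close>, and
    \<open>M - (K - ?l) = ?\<nu>\<close>.\<close>
  hence "?\<nu> \<le> card B'" using B'(4) gs(2) cardG K by (simp add: M_def)
  then obtain B where B: "B \<subseteq> B'" "card B = ?\<nu>" by (metis obtain_subset_with_card_n)
  have "?B0 \<subseteq> D_at \<zeta>" by auto
  hence "functional.span ?B0 \<subseteq> D_at \<zeta>"
    unfolding D_at_def by (metis functional.span_mono functional.span_span)
  hence sub: "B' \<subseteq> D_at \<zeta>" using B'(3) by blast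
  have kill: "c (poly (E f)) = 0" if c: "c \<in> B'" for c f
  proof -
    have cD: "c \<in> D_all" using c sub D_at_le_D_all by blast
    let ?t = "[:-\<zeta>, 1:] ^ K"
    have degt: "degree ?t = K" by (simp add: degree_power_eq)
    hence t0: "?t \<noteq> 0" by simp
    have "degree (f mod ?t) < K"
      using degree_mod_less[OF t0, of f] degt K by auto
    from G(3)[OF this] have 1: "c (poly (E (f mod ?t))) = 0"
    proof (rule kill_E_span[OF cD, rotated])
      fix g assume "g \<in> G \<union> set fs"
      thus "c (poly (E g)) = 0"
      proof
        assume "g \<in> set fs"
        show ?thesis unfolding E_fs[OF \<open>g \<in> set fs\<close>] by (rule D_all_poly_zero[OF cD])
      qed (rule B'(5)[OF _ c])
    qed
    have "[:-\<zeta>, 1:] ^ M dvd E (?t * (f div ?t))"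
    proof (cases "E (?t * (f div ?t)) = 0")
      case False
      hence "?\<nu> + K \<le> order \<zeta> (E (?t * (f div ?t))) + ?l"
        using order_wronskian_snoc[OF indep, of "?t * (f div ?t)" \<zeta> K] unfolding E_def wr_def by simp
      hence "M \<le> order \<zeta> (E (?t * (f div ?t)))" by (simp add: M_def)
      thus ?thesis using False by (simp add: order_divides)
    qed simp
    hence evs: "ev k \<zeta> (poly (E (?t * (f div ?t)))) = 0" if "k < M" for k
      using that by (rule ev_poly_power_dvd)
    have 2: "d (poly (E (?t * (f div ?t)))) = 0" if "d \<in> functional.span ?B0" for d
      using that by (induction rule: functional_span_induct) (use evs in auto)
    have "E f = E (?t * (f div ?t)) + E (f mod ?t)" by (simp flip: E_add)
    thus ?thesis using 1 2[of c] B'(3) c by (auto simp: D_all_poly_add[OF cD])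
  qed
  show thesis
  proof (rule that[of B])
    show "finite B" using B(1) B'(1) finite_subset by blast
    show "functional.independent B" using B(1) B'(2) functional.independent_mono by blast
  qed (use B sub kill in auto)
qed

end

lemma independent_Union_D_at:
  assumes "distinct zs" "\<And>\<zeta>. \<zeta> \<in> set zs \<Longrightarrow> distinct (L \<zeta>) \<and> functional.independent (set (L \<zeta>)) \<and> set (L \<zeta>) \<subseteq> D_at \<zeta>"
  shows "distinct (concat (map L zs)) \<and> functional.independent (set (concat (map L zs)))"
  using assms
proof (induction zs)
  case (Cons \<zeta> zs)
  let ?A = "set (L \<zeta>)" and ?B = "set (concat (map L zs))"
  have A: "distinct (L \<zeta>)" "functional.independent ?A" "?A \<subseteq> D_at \<zeta>" using Cons.prems(2)[of \<zeta>] by auto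
  have B: "distinct (concat (map L zs))" "functional.independent ?B"
    using Cons.IH Cons.prems by auto
  have "?B \<subseteq> (\<Union>\<zeta>'\<in>-{\<zeta>}. D_at \<zeta>')"
  proof
    fix c assume "c \<in> ?B"
    then obtain \<zeta>' where "\<zeta>' \<in> set zs" "c \<in> set (L \<zeta>')" by auto
    thus "c \<in> (\<Union>\<zeta>'\<in>-{\<zeta>}. D_at \<zeta>')" using Cons.prems by auto
  qed
  hence spB: "functional.span ?B \<subseteq> functional.span (\<Union>\<zeta>'\<in>-{\<zeta>}. D_at \<zeta>')" by (rule functional.span_mono)
  have spA: "functional.span ?A \<subseteq> D_at \<zeta>"
    using A(3) unfolding D_at_def by (metis functional.span_mono functional.span_span)
  have "functional.span ?A \<inter> functional.span ?B = {0}"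
  proof (intro equalityI subsetI)
    fix c assume "c \<in> functional.span ?A \<inter> functional.span ?B"
    hence "c = (\<lambda>_. 0)" using D_at_direct[of c \<zeta>] spA spB by blast
    thus "c \<in> {0}" by (simp add: fun_eq_iff)
  qed (auto intro: functional.span_zero)
  from functional.independent_Un[OF _ A(2) _ B(2) this]
  have "functional.independent (?A \<union> ?B)" "?A \<inter> ?B = {}" by auto
  thus ?case using A(1) B(1) by simp
qed (simp add: functional.independent_empty)

lemma sum_lessThan_add: "(\<Sum>i<m + n :: nat. f i) = (\<Sum>i<m. f i) + (\<Sum>i<n. f (i + m))"
  for f :: "nat \<Rightarrow> 'a :: comm_monoid_add"
  by (induction n) (simp_all add: add.assoc add.commute[of m])

lemma D_all_higher_deriv:
  assumes "c \<in> D_all"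
  obtains d where "d \<in> D_all" "\<And>f. entire f \<Longrightarrow> d f = c ((deriv ^^ i) f)"
proof -
  have "\<exists>d\<in>D_all. \<forall>f. entire f \<longrightarrow> d f = c ((deriv ^^ i) f)"
  proof (induction i)
    case (Suc i)
    then obtain d where d: "d \<in> D_all" "\<And>f. entire f \<Longrightarrow> d f = c ((deriv ^^ i) f)" by auto
    obtain e where e: "e \<in> D_all" "\<And>f. entire f \<Longrightarrow> e f = d (deriv f)"
      by (rule D_all_deriv[OF d(1)], rule that)
    have "e f = c ((deriv ^^ Suc i) f)" if "entire f" for f
      using e(2)[OF that] d(2)[OF holomorphic_deriv[OF that open_UNIV]] by (simp add: funpow_swap1)
    thus ?case using e(1) by (intro bexI[of _ e] allI impI)
  qed (use assms in auto)
  thus thesis using that by blast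
qed

lemma higher_deriv_poly: "(deriv ^^ i) (poly p) = poly ((pderiv ^^ i) p :: complex poly)"
  by (induction i) (auto intro!: ext DERIV_imp_deriv poly_DERIV)

context poly_operator
begin

text \<open>The local conditions at all roots of \<open>wr\<close> are put together. Each root
  contributes as many as its multiplicity, so the polynomial of the supports is \<open>wr\<close>
  made monic.\<close>

lemma condition_basis:
  obtains bs where "homogeneous_basis (functional.span (set (map snd bs))) bs"
    "Polynomial.smult (lead_coeff wr) (support_poly bs) = wr"
    "\<And>c f. c \<in> set (map snd bs) \<Longrightarrow> c (poly (E f)) = 0"
proof -
  have "\<exists>L. distinct L \<and> set L \<subseteq> D_at \<zeta> \<and> functional.independent (set L) \<and> length L = order \<zeta> wr \<and>
      (\<forall>c\<in>set L. \<forall>f. c (poly (E f)) = 0)" for \<zeta>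
  proof -
    obtain B where B: "finite B" "B \<subseteq> D_at \<zeta>" "functional.independent B" "card B = order \<zeta> wr"
      "\<And>c f. c \<in> B \<Longrightarrow> c (poly (E f)) = 0" by (rule local_conditions, rule that)
    obtain L where "set L = B" "distinct L" using finite_distinct_list[OF B(1)] by auto
    thus ?thesis using B by (intro exI[of _ L]) (auto simp: distinct_card[symmetric])
  qed
  then obtain L where L: "\<And>\<zeta>. distinct (L \<zeta>)" "\<And>\<zeta>. set (L \<zeta>) \<subseteq> D_at \<zeta>"
    "\<And>\<zeta>. functional.independent (set (L \<zeta>))" "\<And>\<zeta>. length (L \<zeta>) = order \<zeta> wr"
    "\<And>\<zeta> c f. c \<in> set (L \<zeta>) \<Longrightarrow> c (poly (E f)) = 0" by metis
  have "finite {\<zeta>. poly wr \<zeta> = 0}" by (rule poly_roots_finite[OF wr_nonzero])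
  then obtain zs where zs: "set zs = {\<zeta>. poly wr \<zeta> = 0}" "distinct zs"
    using finite_distinct_list by blast
  define bs where "bs = concat (map (\<lambda>\<zeta>. map (Pair \<zeta>) (L \<zeta>)) zs)"
  have snd: "map snd bs = concat (map L zs)"
    by (simp add: bs_def map_concat o_def)
  have "homogeneous_basis (functional.span (set (map snd bs))) bs"
    unfolding homogeneous_basis_def
  proof (intro conjI)
    show "distinct (map snd bs)" "functional.independent (set (map snd bs))"
      unfolding snd using independent_Union_D_at[OF zs(2), of L] L by auto
    show "\<forall>(\<zeta>, c)\<in>set bs. c \<in> D_at \<zeta>" using L(2) by (fastforce simp: bs_def)
  qed simp
  moreover have "support_poly (concat (map (\<lambda>\<zeta>. map (Pair \<zeta>) (L \<zeta>)) zs)) = (\<Prod>\<zeta>\<leftarrow>zs. [:-\<zeta>, 1:] ^ order \<zeta> wr)" for zs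
    by (induction zs) (simp_all add: support_poly_def o_def map_replicate_const L(4))
  hence "support_poly bs = (\<Prod>\<zeta>|poly wr \<zeta> = 0. [:-\<zeta>, 1:] ^ order \<zeta> wr)"
    unfolding bs_def using zs by (simp add: prod.distinct_set_conv_list[symmetric])
  hence "Polynomial.smult (lead_coeff wr) (support_poly bs) = wr" by (simp add: complex_poly_decompose)
  moreover have "c (poly (E f)) = 0" if "c \<in> set (map snd bs)" for c f
    using that L(5) unfolding snd by auto
  ultimately show thesis by (rule that)
qed

lemma E_degree:
  assumes "degree p < m" "length fs \<le> m"
  shows "degree (E p) < m - length fs + degree wr \<or> E p = 0"
  using degree_wronskian_snoc[OF indep, of p] assms unfolding E_def wr_def by fastforce

text \<open>The conditions cut out exactly the image of \<open>E\<close>: on polynomials of bounded degree both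
  spaces have codimension \<open>degree wr\<close>.\<close>

lemma killed_imp_in_range:
  assumes bs: "homogeneous_basis (functional.span (set (map snd bs))) bs"
    and len: "length bs = degree wr"
    and kill: "\<And>c f. c \<in> set (map snd bs) \<Longrightarrow> c (poly (E f)) = 0"
    and g: "\<And>c. c \<in> set (map snd bs) \<Longrightarrow> c (poly g) = 0"
  shows "g \<in> range E"
proof -
  let ?cs = "map snd bs" and ?l = "length fs"
  note hb = homogeneous_basis_facts[OF bs]
  have hom: "homogeneous (functional.span (set ?cs))" using bs unfolding homogeneous_def by blast
  obtain r where r: "r \<noteq> 0"
    "\<And>c h. c \<in> functional.span (set ?cs) \<Longrightarrow> entire h \<Longrightarrow> c (\<lambda>w. poly r w * h w) = 0"
    by (rule common_kill[OF hom], rule that)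
  \<comment> \<open>Large enough that \<open>fs\<close> has degrees below \<open>m\<close> while
    \<open>g\<close> and the common annihilator \<open>r\<close> have degrees below
    \<open>n\<close>; \<open>E\<close> takes degrees below \<open>m\<close> to degrees below
    \<open>n\<close>.\<close>
  define m where "m = Suc (?l + (\<Sum>f\<in>set fs. degree f) + degree r + degree g)"
  define n where "n = m - ?l + degree wr"
  have m: "?l \<le> m" "degree r < n" "degree g < n" by (simp_all add: m_def n_def)
  have degm: "degree f < m" if "f \<in> set fs" for f
    using member_le_sum[OF that, of degree] by (simp add: m_def)
  obtain G where G: "finite G" "card G + card (set fs) = m" "G \<inter> set fs = {}"
    "poly_vs.independent (G \<union> set fs)" "\<And>p. p \<in> G \<Longrightarrow> \<forall>i\<ge>m. poly.coeff p i = 0"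
    by (rule independent_poly_complement[OF _ fs_independent(2) degm]) (simp, assumption, rule that)
  have cardG: "card G + ?l = m" using G(2) fs_independent(1) by (simp add: distinct_card)
  obtain gs where gs: "set gs = G" "distinct gs" using finite_distinct_list[OF G(1)] by auto
  have lgs: "length gs = m - ?l" using distinct_card[OF gs(2)] gs(1) cardG by simp
  \<comment> \<open>\<open>E\<close> is injective on the span of \<open>G\<close>, which meets the
    kernel of \<open>E\<close>, spanned by \<open>fs\<close>, only in 0.\<close>
  have T: "distinct (map E gs) \<and> poly_vs.independent (set (map E gs))"
  proof (rule poly_vs.independent_listI)
    fix a assume "(\<Sum>i<length (map E gs). Polynomial.smult (a i) (map E gs ! i)) = 0"
    hence "E (\<Sum>i<length gs. Polynomial.smult (a i) (gs ! i)) = 0" by (simp add: E_sum)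
    then obtain b where b: "(\<Sum>i<length gs. Polynomial.smult (a i) (gs ! i)) = (\<Sum>i<?l. Polynomial.smult (b i) (fs ! i))"
      by (rule E_kernel)
    define a' where "a' = (\<lambda>i. if i < length gs then a i else - b (i - length gs))"
    have "(\<Sum>i<length (gs @ fs). Polynomial.smult (a' i) ((gs @ fs) ! i)) =
        (\<Sum>i<length gs. Polynomial.smult (a' i) ((gs @ fs) ! i)) +
        (\<Sum>i<?l. Polynomial.smult (a' (i + length gs)) ((gs @ fs) ! (i + length gs)))"
      unfolding length_append by (rule sum_lessThan_add)
    also have "(\<Sum>i<length gs. Polynomial.smult (a' i) ((gs @ fs) ! i)) = (\<Sum>i<length gs. Polynomial.smult (a i) (gs ! i))"
      by (rule sum.cong) (auto simp: a'_def nth_append)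
    also have "(\<Sum>i<?l. Polynomial.smult (a' (i + length gs)) ((gs @ fs) ! (i + length gs))) =
        - (\<Sum>i<?l. Polynomial.smult (b i) (fs ! i))"
      by (simp add: a'_def nth_append sum_negf)
    finally have "(\<Sum>i<length (gs @ fs). Polynomial.smult (a' i) ((gs @ fs) ! i)) = 0" using b by simp
    moreover have "distinct (gs @ fs)" using gs fs_independent(1) G(3) by auto
    moreover have "poly_vs.independent (set (gs @ fs))" using G(4) gs(1) by simp
    ultimately have "a' i = 0" if "i < length (gs @ fs)" for i
      using poly_vs.independent_list_coeffs that by blast
    hence "a' i = 0" if "i < length gs" for i using that by simp
    thus "\<forall>i<length (map E gs). a i = 0" by (auto simp: a'_def)
  qed
  have "g \<in> poly_vs.span (set (map E gs))"
  proof (rule ccontr)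
    assume not: "g \<notin> poly_vs.span (set (map E gs))"
    define S where "S = insert g (set (map E gs))"
    have S: "finite S" "poly_vs.independent S"
      using poly_vs.independent_insertI[OF not] T by (simp_all add: S_def)
    have "g \<notin> set (map E gs)" using not poly_vs.span_base by blast
    hence cardS: "card S = Suc (m - ?l)" using distinct_card[of "map E gs"] T lgs by (simp add: S_def)
    have degS: "degree p < n" if "p \<in> S" for p
    proof -
      have "degree (E p) < n" if "p \<in> G" for p
      proof -
        have "degree p < m"
          using G(5)[OF that] degm by (metis m_def leading_coeff_0_iff degree_0 not_less zero_less_Suc)
        from E_degree[OF this m(1)] show ?thesis using m(2) by (auto simp: n_def)
      qed
      thus ?thesis using that m(3) gs(1) by (auto simp: S_def)
    qed
    \<comment> \<open>As \<open>S\<close> has \<open>m - ?l + 1\<close> elements, \<open>G2\<close>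
      has one element fewer than there are conditions. Hence a nonzero combination \<open>c\<close>
      of the conditions kills \<open>G2\<close> as well as \<open>S\<close>, and so everything of
      degree below \<open>n\<close>.\<close>
    obtain G2 where G2: "finite G2" "card G2 + card S = n"
      "\<And>p. degree p < n \<Longrightarrow> p \<in> poly_vs.span (G2 \<union> S)"
      by (rule independent_poly_complement[OF S degS]) (assumption, rule that)
    obtain g2s where g2s: "set g2s = G2" "length g2s = card G2"
      using finite_distinct_list[OF G2(1)] by (metis distinct_card)
    let ?\<Phi> = "map (\<lambda>p (c :: functional). c (poly p)) g2s"
    have "\<exists>B'. finite B' \<and> functional.independent B' \<and> B' \<subseteq> functional.span (set ?cs) \<and>
        card (set ?cs) \<le> card B' + length ?\<Phi> \<and> (\<forall>\<phi>\<in>set ?\<Phi>. \<forall>b\<in>B'. \<phi> b = 0)"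
      by (rule functional.independent_in_common_kernel) (use hb(2) in auto)
    then obtain B' where B': "finite B'" "functional.independent B'" "B' \<subseteq> functional.span (set ?cs)"
      "card (set ?cs) \<le> card B' + length ?\<Phi>" "\<And>p c. p \<in> G2 \<Longrightarrow> c \<in> B' \<Longrightarrow> c (poly p) = 0"
      using g2s(1) by auto
    have "card (set ?cs) = degree wr" using distinct_card[OF hb(1)] len by simp
    hence "card B' \<noteq> 0" using B'(4) g2s(2) G2(2) cardS by (simp add: n_def)
    then obtain c where c: "c \<in> B'" by (metis card.empty equals0I)
    have csp: "c \<in> functional.span (set ?cs)" using c B'(3) by blast
    have cD: "c \<in> D_all" using csp hb(6) by blast
    have killS: "c (poly p) = 0" if "p \<in> S" for p
    proof -
      have "d (poly p) = 0" if "d \<in> set ?cs" for d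
        using \<open>p \<in> S\<close> g[OF that] kill[OF that] unfolding S_def by auto
      with csp show ?thesis
        by (induction rule: functional_span_induct) auto
    qed
    have low: "c (poly p) = 0" if "degree p < n" for p
      using G2(3)[OF that]
    proof (induction rule: poly_vs.span_induct_alt)
      case base
      show ?case by (rule D_all_poly_zero[OF cD])
    next
      case (step a x y)
      have "c (poly x) = 0" using step(1) B'(5)[OF _ c] killS by blast
      thus ?case unfolding D_all_poly_add[OF cD] D_all_poly_smult[OF cD] using step by simp
    qed
    \<comment> \<open>Division by \<open>r\<close> passes from degrees below \<open>n\<close> to all
      polynomials, since \<open>c\<close> kills the multiples of \<open>r\<close>.\<close>
    have "c = (\<lambda>_. 0)"
    proof (rule D_all_eq_zeroI[OF cD])
      fix f
      have "degree (f mod r) < n" using degree_mod_less[OF r(1), of f] m(2) by auto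
      hence "c (poly (f mod r)) = 0" by (rule low)
      moreover have "c (poly (r * (f div r))) = 0"
        using r(2)[OF csp, of "poly (f div r)"] by (simp add: poly_mult[abs_def])
      moreover have "c (poly f) = c (poly (r * (f div r))) + c (poly (f mod r))"
        using D_all_poly_add[OF cD, of "r * (f div r)" "f mod r"] by simp
      ultimately show "c (poly f) = 0" by simp
    qed
    hence "0 \<in> B'" using c by (simp add: zero_fun_def)
    thus False using B'(2) functional.dependent_zero by blast
  qed
  thus ?thesis
  proof (induction rule: poly_vs.span_induct_alt)
    case base
    show ?case by (metis E_zero rangeI)
  next
    case (step a x y)
    then obtain u v where "x = E u" "y = E v" by auto
    thus ?case by (metis E_add E_smult rangeI)
  qed
qed

end

section \<open>The symbol of the operator and the wave function of its image\<close>

lemma higher_pderiv_monom_self: "(pderiv ^^ n) (monom c n) = [:fact n * c :: complex:]"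
proof (induction n arbitrary: c)
  case (Suc n)
  have "(pderiv ^^ Suc n) (monom c (Suc n)) = (pderiv ^^ n) (monom (of_nat (Suc n) * c) n)"
    by (simp add: funpow_swap1 pderiv_monom)
  thus ?case unfolding Suc by (simp add: algebra_simps)
qed (simp add: monom_0)

lemma degree_higher_pderiv_le: "degree ((pderiv ^^ n) p) \<le> degree p - n" for p :: "complex poly"
  by (induction n) (auto simp: degree_pderiv)

context poly_operator
begin

text \<open>Read off from the degrees of \<open>E\<close> on monomials.\<close>

lemma coef_degree:
  assumes "i \<le> length fs" "degree wr + i < k + length fs"
  shows "poly.coeff (coef i) k = 0"
  using assms
proof (induction i arbitrary: k rule: less_induct)
  case (less i)
  let ?l = "length fs" and ?m = "\<lambda>j. (pderiv ^^ j) (monom 1 i :: complex poly)"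
  have mi: "?m i = [:fact i:]" using higher_pderiv_monom_self[of i 1] by simp
  have m0: "?m j = 0" if "j > i" for j
  proof -
    obtain k where j: "j = k + Suc i" using \<open>j > i\<close> less_iff_Suc_add[of i j] by (auto simp: add.commute)
    have "?m j = (pderiv ^^ k) (pderiv (?m i))" unfolding j by (simp only: funpow_add o_apply funpow.simps(2))
    also have "pderiv (?m i) = 0" by (simp add: mi pderiv_pCons)
    also have "(pderiv ^^ k) 0 = (0 :: complex poly)" by (induction k) simp_all
    finally show ?thesis .
  qed
  have degm: "degree (?m j) \<le> i - j" for j
    using degree_higher_pderiv_le[of j "monom 1 i"] by (simp add: degree_monom_eq)
  have "E (monom 1 i) = (\<Sum>j\<le>?l. coef j * ?m j)" by (rule E_eq)
  also have "\<dots> = (\<Sum>j\<le>i. coef j * ?m j)"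
    using less.prems(1) by (intro sum.mono_neutral_right) (auto simp: m0 not_le)
  also have "\<dots> = (\<Sum>j<i. coef j * ?m j) + Polynomial.smult (fact i) (coef i)"
    by (simp add: lessThan_Suc_atMost[symmetric] mi mult.commute)
  \<comment> \<open>At the monomial of degree \<open>i\<close> the operator involves only the
    coefficients up to \<open>coef i\<close>, and this one is multiplied by the constant
    \<open>fact i\<close>. So \<open>coef i\<close> is determined by \<open>E (monom 1 i)\<close>
    and the earlier coefficients.\<close>
  finally have eq: "Polynomial.smult (fact i) (coef i) = E (monom 1 i) - (\<Sum>j<i. coef j * ?m j)"
    by (simp add: algebra_simps)
  have "poly.coeff (E (monom 1 i)) k = 0"
  proof (cases "E (monom 1 i) = 0")
    case False
    hence "degree (E (monom 1 i)) + ?l \<le> degree wr + i"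
      using degree_wronskian_snoc[OF indep, of "monom 1 i"] unfolding E_def wr_def
      by (simp add: degree_monom_eq)
    thus ?thesis using less.prems(2) by (intro coeff_eq_0) simp
  qed simp
  moreover have "poly.coeff (coef j * ?m j) k = 0" if j: "j < i" for j
  proof (cases "coef j = 0")
    case False
    have "degree (coef j) + ?l \<le> degree wr + j"
    proof (rule ccontr)
      assume "\<not> degree (coef j) + ?l \<le> degree wr + j"
      hence "poly.coeff (coef j) (degree (coef j)) = 0"
        using less.IH[OF j, of "degree (coef j)"] less.prems(1) j by simp
      thus False using False by simp
    qed
    moreover have "degree (coef j * ?m j) \<le> degree (coef j) + (i - j)"
      using degree_mult_le[of "coef j" "?m j"] degm[of j] by linarith
    ultimately show ?thesis using less.prems(2) j by (intro coeff_eq_0) simp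
  qed simp
  ultimately have "poly.coeff (Polynomial.smult (fact i) (coef i)) k = 0"
    unfolding eq by (simp add: coeff_sum)
  thus ?case by simp
qed

text \<open>Preceded by \<open>E\<close>, the functional \<open>c\<close> becomes another one in
  \<open>D_all\<close>; it vanishes at polynomials and hence at the exponential, on which the
  \<open>i\<close>-th derivative acts as \<open>x ^ i\<close>.\<close>

lemma D_all_symbol:
  assumes c: "c \<in> D_all" and kill: "\<And>f. c (poly (E f)) = 0"
  shows "(\<Sum>i\<le>length fs. x ^ i * c (\<lambda>w. poly (coef i) w * exp (x * w))) = 0"
proof -
  have "\<exists>d\<in>D_all. \<forall>f. entire f \<longrightarrow> d f = c (\<lambda>w. poly (coef i) w * (deriv ^^ i) f w)" for i
  proof -
    obtain e where e: "e \<in> D_all" "\<And>f. entire f \<Longrightarrow> e f = c (\<lambda>w. poly (coef i) w * f w)"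
      by (rule D_all_mult[OF c, of "poly (coef i)"]) (simp, rule that)
    obtain d where d: "d \<in> D_all" "\<And>f. entire f \<Longrightarrow> d f = e ((deriv ^^ i) f)"
      by (rule D_all_higher_deriv[OF e(1)], rule that)
    have "d f = c (\<lambda>w. poly (coef i) w * (deriv ^^ i) f w)" if "entire f" for f
      using d(2)[OF that] e(2)[OF holomorphic_higher_deriv[OF that open_UNIV]] by simp
    thus ?thesis using d(1) by (intro bexI[of _ d] allI impI)
  qed
  then obtain d where d: "\<And>i. d i \<in> D_all"
    "\<And>i f. entire f \<Longrightarrow> d i f = c (\<lambda>w. poly (coef i) w * (deriv ^^ i) f w)" by metis
  define e where "e = (\<lambda>f. \<Sum>i\<le>length fs. 1 * d i f)"
  have "e \<in> D_all" unfolding e_def D_all_def by (intro functional_span_sum) (use d(1) in \<open>simp add: D_all_def\<close>)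
  moreover have "e (poly f) = 0" for f
  proof -
    have "e (poly f) = (\<Sum>i\<le>length fs. 1 * c (poly (coef i * (pderiv ^^ i) f)))"
      by (simp add: e_def d(2) higher_deriv_poly poly_mult[abs_def])
    also have "\<dots> = c (\<lambda>z. \<Sum>i\<le>length fs. 1 * poly (coef i * (pderiv ^^ i) f) z)"
      by (rule D_all_sum[OF c, symmetric]) simp
    also have "(\<lambda>z. \<Sum>i\<le>length fs. 1 * poly (coef i * (pderiv ^^ i) f) z) = poly (E f)"
      by (rule ext) (simp add: E_eq poly_sum)
    finally show ?thesis using kill by simp
  qed
  ultimately have "e = (\<lambda>_. 0)" by (rule D_all_eq_zeroI)
  hence "e (\<lambda>w. exp (w * x)) = 0" by simp
  moreover have "d i (\<lambda>w. exp (w * x)) = x ^ i * c (\<lambda>w. poly (coef i) w * exp (x * w))" for i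
  proof -
    have "d i (\<lambda>w. exp (w * x)) = c (\<lambda>w. poly (coef i) w * (x ^ i * exp (w * x)))"
      using d(2)[of "\<lambda>w. exp (w * x)" i] by (simp add: higher_deriv_exp holomorphic_intros)
    also have "(\<lambda>w. poly (coef i) w * (x ^ i * exp (w * x))) = (\<lambda>w. x ^ i * (poly (coef i) w * exp (x * w)))"
      by (simp add: mult_ac)
    also have "c \<dots> = x ^ i * c (\<lambda>w. poly (coef i) w * exp (x * w))"
      by (rule D_all_cmult[OF c]) (intro holomorphic_intros)
    finally show ?thesis .
  qed
  ultimately show ?thesis by (simp add: e_def)
qed

text \<open>The numerator is the symbol of \<open>E\<close>, with \<open>x\<close> in place of the
  derivation, rescaled to be monic in \<open>z\<close>. The denominators \<open>wr\<close> and
  \<open>q_poly C\<close> differ by a constant, which the image of \<open>E\<close> absorbs.\<close>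

lemma range_operator_wave:
  obtains C where "homogeneous C" "W_of C = {to_fract (E f) / to_fract wr | f. True}"
    "\<And>x z. x \<noteq> 0 \<Longrightarrow> tau C x \<noteq> 0 \<Longrightarrow> poly wr z \<noteq> 0 \<Longrightarrow>
      wave_of_conditions C x z = (\<Sum>i\<le>length fs. poly (coef i) z * x ^ i) * exp (x * z) / (x ^ length fs * poly wr z)"
proof -
  let ?l = "length fs"
  obtain bs where bs: "homogeneous_basis (functional.span (set (map snd bs))) bs"
    and wr: "Polynomial.smult (lead_coeff wr) (support_poly bs) = wr"
    and kill: "\<And>c f. c \<in> set (map snd bs) \<Longrightarrow> c (poly (E f)) = 0"
    by (rule condition_basis, rule that)
  define C where "C = functional.span (set (map snd bs))"
  have hom: "homogeneous C" using bs unfolding homogeneous_def C_def by blast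
  have q: "q_poly C = support_poly bs" unfolding C_def by (rule q_poly_eq_support_poly[OF bs])
  have lc: "lead_coeff wr \<noteq> 0" using wr_nonzero by simp
  have len: "length bs = degree wr"
    using support_poly_degree[of bs] arg_cong[OF wr, of degree] lc by simp
  have CD: "C \<subseteq> D_all" by (rule homogeneous_in_D_all[OF hom])
  have killC: "c (poly (E f)) = 0" if "c \<in> C" for c f
    using that unfolding C_def by (induction rule: functional_span_induct) (use kill in auto)
  have "W_of C = {to_fract (E f) / to_fract wr | f. True}"
  proof (intro equalityI subsetI)
    fix w assume "w \<in> W_of C"
    then obtain g where g: "w = to_fract g / to_fract (q_poly C)" "\<forall>c\<in>C. c (poly g) = 0"
      unfolding W_of_def by (elim CollectE exE conjE)
    have "g \<in> range E"
    proof (rule killed_imp_in_range[OF bs len])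
      fix c assume "c \<in> set (map snd bs)"
      thus "c (poly g) = 0" using g(2) functional.span_base unfolding C_def by blast
    qed (rule kill)
    then obtain f where f: "g = E f" by auto
    have "w = to_fract (E (Polynomial.smult (lead_coeff wr) f)) / to_fract wr"
    proof -
      have "to_fract (E (Polynomial.smult (lead_coeff wr) f)) = to_fract [:lead_coeff wr:] * to_fract g"
        by (simp add: E_smult f flip: to_fract_mult)
      moreover have "to_fract wr = to_fract [:lead_coeff wr:] * to_fract (q_poly C)"
        using wr by (simp add: q flip: to_fract_mult)
      moreover have "to_fract [:lead_coeff wr:] \<noteq> 0" using lc by (simp add: to_fract_eq_0_iff)
      ultimately show ?thesis unfolding g(1) by simp
    qed
    thus "w \<in> {to_fract (E f) / to_fract wr | f. True}" by blast
  next
    fix w assume "w \<in> {to_fract (E f) / to_fract wr | f. True}"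
    then obtain f where f: "w = to_fract (E f) / to_fract wr" by blast
    define g where "g = E (Polynomial.smult (1 / lead_coeff wr) f)"
    have "w = to_fract g / to_fract (q_poly C)"
    proof -
      have "Polynomial.smult (lead_coeff wr) g = E f" using lc by (simp add: g_def E_smult)
      hence "to_fract (E f) = to_fract [:lead_coeff wr:] * to_fract g"
        by (simp flip: to_fract_mult)
      moreover have "to_fract wr = to_fract [:lead_coeff wr:] * to_fract (q_poly C)"
        using wr by (simp add: q flip: to_fract_mult)
      moreover have "to_fract [:lead_coeff wr:] \<noteq> 0" using lc by (simp add: to_fract_eq_0_iff)
      ultimately show ?thesis unfolding f by simp
    qed
    thus "w \<in> W_of C" unfolding W_of_def using killC by (auto simp: g_def)
  qed
  moreover have "wave_of_conditions C x z =
      (\<Sum>i\<le>?l. poly (coef i) z * x ^ i) * exp (x * z) / (x ^ ?l * poly wr z)"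
    if x: "x \<noteq> 0" "tau C x \<noteq> 0" and z: "poly wr z \<noteq> 0" for x z
  proof -
    define S where "S = (\<Sum>i\<le>?l. Polynomial.smult (x ^ i) (coef i))"
    \<comment> \<open>Among the coefficients only \<open>coef ?l = wr\<close> reaches degree
      \<open>degree wr\<close>, so the leading coefficient of \<open>S\<close> is
      \<open>x ^ ?l * lead_coeff wr\<close>, which is nonzero because
      \<open>x \<noteq> 0\<close>.\<close>
    define b where "b = 1 / (x ^ ?l * lead_coeff wr)"
    have b: "b \<noteq> 0" using x lc by (simp add: b_def)
    have coeff: "poly.coeff S k = (if k = degree wr then x ^ ?l * lead_coeff wr else 0)" if "k \<ge> degree wr" for k
    proof -
      have "poly.coeff S k = (\<Sum>i\<le>?l. x ^ i * poly.coeff (coef i) k)" by (simp add: S_def coeff_sum)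
      also have "\<dots> = (\<Sum>i\<in>{?l}. x ^ i * poly.coeff (coef i) k)"
        using that by (intro sum.mono_neutral_right) (auto intro!: coef_degree)
      finally show ?thesis using that by (auto simp: coef_length intro!: coeff_eq_0)
    qed
    define P where "P = Polynomial.smult b S"
    have degP: "degree P = degree (q_poly C)"
    proof -
      have "degree S = degree wr"
      proof (rule antisym)
        show "degree S \<le> degree wr" by (rule degree_le) (use coeff in auto)
        have "poly.coeff S (degree wr) \<noteq> 0" unfolding coeff[OF order_refl] using x lc by simp
        thus "degree wr \<le> degree S" by (rule le_degree)
      qed
      thus ?thesis using b support_poly_degree[of bs] len by (simp add: P_def q)
    qed
    have "lead_coeff P = 1"
      using support_poly_degree[of bs] len coeff[of "degree wr"] x lc unfolding degP q
      by (simp add: P_def b_def)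
    moreover have "c (\<lambda>w. poly P w * exp (x * w)) = 0" if c: "c \<in> C" for c
    proof -
      have cD: "c \<in> D_all" using c CD by blast
      have "(\<lambda>w. poly P w * exp (x * w)) = (\<lambda>w. \<Sum>i\<le>?l. (b * x ^ i) * (poly (coef i) w * exp (x * w)))"
        by (simp add: P_def S_def poly_sum sum_distrib_left sum_distrib_right mult_ac)
      hence "c (\<lambda>w. poly P w * exp (x * w)) = c (\<lambda>w. \<Sum>i\<le>?l. (b * x ^ i) * (poly (coef i) w * exp (x * w)))"
        by (rule arg_cong)
      also have "\<dots> = (\<Sum>i\<le>?l. (b * x ^ i) * c (\<lambda>w. poly (coef i) w * exp (x * w)))"
        by (rule D_all_sum[OF cD]) (intro holomorphic_intros)
      also have "\<dots> = b * (\<Sum>i\<le>?l. x ^ i * c (\<lambda>w. poly (coef i) w * exp (x * w)))"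
        by (simp add: sum_distrib_left mult.assoc)
      also have "\<dots> = 0" using D_all_symbol[OF cD killC[OF c]] by simp
      finally show ?thesis .
    qed
    ultimately have "wave_of_conditions C x z = poly P z * exp (x * z) / poly (q_poly C) z"
      by (intro wave_of_conditions_eq[OF hom x(2) degP])
    moreover have "poly wr z = lead_coeff wr * poly (q_poly C) z"
      using arg_cong[OF wr, of "\<lambda>p. poly p z"] by (simp add: q)
    moreover have "poly P z = b * (\<Sum>i\<le>?l. poly (coef i) z * x ^ i)"
      by (simp add: P_def S_def poly_sum mult.commute)
    ultimately show ?thesis using lc x z by (simp add: b_def)
  qed
  ultimately show thesis using that[OF hom] by blast
qed

end

section \<open>Exceptional Hermite functions\<close>

text \<open>The generating function read as a Taylor expansion in \<open>z\<close> at 0. Written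
  with \<open>ev\<close>, it shows the Hermite polynomial to be the exponential transform of a
  hatted condition.\<close>

lemma poly_hermite: "poly (hermite y n) x = ev n 0 (\<lambda>z. exp (y * z ^ 2) * exp (x * z))"
proof -
  let ?g = "\<lambda>z. exp (x * z + y * z ^ 2)"
  let ?F = "Abs_fps (\<lambda>n. poly (hermite y n) x / fact n)"
  have s: "(\<lambda>n. fps_nth ?F n * z ^ n) sums ?g z" for z
    using hermite_generating_function[of y x z] by simp
  have "fps_conv_radius ?F \<ge> 1"
    unfolding fps_conv_radius_def
    using conv_radius_geI[OF sums_summable[OF s[of 1]]] by (simp add: one_ereal_def)
  hence "fps_conv_radius ?F > 0" by (rule less_le_trans[rotated]) simp
  moreover have "eval_fps ?F z = ?g z" for z
    unfolding eval_fps_def by (rule sums_unique[OF s, symmetric])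
  ultimately have "?g has_fps_expansion ?F" unfolding has_fps_expansion_def by simp
  from fps_nth_fps_expansion[OF this, of n] have "poly (hermite y n) x = (deriv ^^ n) ?g 0"
    by simp
  moreover have "?g = (\<lambda>z. exp (y * z ^ 2) * exp (x * z))"
    by (simp add: exp_add mult.commute)
  moreover have "entire (\<lambda>z. exp (y * z ^ 2) * exp (x * z))" by (intro holomorphic_intros)
  ultimately show ?thesis by (simp add: ev_def)
qed

lemma hermite_monic: "degree (hermite y n) = n" "poly.coeff (hermite y n) n = 1"
proof -
  define g where "g = (\<lambda>i. (deriv ^^ i) (\<lambda>z. exp (y * z ^ 2)) 0)"
  \<comment> \<open>The Leibniz expansion of the derivatives of the product
    \<open>exp (y * z ^ 2) * exp (x * z)\<close> at 0; the leading coefficient comes from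
    \<open>g 0 = 1\<close>.\<close>
  define H where "H = (\<Sum>i=0..n. monom (of_nat (n choose i) * g i) (n - i))"
  have "poly (hermite y n) x = poly H x" for x
  proof -
    have "poly (hermite y n) x = (deriv ^^ n) (\<lambda>z. exp (y * z ^ 2) * exp (x * z)) 0"
      unfolding poly_hermite ev_def by (simp add: holomorphic_intros)
    also have "\<dots> = (\<Sum>i=0..n. of_nat (n choose i) * g i * (deriv ^^ (n - i)) (\<lambda>z. exp (x * z)) 0)"
      unfolding g_def by (rule higher_deriv_mult[of _ UNIV]) (auto intro!: holomorphic_intros)
    also have "\<dots> = poly H x"
    proof -
      have "(deriv ^^ k) (\<lambda>z. exp (x * z)) 0 = x ^ k" for k
        using ev_exp[of k 0 x] by (simp add: ev_def)
      thus ?thesis by (simp add: H_def poly_sum poly_monom)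
    qed
    finally show ?thesis .
  qed
  hence H: "hermite y n = H" by (metis poly_eq_poly_eq_iff ext)
  have "poly.coeff H n = (\<Sum>i=0..n. if i = 0 then 1 else 0)"
    unfolding H_def coeff_sum by (rule sum.cong) (auto simp: g_def)
  thus c: "poly.coeff (hermite y n) n = 1" by (simp add: H)
  have "degree H \<le> n" unfolding H_def
    by (intro degree_sum_le) (auto intro: order.trans[OF degree_monom_le])
  moreover have "n \<le> degree H" using c by (intro le_degree) (simp add: H)
  ultimately show "degree (hermite y n) = n" by (simp add: H)
qed

lemma span_monic_sequence:
  assumes "\<And>n. degree (H n) = n" "\<And>n. poly.coeff (H n) n = 1"
  shows "p \<in> poly_vs.span (range H)"
proof (induction "degree p" arbitrary: p rule: less_induct)
  case less
  define q where "q = p - Polynomial.smult (lead_coeff p) (H (degree p))"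
  have base: "Polynomial.smult a (H n) \<in> poly_vs.span (range H)" for a n
    by (intro poly_vs.span_scale poly_vs.span_base) simp
  have "q \<in> poly_vs.span (range H)"
  proof (cases "degree p = 0")
    case True
    have "H 0 = [:1:]" using assms[of 0] by (metis degree_eq_zeroE coeff_pCons_0)
    hence "q = 0" using True by (auto simp: q_def elim!: degree_eq_zeroE)
    thus ?thesis by (simp add: poly_vs.span_zero)
  next
    case False
    have "poly.coeff q k = 0" if "k \<ge> degree p" for k
    proof (cases "k = degree p")
      case True thus ?thesis by (simp add: q_def assms)
    next
      case False
      thus ?thesis using that assms(1)[of "degree p"] by (simp add: q_def coeff_eq_0)
    qed
    hence "degree q \<le> degree p - 1" by (intro degree_le) auto
    hence "degree q < degree p" using False by simp
    thus ?thesis by (rule less)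
  qed
  from poly_vs.span_add[OF this base[of "lead_coeff p" "degree p"]] show ?case by (simp add: q_def)
qed

text \<open>Among the terms of a nontrivial relation that have a nonzero coefficient, only the one
  of largest degree reaches that degree.\<close>

lemma indep_list_distinct_degrees:
  fixes H :: "nat \<Rightarrow> complex poly"
  assumes H: "\<And>n. degree (H n) = n" "\<And>n. poly.coeff (H n) n = 1" and "distinct ks"
  shows "poly_wr.indep_list (map H ks)"
  unfolding poly_wr.indep_list_def
proof (intro allI impI, rule ccontr)
  fix a i assume 0: "(\<Sum>i<length (map H ks). [:a i:] * map H ks ! i) = 0"
    and i: "i < length (map H ks)" "a i \<noteq> 0"
  define I where "I = {j. j < length ks \<and> a j \<noteq> 0}"
  have I: "finite I" "I \<noteq> {}" using i by (auto simp: I_def)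
  then obtain j where j: "j \<in> I" "ks ! j = Max ((!) ks ` I)"
    by (metis (no_types, lifting) Max_in finite_imageI image_iff image_is_empty)
  have "poly.coeff (\<Sum>i<length ks. Polynomial.smult (a i) (H (ks ! i))) (ks ! j) =
      (\<Sum>i<length ks. if i = j then a j else 0)"
    unfolding coeff_sum
  proof (rule sum.cong)
    fix k assume k: "k \<in> {..<length ks}"
    show "poly.coeff (Polynomial.smult (a k) (H (ks ! k))) (ks ! j) = (if k = j then a j else 0)"
    proof (cases "k = j \<or> a k = 0")
      case True thus ?thesis using H(2) j(1) by (auto simp: I_def)
    next
      case False
      hence "k \<in> I" using k by (simp add: I_def)
      hence "ks ! k \<le> ks ! j" using I(1) by (simp add: j(2))
      moreover have "ks ! k \<noteq> ks ! j"
        using False k j(1) \<open>distinct ks\<close> by (simp add: I_def nth_eq_iff_index_eq)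
      ultimately have "poly.coeff (H (ks ! k)) (ks ! j) = 0" using H(1) by (intro coeff_eq_0) simp
      thus ?thesis using False by simp
    qed
  qed simp
  also have "\<dots> = a j" using j(1) by (simp add: I_def)
  finally have "a j = 0" using 0 by simp
  thus False using j(1) by (simp add: I_def)
qed

lemma hat_ev:
  shows "hat y (ev k 0) \<in> D_at 0" "hat y (ev k 0) (\<lambda>w. exp (x * w)) = poly (hermite y k) x"
proof -
  have u: "entire (\<lambda>z. exp (y * z ^ 2))" by (intro holomorphic_intros)
  obtain d where d: "d \<in> D_at 0" "\<And>f. entire f \<Longrightarrow> d f = ev k 0 (\<lambda>z. exp (y * z ^ 2) * f z)"
    by (rule D_at_mult[OF ev_in_D_at u], rule that)
  have "hat y (ev k 0) f = d f" for f
  proof (cases "entire f")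
    case False
    \<comment> \<open>The factor has an entire inverse, so a product with it is entire only if
      \<open>f\<close> is; hence the default values of both functionals agree.\<close>
    have "\<not> entire (\<lambda>z. exp (y * z ^ 2) * f z)"
    proof
      assume "entire (\<lambda>z. exp (y * z ^ 2) * f z)"
      hence "entire (\<lambda>z. exp (- (y * z ^ 2)) * (exp (y * z ^ 2) * f z))"
        by (rule entire_mult[rotated]) (intro holomorphic_intros)
      moreover have "(\<lambda>z. exp (- (y * z ^ 2)) * (exp (y * z ^ 2) * f z)) = f"
        by (rule ext) (simp add: exp_minus)
      ultimately show False using False by (simp only:)
    qed
    moreover have "d f = 0" using D_all_not_entire[OF _ False] d(1) D_at_le_D_all by blast
    ultimately show ?thesis by (simp add: hat_def ev_def)
  qed (simp add: hat_def d(2))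
  hence "hat y (ev k 0) = d" by (rule ext)
  thus "hat y (ev k 0) \<in> D_at 0" using d(1) by simp
  show "hat y (ev k 0) (\<lambda>w. exp (x * w)) = poly (hermite y k) x"
    by (simp add: hat_def poly_hermite)
qed

text \<open>Independence is read off from the exponential transforms, which are Hermite polynomials
  of distinct degrees.\<close>

lemma hat_homogeneous_basis:
  assumes "distinct ks"
  shows "homogeneous_basis (hat y ` functional.span ((\<lambda>k. ev k 0) ` set ks)) (map (\<lambda>k. (0, hat y (ev k 0))) ks)"
  unfolding homogeneous_basis_def
proof (intro conjI)
  let ?bs = "map (\<lambda>k. (0 :: complex, hat y (ev k 0))) ks"
  have snd: "map snd ?bs = map (\<lambda>k. hat y (ev k 0)) ks" by simp
  have "distinct (map snd ?bs) \<and> functional.independent (set (map snd ?bs))"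
  proof (rule functional.independent_listI)
    fix a assume "(\<Sum>i<length (map snd ?bs). (\<lambda>f. a i * (map snd ?bs ! i) f)) = 0"
    hence 0: "(\<Sum>i<length ks. (\<lambda>f. a i * hat y (ev (ks ! i) 0) f)) = 0" by simp
    have "poly (\<Sum>i<length ks. Polynomial.smult (a i) (hermite y (ks ! i))) x = 0" for x
      using arg_cong[OF 0, of "\<lambda>c. c (\<lambda>w. exp (x * w))"] by (simp add: sum_apply hat_ev poly_sum)
    hence "(\<Sum>i<length (map (hermite y) ks). [:a i:] * map (hermite y) ks ! i) = 0"
      by (simp add: poly_all_0_iff_0[symmetric])
    moreover have "poly_wr.indep_list (map (hermite y) ks)"
      by (rule indep_list_distinct_degrees[OF hermite_monic assms])
    ultimately show "\<forall>i<length (map snd ?bs). a i = 0"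
      unfolding poly_wr.indep_list_def by simp
  qed
  thus "distinct (map snd ?bs)" "functional.independent (set (map snd ?bs))" by blast+
  show "\<forall>(\<zeta>, c)\<in>set ?bs. c \<in> D_at \<zeta>" using hat_ev(1) by auto
  show "functional.span (set (map snd ?bs)) = hat y ` functional.span ((\<lambda>k. ev k 0) ` set ks)"
  proof (intro equalityI subsetI)
    fix c assume "c \<in> functional.span (set (map snd ?bs))"
    thus "c \<in> hat y ` functional.span ((\<lambda>k. ev k 0) ` set ks)"
    proof (induction rule: functional_span_induct)
      case zero
      show ?case by (rule image_eqI[of _ _ "\<lambda>_. 0"]) (auto simp: hat_def functional_span_zero)
    next
      case (step a x c)
      then obtain k d where k: "k \<in> set ks" "x = hat y (ev k 0)"
        and d: "d \<in> functional.span ((\<lambda>k. ev k 0) ` set ks)" "c = hat y d" by auto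
      have "(\<lambda>f. a * ev k 0 f + d f) \<in> functional.span ((\<lambda>k. ev k 0) ` set ks)"
        using k by (intro functional_span_step functional.span_base d) simp
      moreover have "(\<lambda>f. a * x f + c f) = hat y (\<lambda>f. a * ev k 0 f + d f)" by (simp add: hat_def k d)
      ultimately show ?case by blast
    qed
  next
    fix c assume "c \<in> hat y ` functional.span ((\<lambda>k. ev k 0) ` set ks)"
    then obtain d where "d \<in> functional.span ((\<lambda>k. ev k 0) ` set ks)" "c = hat y d" by blast
    thus "c \<in> functional.span (set (map snd ?bs))"
    proof (induction arbitrary: c rule: functional_span_induct)
      case zero
      thus ?case by (simp add: hat_def functional_span_zero)
    next
      case (step a x d)
      from step obtain k where k: "k \<in> set ks" "x = ev k 0" by auto
      have "(\<lambda>f. a * hat y (ev k 0) f + hat y d f) \<in> functional.span (set (map snd ?bs))"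
        by (rule functional_span_step[OF functional.span_base step.IH[OF refl]]) (use k in auto)
      thus ?case using step.prems k by (simp add: hat_def)
    qed
  qed
qed

text \<open>The numerator is the symbol of \<open>E\<close> with coefficients evaluated at
  \<open>x\<close>, divided by \<open>wr\<close> at \<open>x\<close>. A hatted condition turns
  \<open>w ^ i * exp (x * w)\<close> into the \<open>i\<close>-th derivative of a Hermite polynomial
  at \<open>x\<close>, and \<open>E\<close> annihilates that polynomial. The right-hand side is that
  of \<open>range_operator_wave\<close> with the variables exchanged.\<close>

lemma hat_wave:
  fixes ks :: "nat list" and y :: complex
  defines "fs \<equiv> map (hermite y) ks" and "C \<equiv> hat y ` functional.span ((\<lambda>k. ev k 0) ` set ks)"
  assumes ks: "distinct ks" and x: "tau C x \<noteq> 0" "poly (wronskian pderiv fs) x \<noteq> 0"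
  shows "wave_of_conditions C x z =
    (\<Sum>i\<le>length fs. poly (poly_operator.coef fs i) x * z ^ i) * exp (x * z) /
      (z ^ length fs * poly (wronskian pderiv fs) x)"
proof -
  interpret poly_operator fs
    by unfold_locales (simp add: fs_def indep_list_distinct_degrees[OF hermite_monic ks])
  let ?l = "length fs" and ?bs = "map (\<lambda>k. (0 :: complex, hat y (ev k 0))) ks"
  have hb: "homogeneous_basis C ?bs" unfolding C_def by (rule hat_homogeneous_basis[OF ks])
  hence hom: "homogeneous C" unfolding homogeneous_def by blast
  have wx: "poly wr x \<noteq> 0" using x(2) by (simp add: wr_def)
  have "support_poly ?bs = monom 1 (length ks)"
    by (induction ks) (simp_all add: support_poly_def monom_Suc monom_0)
  hence q: "q_poly C = monom 1 ?l" using q_poly_eq_support_poly[OF hb] by (simp add: fs_def)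
  define P where "P = (\<Sum>i\<le>?l. monom (poly (coef i) x / poly wr x) i)"
  have coeff: "poly.coeff P i = (if i \<le> ?l then poly (coef i) x / poly wr x else 0)" for i
    by (simp add: P_def coeff_sum)
  have degP: "degree P = ?l"
  proof (rule antisym)
    show "degree P \<le> ?l" by (rule degree_le) (simp add: coeff)
    show "?l \<le> degree P" by (rule le_degree) (simp add: coeff coef_length wx)
  qed
  have kill: "c (\<lambda>w. poly P w * exp (x * w)) = 0" if "c \<in> set (map snd ?bs)" for c
  proof -
    obtain k where k: "k \<in> set ks" "c = hat y (ev k 0)" using \<open>c \<in> set (map snd ?bs)\<close> by auto
    have cD: "c \<in> D_all" unfolding k(2) using hat_ev(1) D_at_le_D_all by blast
    have "c (\<lambda>w. w ^ i * exp (x * w)) = poly ((pderiv ^^ i) (hermite y k)) x" for i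
    proof -
      have "(\<lambda>x. c (\<lambda>w. exp (x * w))) = poly (hermite y k)" unfolding k(2) hat_ev(2) ..
      from D_all_exp_higher_deriv[OF cD, of i, unfolded this higher_deriv_poly] show ?thesis
        by (metis (no_types))
    qed
    hence "c (\<lambda>w. poly P w * exp (x * w)) =
        (\<Sum>i\<le>?l. poly (coef i) x / poly wr x * poly ((pderiv ^^ i) (hermite y k)) x)"
      unfolding D_all_poly[OF cD] degP by (intro sum.cong) (auto simp: coeff)
    also have "\<dots> = poly (E (hermite y k)) x / poly wr x"
      by (simp add: E_eq poly_sum sum_divide_distrib)
    also have "E (hermite y k) = 0" by (rule E_fs) (simp add: fs_def k(1))
    finally show ?thesis by simp
  qed
  have "wave_of_conditions C x z = poly P z * exp (x * z) / poly (q_poly C) z"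
  proof (rule wave_of_conditions_eq[OF hom x(1)])
    show "degree P = degree (q_poly C)" by (simp add: degP q degree_monom_eq)
    show "lead_coeff P = 1" by (simp add: degP coeff coef_length wx)
    fix c assume "c \<in> C"
    hence "c \<in> functional.span (set (map snd ?bs))" using homogeneous_basis_facts(3)[OF hb] by simp
    thus "c (\<lambda>w. poly P w * exp (x * w)) = 0"
      by (induction rule: functional_span_induct) (use kill in auto)
  qed
  moreover have "poly P z = (\<Sum>i\<le>?l. poly (coef i) x * z ^ i) / poly wr x"
    by (simp add: P_def poly_sum poly_monom sum_divide_distrib)
  ultimately show ?thesis by (simp add: q poly_monom wr_def)
qed

section \<open>Partitions and their index sets\<close>

lemma finite_initial_segment:
  fixes S :: "nat set"
  assumes "finite S" "S \<subseteq> {1..}" "\<And>i j. i \<in> S \<Longrightarrow> 1 \<le> j \<Longrightarrow> j \<le> i \<Longrightarrow> j \<in> S"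
  shows "S = {1..card S}"
proof (cases "S = {}")
  case False
  have "S = {1..Max S}"
  proof (intro equalityI subsetI)
    fix i assume "i \<in> S"
    thus "i \<in> {1..Max S}" using assms(1,2) by (auto intro: Max_ge)
  next
    fix i assume "i \<in> {1..Max S}"
    thus "i \<in> S" using assms(3)[OF Max_in[OF assms(1) False], of i] by auto
  qed
  hence "card S = Max S" by (metis card_atLeastAtMost diff_Suc_1 One_nat_def add_diff_cancel_right' Suc_eq_plus1)
  thus ?thesis using \<open>S = {1..Max S}\<close> by simp
qed simp

lemma partition_facts:
  assumes "is_partition lam"
  shows "1 \<le> i \<Longrightarrow> lam i \<noteq> 0 \<longleftrightarrow> i \<le> part_length lam"
    "1 \<le> i \<Longrightarrow> i < j \<Longrightarrow> m_seq lam j < m_seq lam i"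
proof -
  let ?S = "{i. 1 \<le> i \<and> lam i \<noteq> 0}"
  have anti: "lam j \<le> lam i" if "1 \<le> i" "i \<le> j" for i j
    using assms that unfolding is_partition_def monotone_on_def by simp
  have fin: "finite ?S" using assms unfolding is_partition_def by blast
  have down: "j \<in> ?S" if "i \<in> ?S" "1 \<le> j" "j \<le> i" for i j
  proof -
    have "lam i \<noteq> 0" "lam i \<le> lam j" using anti[of j i] that by auto
    thus ?thesis using that(2) by simp
  qed
  have "?S \<subseteq> {1..}" by auto
  from finite_initial_segment[OF fin this down] have S: "?S = {1..part_length lam}"
    unfolding part_length_def .
  show "lam i \<noteq> 0 \<longleftrightarrow> i \<le> part_length lam" if "1 \<le> i"
  proof -
    have "i \<in> ?S \<longleftrightarrow> i \<in> {1..part_length lam}" by (simp only: S)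
    thus ?thesis using that by simp
  qed
  show "1 \<le> i \<Longrightarrow> i < j \<Longrightarrow> m_seq lam j < m_seq lam i"
    using anti[of i j] by (simp add: m_seq_def)
qed

lemma k_seq_int:
  assumes "is_partition lam" "1 \<le> i" "i \<le> part_length lam"
  shows "int (k_seq lam i) = m_seq lam i + int (part_length lam)"
  using assms by (simp add: k_seq_def m_seq_def)

definition k_list :: "(nat \<Rightarrow> nat) \<Rightarrow> nat list" where
  "k_list lam = map (k_seq lam) (rev [1..<part_length lam + 1])"

lemma distinct_k_list:
  assumes "is_partition lam"
  shows "distinct (k_list lam)"
proof -
  have "inj_on (k_seq lam) {1..<part_length lam + 1}"
  proof (rule inj_onI)
    fix i j assume ij: "i \<in> {1..<part_length lam + 1}" "j \<in> {1..<part_length lam + 1}" "k_seq lam i = k_seq lam j"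
    hence "m_seq lam i = m_seq lam j"
      using k_seq_int[OF assms, of i] k_seq_int[OF assms, of j] by simp
    thus "i = j"
      using partition_facts(2)[OF assms, of i j] partition_facts(2)[OF assms, of j i] ij
      by (cases i j rule: linorder_cases) auto
  qed
  thus ?thesis unfolding k_list_def distinct_map set_rev set_upt by (simp only: distinct_rev distinct_upt)
qed

lemma set_k_list: "set (k_list lam) = k_seq lam ` {1..part_length lam}"
proof -
  have "{1..<part_length lam + 1} = {1..part_length lam}" by auto
  thus ?thesis unfolding k_list_def set_map set_rev set_upt by (simp only:)
qed

lemma J_set_facts:
  assumes "is_partition lam" "m \<in> J_set lam"
  shows "m + int (part_length lam) \<ge> 0" "(\<Prod>i=1..part_length lam. m - m_seq lam i) \<noteq> 0"
proof -
  have ne: "m \<noteq> m_seq lam i" if "1 \<le> i" for i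
    using assms(2) that unfolding J_set_def by auto
  show "m + int (part_length lam) \<ge> 0"
  proof (rule ccontr)
    \<comment> \<open>The index \<open>nat (- m)\<close> then lies beyond the nonzero parts, where
      \<open>m_seq lam i = - int i\<close>, so \<open>m\<close> would be one of the removed
      numbers.\<close>
    assume "\<not> ?thesis"
    hence "nat (- m) > part_length lam" "1 \<le> nat (- m)" by simp_all
    hence "m_seq lam (nat (- m)) = m"
      using partition_facts(1)[OF assms(1), of "nat (- m)"] by (simp add: m_seq_def)
    thus False using ne \<open>1 \<le> nat (- m)\<close> by metis
  qed
  show "(\<Prod>i=1..part_length lam. m - m_seq lam i) \<noteq> 0"
    using ne by (simp add: prod_zero_iff)
qed

text \<open>After the shift by the length, the removed numbers with \<open>i\<close> up to the
  length become the \<open>k_seq lam i\<close>, and all others become negative.\<close>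

lemma J_set_surj:
  assumes lam: "is_partition lam" and n: "n \<notin> set (k_list lam)"
  shows "int n - int (part_length lam) \<in> J_set lam"
proof -
  have "int n - int (part_length lam) \<noteq> m_seq lam i" if i: "1 \<le> i" for i
  proof
    assume eq: "int n - int (part_length lam) = m_seq lam i"
    show False
    proof (cases "i \<le> part_length lam")
      case True
      hence "int (k_seq lam i) = int n" using k_seq_int[OF lam i True] eq by simp
      thus False using n True i unfolding set_k_list by auto
    next
      case False
      hence "m_seq lam i = - int i" using partition_facts(1)[OF lam i] by (simp add: m_seq_def)
      thus False using eq False by linarith
    qed
  qed
  thus ?thesis unfolding J_set_def by auto
qed

text \<open>The normalising factors \<open>\<kappa> m\<close> are nonzero on
  \<open>J_set lam\<close>, so they do not change the span. The Hermite polynomials missing from it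
  are the members of \<open>fs\<close>, whose images are zero.\<close>

lemma exc_space_eq:
  fixes lam y
  defines "fs \<equiv> map (hermite y) (k_list lam)"
  assumes lam: "is_partition lam"
  shows "exc_space lam y = {to_fract (poly_operator.E fs f) / to_fract (wronskian pderiv fs) | f. True}"
proof -
  let ?l = "part_length lam"
  interpret poly_operator fs
    by unfold_locales (simp add: fs_def indep_list_distinct_degrees[OF hermite_monic distinct_k_list[OF lam]])
  define V where "V = {to_fract (E f) / to_fract wr | f. True}"
  define \<kappa> where "\<kappa> = (\<lambda>m. 1 / (of_int (\<Prod>i=1..?l. m - m_seq lam i) :: complex))"
  have fs': "map (\<lambda>i. hermite y (k_seq lam i)) (rev [1..<?l+1]) = fs"
    unfolding fs_def k_list_def map_map o_def ..
  have exc: "exc_hermite lam y m = to_fract [:\<kappa> m:] * (to_fract (E (hermite y (nat (m + int ?l)))) / to_fract wr)" for m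
    unfolding exc_hermite_def Let_def fs' \<kappa>_def E_def wr_def ..
  have \<kappa>: "\<kappa> m \<noteq> 0" if "m \<in> J_set lam" for m
  proof -
    have "(of_int (\<Prod>i=1..?l. m - m_seq lam i) :: complex) \<noteq> 0"
      using J_set_facts(2)[OF lam that] unfolding of_int_eq_0_iff .
    thus ?thesis unfolding \<kappa>_def by (simp del: of_int_prod)
  qed
  have scale: "to_fract [:a:] * (to_fract (E f) / to_fract wr) = to_fract (E (Polynomial.smult a f)) / to_fract wr" for a f
    by (simp add: E_smult flip: to_fract_mult)
  have add: "to_fract (E f) / to_fract wr + to_fract (E g) / to_fract wr = to_fract (E (f + g)) / to_fract wr" for f g
    by (simp add: E_add add_divide_distrib)
  have "exc_space lam y = V"
  proof (intro equalityI subsetI)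
    fix w assume "w \<in> exc_space lam y"
    thus "w \<in> V" unfolding exc_space_def
    proof (induction rule: ratfun.span_induct_alt)
      case base
      have "0 = to_fract (E 0) / to_fract wr" by simp
      thus ?case unfolding V_def by blast
    next
      case (step a v w)
      then obtain m g where m: "v = exc_hermite lam y m" "w = to_fract (E g) / to_fract wr"
        unfolding V_def by blast
      show ?case unfolding m exc scale add V_def by blast
    qed
  next
    fix w assume "w \<in> V"
    then obtain f where f: "w = to_fract (E f) / to_fract wr" unfolding V_def by blast
    have "f \<in> poly_vs.span (range (hermite y))" by (rule span_monic_sequence[OF hermite_monic])
    hence "to_fract (E f) / to_fract wr \<in> exc_space lam y"
    proof (induction rule: poly_vs.span_induct_alt)
      case base
      show ?case unfolding exc_space_def using ratfun.span_zero by simp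
    next
      case (step a h g)
      then obtain n where n: "h = hermite y n" by blast
      have "to_fract (E h) / to_fract wr \<in> exc_space lam y"
      proof (cases "n \<in> set (k_list lam)")
        case True
        hence "E h = 0" by (intro E_fs) (simp add: fs_def n)
        thus ?thesis unfolding exc_space_def using ratfun.span_zero by simp
      next
        case False
        define m where "m = int n - int ?l"
        have m: "m \<in> J_set lam" unfolding m_def by (rule J_set_surj[OF lam False])
        have "to_fract [:1 / \<kappa> m:] * exc_hermite lam y m \<in> exc_space lam y"
          unfolding exc_space_def using m by (intro ratfun.span_scale ratfun.span_base) simp
        also have "to_fract [:1 / \<kappa> m:] * exc_hermite lam y m = to_fract (E h) / to_fract wr"
          unfolding exc scale using \<kappa>[OF m] by (simp add: m_def n)
        finally show ?thesis .
      qed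
      hence "to_fract [:a:] * (to_fract (E h) / to_fract wr) + to_fract (E g) / to_fract wr \<in> exc_space lam y"
        using step(2) unfolding exc_space_def by (intro ratfun.span_add ratfun.span_scale)
      thus ?case unfolding scale add .
    qed
    thus "w \<in> exc_space lam y" by (simp add: f)
  qed
  thus ?thesis by (simp add: V_def wr_def)
qed

theorem proposition4p19:
  fixes lam :: "nat \<Rightarrow> nat" and y :: complex
  assumes "is_partition lam"
  shows "exc_space lam y \<in> Gr_ad \<and> exc_space lam y = bispectral (W_hat lam y)"
proof -
  define ks where "ks = k_list lam"
  define fs where "fs = map (hermite y) ks"
  have ks: "distinct ks" unfolding ks_def by (rule distinct_k_list[OF assms])
  interpret poly_operator fs
    by unfold_locales (simp add: fs_def indep_list_distinct_degrees[OF hermite_monic ks])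
  obtain C where C: "homogeneous C" "W_of C = {to_fract (E f) / to_fract wr | f. True}"
    "\<And>x z. x \<noteq> 0 \<Longrightarrow> tau C x \<noteq> 0 \<Longrightarrow> poly wr z \<noteq> 0 \<Longrightarrow> wave_of_conditions C x z =
      (\<Sum>i\<le>length fs. poly (coef i) z * x ^ i) * exp (x * z) / (x ^ length fs * poly wr z)"
    by (rule range_operator_wave, rule that)
  have exc: "exc_space lam y = W_of C"
    unfolding C(2) wr_def by (rule exc_space_eq[OF assms, of y, folded ks_def, folded fs_def])
  have mem: "exc_space lam y \<in> Gr_ad" unfolding exc Gr_ad_def using C(1) by blast
  define C' where "C' = hat y ` functional.span ((\<lambda>k. ev k 0) ` set ks)"
  have hom': "homogeneous C'"
    using hat_homogeneous_basis[OF ks, of y] unfolding homogeneous_def C'_def by blast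
  have W': "W_hat lam y = W_of C'"
    unfolding W_hat_def C_part_def C'_def ks_def set_k_list image_image ..
  obtain A B where AB: "open A" "closure A = UNIV" "open B" "closure B = UNIV"
    "\<And>x z. x \<in> A \<Longrightarrow> z \<in> B \<Longrightarrow> wave (W_of C) x z = wave_of_conditions C x z" "A \<subseteq> {x. tau C x \<noteq> 0}"
    by (rule wave_eq_on_generic[OF C(1)], rule that)
  obtain A' B' where AB': "open A'" "closure A' = UNIV" "open B'" "closure B' = UNIV"
    "\<And>x z. x \<in> A' \<Longrightarrow> z \<in> B' \<Longrightarrow> wave (W_of C') x z = wave_of_conditions C' x z" "A' \<subseteq> {x. tau C' x \<noteq> 0}"
    by (rule wave_eq_on_generic[OF hom'], rule that)
  have cofinite: "open (- F) \<and> closure (- F) = UNIV" if "finite F" for F :: "complex set"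
    using finite_imp_closed[OF that] empty_interior_finite[OF that] by (simp add: open_Compl closure_complement)
  define F where "F = {z. poly wr z = 0}"
  have finF: "finite F" unfolding F_def by (rule poly_roots_finite[OF wr_nonzero])
  \<comment> \<open>In the wave function of the curve the arguments are exchanged: \<open>x\<close>
    has to be good as a first argument for \<open>C\<close> and as a second one for
    \<open>C'\<close>, and \<open>z\<close> the other way round. Removing 0 and the roots of
    \<open>wr\<close> keeps the closed form's denominator nonzero.\<close>
  define U where "U = (A \<inter> (B' \<inter> - {0})) \<times> (B \<inter> (A' \<inter> - F))"
  have "open U"
    unfolding U_def using cofinite[of "{0}"] cofinite[OF finF] AB AB' by (intro open_Times open_Int) auto
  moreover have "closure U = UNIV"
    unfolding U_def using cofinite[of "{0}"] cofinite[OF finF] AB AB'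
    by (intro closure_Times_UNIV closure_Int_open_dense) auto
  moreover have "wave (exc_space lam y) x z = wave (W_hat lam y) z x" if "(x, z) \<in> U" for x z
  proof -
    have xz: "x \<in> A" "x \<in> B'" "x \<noteq> 0" "z \<in> B" "z \<in> A'" "poly wr z \<noteq> 0"
      using that by (simp_all add: U_def F_def)
    have "wave (exc_space lam y) x z = wave_of_conditions C x z"
      unfolding exc by (rule AB(5)[OF xz(1,4)])
    also have "\<dots> = (\<Sum>i\<le>length fs. poly (coef i) z * x ^ i) * exp (x * z) / (x ^ length fs * poly wr z)"
      using xz AB(6) by (intro C(3)) auto
    also have "\<dots> = wave_of_conditions C' z x"
    proof -
      have "tau C' z \<noteq> 0" using xz(5) AB'(6) by blast
      moreover have "poly (wronskian pderiv fs) z \<noteq> 0" using xz(6) by (simp add: wr_def)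
      ultimately show ?thesis
        using hat_wave[OF ks, of y z x] unfolding C'_def fs_def[symmetric]
        by (simp add: wr_def mult.commute)
    qed
    also have "\<dots> = wave (W_hat lam y) z x" unfolding W' by (rule AB'(5)[OF xz(5,2), symmetric])
    finally show ?thesis .
  qed
  ultimately have wave: "mero_eq (wave (exc_space lam y)) (\<lambda>x z. wave (W_hat lam y) z x)"
    unfolding mero_eq_def by blast
  have "bispectral (W_hat lam y) = exc_space lam y"
    unfolding bispectral_def
    by (rule the_equality) (use mem wave wave_determines in blast)+
  with mem show ?thesis by simp
qed

end
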